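(* For every natural number $M$ there exist a power $q$ of $2$ with $q>M$ and an elliptic curve defined over the rational function field $\mathbb{F}_{q^2}(t)$ whose group of $\mathbb{F}_{q^2}(t)$-rational points has rank equal to $q$.
   Context: $\mathbb{F}_{q^2}(t)$ is the field of rational functions in one variable $t$ over the finite field with $q^2$ elements. The rank of a finitely generated abelian group is its $\mathbb{Z}$-rank. *)

theory Defs
  imports
    "HOL-Algebra.Algebraic_Closure_Type"
    "HOL-Library.Extended_Nat"
    "HOL-Library.Z2"
begin

(* Finite fields of characteristic 2 are realised as finite subfields of the algebraic closure of
   the two-element field, and F(t) as a subset of the field of fractions of the polynomials over
   that closure. This allows the finite field to vary inside a formula. *)

definition rational_functions :: "'a::field set \<Rightarrow> 'a poly fract set" where
  "rational_functions F =
     {Fract p r | p r. (\<forall>i. coeff p i \<in> F) \<and> (\<forall>i. coeff r i \<in> F) \<and> r \<noteq> 0}"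

(* y^2 + A1 x y + A3 y = x^3 + A2 x^2 + A4 x + A6. The general form is needed, since short
   Weierstrass equations are singular in characteristic 2. *)
record 'a weierstrass =
  A1 :: 'a
  A2 :: 'a
  A3 :: 'a
  A4 :: 'a
  A6 :: 'a

definition discriminant :: "'a::field weierstrass \<Rightarrow> 'a" where
  "discriminant E =
     (let b2 = A1 E ^ 2 + 4 * A2 E;
          b4 = 2 * A4 E + A1 E * A3 E;
          b6 = A3 E ^ 2 + 4 * A6 E;
          b8 = A1 E ^ 2 * A6 E + 4 * A2 E * A6 E - A1 E * A3 E * A4 E
                 + A2 E * A3 E ^ 2 - A4 E ^ 2
      in - (b2 ^ 2) * b8 - 8 * b4 ^ 3 - 27 * b6 ^ 2 + 9 * b2 * b4 * b6)"

definition elliptic_curve_over :: "'a::field set \<Rightarrow> 'a weierstrass \<Rightarrow> bool" where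
  "elliptic_curve_over K E \<longleftrightarrow>
     {A1 E, A2 E, A3 E, A4 E, A6 E} \<subseteq> K \<and> discriminant E \<noteq> 0"

datatype 'a point = Infinity | Affine 'a 'a

fun on_curve :: "'a::field weierstrass \<Rightarrow> 'a point \<Rightarrow> bool" where
  "on_curve E Infinity \<longleftrightarrow> True"
| "on_curve E (Affine x y) \<longleftrightarrow>
     y ^ 2 + A1 E * x * y + A3 E * y = x ^ 3 + A2 E * x ^ 2 + A4 E * x + A6 E"

definition rational_points :: "'a::field set \<Rightarrow> 'a weierstrass \<Rightarrow> 'a point set" where
  "rational_points K E =
     {P. on_curve E P \<and> (case P of Infinity \<Rightarrow> True | Affine x y \<Rightarrow> x \<in> K \<and> y \<in> K)}"

(* Chord-tangent law. The negative of (x, y) is (x, - y - A1 x - A3); otherwise l is the slope of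
   the line through the two points (the tangent if they coincide), and y = l x + m is that line.
   For two points on the curve that have the same x and are not mutually inverse, the y-coordinates
   agree, so the tangent branch is the doubling case. *)
fun point_add :: "'a::field weierstrass \<Rightarrow> 'a point \<Rightarrow> 'a point \<Rightarrow> 'a point" where
  "point_add E Infinity Q = Q"
| "point_add E (Affine x1 y1) Infinity = Affine x1 y1"
| "point_add E (Affine x1 y1) (Affine x2 y2) =
     (if x1 = x2 \<and> y2 = - y1 - A1 E * x1 - A3 E then Infinity
      else
        (let l = (if x1 = x2
                  then (3 * x1 ^ 2 + 2 * A2 E * x1 + A4 E - A1 E * y1)
                         / (2 * y1 + A1 E * x1 + A3 E)
                  else (y2 - y1) / (x2 - x1));
             m = y1 - l * x1;
             x3 = l ^ 2 + A1 E * l - A2 E - x1 - x2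
         in Affine x3 (- (l + A1 E) * x3 - m - A3 E)))"

definition mordell_weil_group :: "'a::field set \<Rightarrow> 'a weierstrass \<Rightarrow> 'a point monoid" where
  "mordell_weil_group K E =
     \<lparr>carrier = rational_points K E, monoid.mult = point_add E, one = Infinity\<rparr>"

definition int_independent :: "('a, 'b) monoid_scheme \<Rightarrow> 'a set \<Rightarrow> bool" where
  "int_independent G S \<longleftrightarrow>
     finite S \<and> S \<subseteq> carrier G \<and>
     (\<forall>n :: 'a \<Rightarrow> int. (\<Otimes>\<^bsub>G\<^esub>P\<in>S. P [^]\<^bsub>G\<^esub> n P) = \<one>\<^bsub>G\<^esub> \<longrightarrow> (\<forall>P\<in>S. n P = 0))"

(* Z-rank of a commutative group; the value is infinity if independent sets are unboundedly large,
   so a finite value is always attained. *)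
definition int_rank :: "('a, 'b) monoid_scheme \<Rightarrow> enat" where
  "int_rank G = (SUP S\<in>{S. int_independent G S}. enat (card S))"

end

(* Take q = 4^j, so that 3 does not divide d = q + 1, and the curve y^2 + x y + B y = x^3 with
   B = 1 + t^d. It carries the 3-torsion point T = (0, 0), and over a field containing the cube roots
   of unity it is 3-isogenous to the curve with B + 1 = t^d in place of B; multiplication by 3 is the
   composition of the two isogenies. Hence the group is controlled by descent with values in cube
   classes of the rational function field, where the class group is trivial: the descent map y mod
   cubes is unramified outside the d roots of B, respectively outside t = 0, and the second map is
   already exhausted by torsion. For each of the d roots z of B, all of which lie in the field with
   q^2 elements, there is an explicit point whose descent image is t - z. So these points generate
   the group modulo 3, and T accounts for exactly one relation among them, which leaves rank
   d - 1 = q. The passage from "modulo 3" to the rank uses heights and the finiteness of the field.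

   Cube classes are taken over the algebraic closure of the constants; a point Q with 3 Q rational
   and trivial descent image is then rational by comparison with its Frobenius conjugate.

   Associativity of the group law comes from the twisted Hessian model, whose rotated addition law is
   a single formula without exceptions because t^d is not a cube. *)

theory Submission
  imports Defs "HOL-Number_Theory.Cong"
begin

text \<open>Both isogenies become explicit in coordinates with p + r + s = 1 and p r s = t^d. A
  Hessian point (u, v) goes to (p, r, s) = (1, v^3, b u^3) / (u v), and a Fourier transform over the
  cube roots of unity turns (p, r, s) into (z, w) with 3 (u, v) = (z w, z^3). Dividing by 3
  therefore means extracting cube roots twice, with linear maps in between. Each extraction divides
  degrees by 3, so division by 3 contracts heights by 9 up to a constant, whereas translation by a
  fixed point costs at most a factor 4 by the bare chord formula. As 4 < 9, the rational points
  below a suitable height bound form a finite set that the descent maps into itself. The obstacle to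
  descending directly over F is that its constants are not all cubes, because 3 divides q^2 - 1.
  Over closed constants every constant is a cube and valuations alone detect cubes.\<close>

no_notation univ_poly (\<open>(\<open>open_block notation=\<open>postfix X\<close>\<close>_ [X]\<index>)\<close> 80)

section \<open>Characteristic two\<close>

text \<open>In such rings signs and even coefficients disappear by simplification. The closure of
  the two-element field, its polynomials and their fractions are all instances.\<close>

class char_two = comm_ring_1 +
  assumes one_plus_one: "1 + 1 = 0"
begin

lemma add_self [simp]: "x + x = 0"
  by (metis one_plus_one distrib_right mult_1 mult_zero_left)

lemma add_self_left [simp]: "x + (x + y) = y"
  by (simp flip: add.assoc)

lemma uminus_char_two [simp]: "- x = x"
  by (metis add_self minus_unique)

lemma diff_char_two [simp]: "x - y = x + y"
  by (metis diff_conv_add_uminus uminus_char_two)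

lemma numeral_Bit0_char_two [simp]: "numeral (num.Bit0 n) = 0"
  by (simp add: numeral_Bit0)

lemma numeral_Bit1_char_two [simp]: "numeral (num.Bit1 n) = 1"
  by (simp add: numeral_Bit1)

lemma add_eq_0_iff_char_two: "x + y = 0 \<longleftrightarrow> x = y"
  by (metis add.right_neutral add_self add_self_left)

end

lemma square_add_char_two: "(x + y)^2 = x^2 + (y::'a::char_two)^2"
  by (simp add: power2_sum)

text \<open>After expansion into monomials, equal terms cancel in pairs by \<open>add_self\<close>,
  so \<open>simp\<close> can prove polynomial identities that hold modulo 2.\<close>

lemmas char_two_expand = algebra_simps power_numeral_reduce

section \<open>Addition on twisted Hessian curves\<close>

text \<open>The following two lemmas are the polynomial identities behind associativity of the rotated
  addition law of Bernstein, Chuengsatiansup, Kohel and Lange on the twisted Hessian curve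
  \<open>b X\<^sup>3 + Y\<^sup>3 + Z\<^sup>3 = X Y Z\<close>, in the chart \<open>Z = 1\<close>. The cofactors of the three curve equations come
  from polynomial division.\<close>

lemma hessian_assoc_u:
  fixes b u1 v1 u2 v2 u3 v3 :: "'a::idom"
  assumes "b * u1^3 + v1^3 + 1 = u1 * v1" and "b * u2^3 + v2^3 + 1 = u2 * v2"
    and "b * u3^3 + v3^3 + 1 = u3 * v3"
  defines "U \<equiv> u1 - v1^2*u2*v2" and "V \<equiv> v2^2*v1 - b*u1^2*u2" and "D \<equiv> b*u2^2*u1*v1 - v2"
    and "U' \<equiv> u2 - v2^2*u3*v3" and "V' \<equiv> v3^2*v2 - b*u2^2*u3" and "D' \<equiv> b*u3^2*u2*v2 - v3"
  shows "(U*D - V^2*u3*v3) * (b*U'^2*u1*v1 - V'*D') = (D'^2*u1 - v1^2*U'*V') * (b*u3^2*U*V - D^2*v3)"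
proof -
  define e1 e2 e3 where e: "e1 = b * u1^3 + v1^3 + 1 - u1 * v1"
    "e2 = b * u2^3 + v2^3 + 1 - u2 * v2" "e3 = b * u3^3 + v3^3 + 1 - u3 * v3"
  have "(U*D - V^2*u3*v3) * (b*U'^2*u1*v1 - V'*D') - (D'^2*u1 - v1^2*U'*V') * (b*u3^2*U*V - D^2*v3)
    = (b*v1^2*u2*v2^6*u3^3*v3^3 - b*v1^2*u2^2*v2^4*u3^2*v3^2 - b*u1*v2^5*u3^3*v3^3 -
      b*u1*v2^8*u3^3*v3^3 + 2*b*u1*u2*v2^3*u3^2*v3^2 + 3*b*u1*u2*v2^6*u3^2*v3^2 +
      b*u1*u2*v2^6*u3^3*v3^3 - 3*b*u1*u2^2*v2^4*u3*v3 - 2*b*u1*u2^2*v2^4*u3*v3^4 -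
      b*u1*u2^2*v2^4*u3^2*v3^2 + b*u1*u2^3*v2^2 + b*u1*u2^3*v2^2*v3^3 - b^2*v1^2*u2^3*v2^5*u3^4*v3 +
      b^2*v1^2*u2^4*v2^3*u3^3 - b^2*u1*u2^2*v2^4*u3^4*v3 - b^2*u1*u2^3*v2^2*u3^3 -
      b^2*u1*u2^3*v2^5*u3^4*v3 + 3*b^2*u1*u2^4*v2^3*u3^2*v3^2 + b^2*u1*u2^4*v2^3*u3^3 -
      b^2*u1*u2^5*v2*u3*v3 - b^2*u1^2*v1*u2^2*v2^4*u3^3*v3^3 + b^2*u1^2*v1*u2^3*v2^2*u3^2*v3^2 -
      b^2*u1^2*v1*u2^3*v2^5*u3^2*v3^2 + 2*b^2*u1^2*v1*u2^4*v2^3*u3*v3 +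
      b^2*u1^2*v1*u2^4*v2^3*u3*v3^4 - b^2*u1^2*v1*u2^5*v2 - b^2*u1^2*v1*u2^5*v2*v3^3 +
      b^3*u1*u2^3*v2^5*u3^6 - b^3*u1*u2^6*v2^2*u3^3 + b^3*u1^2*v1*u2^4*v2^3*u3^4*v3 -
      b^3*u1^2*v1*u2^5*v2*u3^3 - b^3*u1^2*v1*u2^6*v2^2*u3^2*v3^2 + b^3*u1^2*v1*u2^7*u3*v3) * e1
    + (b*u1*v2^5*u3^3*v3^3 - 3*b*u1*u2*v2^3*u3^2*v3^2 + 3*b*u1*u2^2*v2*u3*v3 + 2*b*u1*u2^2*v2*u3*v3^4
      - 2*b*u1*u2^2*v2*u3^2*v3^2 - b*u1^2*v1*v2^2*u3^2*v3^2 - b*u1^2*v1*v2^5*u3^3*v3^3 +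
      2*b*u1^2*v1*u2*u3*v3 + 2*b*u1^2*v1*u2*u3*v3^4 - 2*b*u1^2*v1*u2*u3^2*v3^2 +
      3*b*u1^2*v1*u2*v2^3*u3^2*v3^2 - 3*b*u1^2*v1*u2^2*v2*u3*v3 - 2*b*u1^2*v1*u2^2*v2*u3*v3^4 +
      2*b*u1^2*v1*u2^2*v2*u3^2*v3^2 + 2*b^2*u1*u2^2*v2*u3^4*v3 - b^2*u1*u2^3*v2^2*u3^3*v3^3 +
      b^2*u1*u2^3*v2^2*u3^4*v3 - b^2*u1*u2^4*u3^3 - b^2*u1*u2^4*u3^3*v3^3 + b^2*u1*u2^4*u3^4*v3 +
      2*b^2*u1^2*v1*u2*u3^4*v3 - b^2*u1^2*v1*u2^2*v2*u3^3*v3^3 - b^2*u1^2*v1*u2^2*v2*u3^4*v3 +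
      b^2*u1^2*v1*u2^3*v2^2*u3^2*v3^2 + b^2*u1^2*v1*u2^3*v2^2*u3^3*v3^3 -
      b^2*u1^2*v1*u2^3*v2^2*u3^4*v3 - 2*b^2*u1^2*v1*u2^4*u3*v3 - b^2*u1^2*v1*u2^4*u3*v3^4 +
      b^2*u1^2*v1*u2^4*u3^2*v3^2 + b^2*u1^2*v1*u2^4*u3^3 + b^2*u1^2*v1*u2^4*u3^3*v3^3 -
      b^2*u1^2*v1*u2^4*u3^4*v3 + b^2*u1^3*v1^2*u2*v2^3*u3^3*v3^3 - 2*b^2*u1^3*v1^2*u2^2*v2*u3^2*v3^2
      - b^2*u1^3*v1^2*u2^3*v2^2*u3^2*v3^2 + 2*b^2*u1^3*v1^2*u2^4*u3*v3 + b^2*u1^3*v1^2*u2^4*u3*v3^4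
      - b^2*u1^3*v1^2*u2^4*u3^2*v3^2 + b^2*u1^4*v2^5*u3^3*v3^3 + b^2*u1^4*u2*u3^2*v3^2 -
      3*b^2*u1^4*u2*v2^3*u3^2*v3^2 + 3*b^2*u1^4*u2^2*v2*u3*v3 + 2*b^2*u1^4*u2^2*v2*u3*v3^4 -
      2*b^2*u1^4*u2^2*v2*u3^2*v3^2 - b^3*u1*u2^3*v2^2*u3^6 - b^3*u1*u2^4*u3^6 -
      b^3*u1^2*v1*u2^2*v2*u3^6 + b^3*u1^2*v1*u2^3*v2^2*u3^6 - b^3*u1^2*v1*u2^4*u3^4*v3 +
      b^3*u1^2*v1*u2^4*u3^6 + b^3*u1^3*v1^2*u2^3*v2^2*u3^4*v3 - b^3*u1^3*v1^2*u2^4*u3^3 -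
      b^3*u1^3*v1^2*u2^4*u3^3*v3^3 + 2*b^3*u1^3*v1^2*u2^4*u3^4*v3 + b^3*u1^4*u2^2*v2*u3^4*v3 -
      b^3*u1^4*u2^3*v2^2*u3^3*v3^3 + b^3*u1^4*u2^3*v2^2*u3^4*v3 - b^3*u1^4*u2^4*u3^3 -
      b^3*u1^4*u2^4*u3^3*v3^3 + b^3*u1^4*u2^4*u3^4*v3 + b^3*u1^5*v1*u2^3*v2^2*u3^2*v3^2 -
      2*b^3*u1^5*v1*u2^4*u3*v3 - b^3*u1^5*v1*u2^4*u3*v3^4 + b^3*u1^5*v1*u2^4*u3^2*v3^2 -
      b^4*u1^3*v1^2*u2^4*u3^6 - b^4*u1^4*u2^3*v2^2*u3^6 - b^4*u1^4*u2^4*u3^6 -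
      b^4*u1^5*v1*u2^4*u3^4*v3) * e2
    + (0 - 2*b*u1*u2^2*v2*u3*v3 - b*u1*u2^3*v2^2 + 2*b*u1*u2^3*v2^2*u3*v3 - 2*b*u1^2*v1*u2*u3*v3 -
      b*u1^2*v1*u2^2*v2 + 4*b*u1^2*v1*u2^2*v2*u3*v3 + b*u1^2*v1*u2^3*v2^2 -
      2*b*u1^2*v1*u2^3*v2^2*u3*v3 + b^2*u1*u2^3*v2^2*u3^3 + b^2*u1*u2^4*u3^3 -
      2*b^2*u1*u2^5*v2*u3*v3 - b^2*u1*u2^5*v2*u3^3 + b^2*u1^2*v1*u2^2*v2*u3^3 -
      2*b^2*u1^2*v1*u2^3*v2^2*u3^3 - b^2*u1^2*v1*u2^4*u3*v3 - b^2*u1^2*v1*u2^4*u3^3 +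
      b^2*u1^2*v1*u2^5*v2 + b^2*u1^2*v1*u2^5*v2*u3*v3 + b^2*u1^2*v1*u2^5*v2*u3^3 +
      b^2*u1^3*v1^2*u2^4 - b^2*u1^3*v1^2*u2^4*u3*v3 - b^2*u1^3*v1^2*u2^5*v2 +
      b^2*u1^3*v1^2*u2^5*v2*u3*v3 - 3*b^2*u1^4*u2^2*v2*u3*v3 - b^2*u1^4*u2^3*v2^2 +
      2*b^2*u1^4*u2^3*v2^2*u3*v3 + b^3*u1*u2^6*v2^2*u3^3 + b^3*u1*u2^7*u3^3 +
      b^3*u1^2*v1*u2^5*v2*u3^3 - b^3*u1^2*v1*u2^6*v2^2*u3^3 + b^3*u1^2*v1*u2^7*u3*v3 -
      b^3*u1^2*v1*u2^7*u3^3 + b^3*u1^3*v1^2*u2^4*u3^3 - b^3*u1^3*v1^2*u2^5*v2*u3^3 -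
      b^3*u1^3*v1^2*u2^7*u3*v3 + 2*b^3*u1^4*u2^3*v2^2*u3^3 + b^3*u1^4*u2^4*u3^3 -
      2*b^3*u1^4*u2^5*v2*u3*v3 - b^3*u1^4*u2^5*v2*u3^3 + b^3*u1^5*v1*u2^4*u3*v3 +
      b^3*u1^5*v1*u2^5*v2 - b^3*u1^5*v1*u2^5*v2*u3*v3 + b^4*u1^3*v1^2*u2^7*u3^3 +
      b^4*u1^4*u2^6*v2^2*u3^3 + b^4*u1^4*u2^7*u3^3 + b^4*u1^5*v1*u2^7*u3*v3) * e3"
    unfolding U_def V_def D_def U'_def V'_def D'_def e by Groebner_Basis.algebra
  moreover have "e1 = 0" "e2 = 0" "e3 = 0"
    using assms(1-3) by (simp_all add: e)
  ultimately show ?thesis by simp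
qed

lemma hessian_assoc_v:
  fixes b u1 v1 u2 v2 u3 v3 :: "'a::idom"
  assumes "b * u1^3 + v1^3 + 1 = u1 * v1" and "b * u2^3 + v2^3 + 1 = u2 * v2"
    and "b * u3^3 + v3^3 + 1 = u3 * v3"
  defines "U \<equiv> u1 - v1^2*u2*v2" and "V \<equiv> v2^2*v1 - b*u1^2*u2" and "D \<equiv> b*u2^2*u1*v1 - v2"
    and "U' \<equiv> u2 - v2^2*u3*v3" and "V' \<equiv> v3^2*v2 - b*u2^2*u3" and "D' \<equiv> b*u3^2*u2*v2 - v3"
  shows "(v3^2*V*D - b*U^2*u3) * (b*U'^2*u1*v1 - V'*D')
    = (V'^2*v1 - b*u1^2*U'*D') * (b*u3^2*U*V - D^2*v3)"
proof -
  define e1 e2 e3 where e: "e1 = b * u1^3 + v1^3 + 1 - u1 * v1"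
    "e2 = b * u2^3 + v2^3 + 1 - u2 * v2" "e3 = b * u3^3 + v3^3 + 1 - u3 * v3"
  have "(v3^2*V*D - b*U^2*u3) * (b*U'^2*u1*v1 - V'*D')
      - (V'^2*v1 - b*u1^2*U'*D') * (b*u3^2*U*V - D^2*v3)
    = (b*v1*u2*v2^5*u3^2*v3^4 - b*v1*u2^2*v2^3*u3*v3^3 - b^2*v1*u2^3*v2^4*u3^3*v3^2 +
      b^2*v1*u2^4*v2^2*u3^2*v3 - b^2*u1*v1^2*u2^2*v2^6*u3^3*v3^2 + 2*b^2*u1*v1^2*u2^3*v2^4*u3^2*v3 -
      b^2*u1*v1^2*u2^4*v2^2*u3 + b^2*u1^2*u2*v2^5*u3^3*v3^2 - 3*b^2*u1^2*u2^2*v2^3*u3^2*v3 -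
      b^2*u1^2*u2^2*v2^3*u3^2*v3^4 + b^2*u1^2*u2^2*v2^6*u3^2*v3^4 - b^2*u1^2*u2^2*v2^6*u3^3*v3^2 +
      2*b^2*u1^2*u2^3*v2*u3 - 2*b^2*u1^2*u2^3*v2^4*u3*v3^3 + 2*b^2*u1^2*u2^3*v2^4*u3^2*v3 +
      b^2*u1^2*u2^4*v2^2*v3^2 + b^2*u1^2*u2^4*v2^2*v3^5 - b^2*u1^2*u2^4*v2^2*u3 +
      b^3*u1^2*u2^2*v2^6*u3^5*v3 - b^3*u1^2*u2^3*v2^4*u3^4 + 2*b^3*u1^2*u2^4*v2^2*u3^3*v3^2 -
      2*b^3*u1^2*u2^6*v2*u3*v3^3 - b^4*u1^2*u2^6*v2*u3^4 + b^4*u1^2*u2^8*u3^2*v3) * e1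
    + (0 - b*u1*v1^2*v2^4*u3^2*v3^4 + 2*b*u1*v1^2*u2*v2^2*u3*v3^3 - b*u1*v1^2*u2^2*v3^2 -
      b*u1*v1^2*u2^2*v3^5 + b*u1*v1^2*u2^2*u3*v3^3 - b*u1^2*v2*u3*v3^3 - b^2*u1*v1^2*u2^2*u3^3*v3^2
      + b^2*u1*v1^2*u2^2*v2^3*u3^3*v3^2 - 2*b^2*u1*v1^2*u2^3*v2*u3^2*v3 + 2*b^2*u1^2*u2^2*u3^2*v3 +
      b^2*u1^2*u2^2*u3^2*v3^4 - b^2*u1^2*u2^2*u3^3*v3^2 - b^2*u1^2*u2^2*v2^3*u3^2*v3^4 +
      b^2*u1^2*u2^2*v2^3*u3^3*v3^2 + 2*b^2*u1^2*u2^3*v2*u3*v3^3 - 2*b^2*u1^2*u2^3*v2*u3^2*v3 -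
      b^2*u1^2*u2^3*v2*u3^2*v3^4 + b^2*u1^2*u2^3*v2*u3^3*v3^2 + b^2*u1^3*v1*u2*v2^2*u3^3*v3^2 +
      b^2*u1^3*v1*u2^2*u3*v3^3 - 3*b^2*u1^3*v1*u2^2*u3^2*v3 - 2*b^2*u1^3*v1*u2^2*u3^2*v3^4 +
      2*b^2*u1^3*v1*u2^2*u3^3*v3^2 + b^2*u1^3*v1*u2^2*v2^3*u3^2*v3^4 -
      b^2*u1^3*v1*u2^2*v2^3*u3^3*v3^2 - 2*b^2*u1^3*v1*u2^3*v2*u3*v3^3 +
      2*b^2*u1^3*v1*u2^3*v2*u3^2*v3 + b^2*u1^3*v1*u2^3*v2*u3^2*v3^4 - b^2*u1^3*v1*u2^3*v2*u3^3*v3^2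
      + b^3*u1^2*u2^2*u3^5*v3 - b^3*u1^2*u2^2*v2^3*u3^5*v3 + b^3*u1^2*u2^3*v2*u3^4 -
      b^3*u1^2*u2^3*v2*u3^5*v3 + b^3*u1^2*u2^5*u3^2*v3^4 - b^3*u1^2*u2^5*u3^3*v3^2 -
      b^3*u1^3*v1*u2*v2^2*u3^5*v3 + b^3*u1^3*v1*u2^2*u3^4 - 2*b^3*u1^3*v1*u2^2*u3^5*v3 +
      b^3*u1^3*v1*u2^2*v2^3*u3^5*v3 - b^3*u1^3*v1*u2^3*v2*u3^3*v3^2 - b^3*u1^3*v1*u2^3*v2*u3^4 +
      b^3*u1^3*v1*u2^3*v2*u3^5*v3 - b^3*u1^3*v1*u2^5*u3^2*v3^4 + b^3*u1^3*v1*u2^5*u3^3*v3^2 +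
      b^3*u1^4*v1^2*u2^2*v2^3*u3^3*v3^2 - 2*b^3*u1^4*v1^2*u2^3*v2*u3^2*v3 -
      b^3*u1^4*v1^2*u2^3*v2*u3^2*v3^4 + b^3*u1^4*v1^2*u2^3*v2*u3^3*v3^2 - b^3*u1^5*u2*v2^2*u3^3*v3^2
      + 3*b^3*u1^5*u2^2*u3^2*v3 + 2*b^3*u1^5*u2^2*u3^2*v3^4 - 2*b^3*u1^5*u2^2*u3^3*v3^2 -
      b^3*u1^5*u2^2*v2^3*u3^2*v3^4 + b^3*u1^5*u2^2*v2^3*u3^3*v3^2 + 2*b^3*u1^5*u2^3*v2*u3*v3^3 -
      2*b^3*u1^5*u2^3*v2*u3^2*v3 - b^3*u1^5*u2^3*v2*u3^2*v3^4 + b^3*u1^5*u2^3*v2*u3^3*v3^2 +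
      b^4*u1^2*u2^5*u3^5*v3 - b^4*u1^3*v1*u2^5*u3^5*v3 - b^4*u1^4*v1^2*u2^3*v2*u3^5*v3 +
      2*b^4*u1^5*u2^2*u3^5*v3 - b^4*u1^5*u2^2*v2^3*u3^5*v3 + b^4*u1^5*u2^3*v2*u3^4 -
      b^4*u1^5*u2^3*v2*u3^5*v3 + b^4*u1^5*u2^5*u3^2*v3^4 - b^4*u1^5*u2^5*u3^3*v3^2 +
      b^5*u1^5*u2^5*u3^5*v3) * e2
    + (b*u1*v1^2*u2^2*v3^2 - b*u1*v1^2*u2^3*v2*v3^2 + b*u1^2*u2*v2^2*v3^2 + b^2*u1*v1^2*u2^4*v2^2*u3
      + b^2*u1*v1^2*u2^5*v3^2 - b^2*u1^2*u2^2*u3^2*v3 - 2*b^2*u1^2*u2^3*v2*u3 +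
      2*b^2*u1^2*u2^3*v2*u3^2*v3 - b^2*u1^2*u2^4*v2^2*v3^2 + b^2*u1^2*u2^4*v2^2*u3 -
      b^2*u1^2*u2^4*v2^2*u3^2*v3 + b^2*u1^3*v1*u2*v2^2*u3^2*v3 - b^2*u1^3*v1*u2^2*u3 +
      2*b^2*u1^3*v1*u2^2*u3^2*v3 - b^2*u1^3*v1*u2^3*v2*v3^2 + 2*b^2*u1^3*v1*u2^3*v2*u3 -
      3*b^2*u1^3*v1*u2^3*v2*u3^2*v3 + b^2*u1^3*v1*u2^4*v2^2*v3^2 - b^2*u1^3*v1*u2^4*v2^2*u3 +
      b^2*u1^3*v1*u2^4*v2^2*u3^2*v3 - 2*b^3*u1^2*u2^5*u3^2*v3 + 2*b^3*u1^2*u2^6*v2*u3^2*v3 +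
      b^3*u1^3*v1*u2^4*v2^2*u3^2*v3 + 3*b^3*u1^3*v1*u2^5*u3^2*v3 - 2*b^3*u1^3*v1*u2^6*v2*u3^2*v3 +
      b^3*u1^4*v1^2*u2^3*v2*u3^2*v3 + b^3*u1^4*v1^2*u2^4*v2^2*u3 - b^3*u1^4*v1^2*u2^4*v2^2*u3^2*v3 -
      2*b^3*u1^5*u2^2*u3^2*v3 - 2*b^3*u1^5*u2^3*v2*u3 + 3*b^3*u1^5*u2^3*v2*u3^2*v3 -
      b^3*u1^5*u2^4*v2^2*v3^2 + b^3*u1^5*u2^4*v2^2*u3 - b^3*u1^5*u2^4*v2^2*u3^2*v3 -
      b^4*u1^2*u2^8*u3^2*v3 + b^4*u1^3*v1*u2^8*u3^2*v3 + b^4*u1^4*v1^2*u2^6*v2*u3^2*v3 -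
      3*b^4*u1^5*u2^5*u3^2*v3 + 2*b^4*u1^5*u2^6*v2*u3^2*v3 - b^5*u1^5*u2^8*u3^2*v3) * e3"
    unfolding U_def V_def D_def U'_def V'_def D'_def e by Groebner_Basis.algebra
  moreover have "e1 = 0" "e2 = 0" "e3 = 0"
    using assms(1-3) by (simp_all add: e)
  ultimately show ?thesis by simp
qed

lemma hessian_closed:
  fixes b u1 v1 u2 v2 :: "'a::idom"
  assumes "b * u1^3 + v1^3 + 1 = u1 * v1" and "b * u2^3 + v2^3 + 1 = u2 * v2"
  defines "U \<equiv> u1 - v1^2*u2*v2" and "V \<equiv> v2^2*v1 - b*u1^2*u2" and "D \<equiv> b*u2^2*u1*v1 - v2"
  shows "b * U^3 + V^3 + D^3 = U * V * D"
proof -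
  define e1 e2 where e: "e1 = b * u1^3 + v1^3 + 1 - u1 * v1" "e2 = b * u2^3 + v2^3 + 1 - u2 * v2"
  have "b * U^3 + V^3 + D^3 - U * V * D
    = (v2^6 - u2*v2^4 + b*u2^3*v2^3 - b*v1^3*u2^3*v2^3 + 3*b*u1*v1*u2^2*v2^2 + b^2*u1^3*u2^3*v2^3 -
      b^2*u1^3*u2^4*v2 + b^3*u1^3*u2^6) * e1
    + (0 - v2^3 + u1*v1*v2^3 - 3*b*u1^2*v1^2*u2*v2 + b*u1^3 - b*u1^3*v2^3 - b^2*u1^3*u2^3 +
      b^2*u1^4*v1*u2^3 - b^3*u1^6*u2^3) * e2"
    unfolding U_def V_def D_def e by Groebner_Basis.algebra
  moreover have "e1 = 0" "e2 = 0"
    using assms(1-2) by (simp_all add: e)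
  ultimately show ?thesis by simp
qed

text \<open>In characteristic two the chord through two points of the Hessian curve has coordinates
  \<open>s X + r Y + p Z = 0\<close>, and the third intersection point is \<open>(U : D : V)\<close>.\<close>

lemma hessian_chord:
  fixes b u1 v1 u2 v2 :: "'a::{idom,char_two}"
  assumes "b * u1^3 + v1^3 + 1 = u1 * v1" and "b * u2^3 + v2^3 + 1 = u2 * v2"
  defines "U \<equiv> u1 + v1^2*u2*v2" and "V \<equiv> v2^2*v1 + b*u1^2*u2" and "D \<equiv> b*u2^2*u1*v1 + v2"
    and "p \<equiv> u1*v2 + u2*v1" and "r \<equiv> u2 + u1" and "s \<equiv> v1 + v2"
  shows "s * U + r * D + p * V = 0"
    and "(p^2 + r^2 + s^2 + p*r + p*s + r*s) * (u1+v1+1) * (u2+v2+1) * (U+V+D)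
      + (b+1) * (p+r)^3 * (U+V+D) + (b+1) * U * (u1+v1+1) * (u2+v2+1) * (p+r)^2 = 0"
proof -
  define U' V' D' p' r' s' where d: "U' = u1 - v1^2*u2*v2" "V' = v2^2*v1 - b*u1^2*u2"
    "D' = b*u2^2*u1*v1 - v2" "p' = u1*v2 - u2*v1" "r' = u2 - u1" "s' = v1 - v2"
  have eq: "U' = U" "V' = V" "D' = D" "p' = p" "r' = r" "s' = s"
    unfolding d U_def V_def D_def p_def r_def s_def by simp_all
  define e1 e2 where e: "e1 = b * u1^3 + v1^3 + 1 - u1 * v1" "e2 = b * u2^3 + v2^3 + 1 - u2 * v2"
  have e0: "e1 = 0" "e2 = 0"
    using assms(1,2) by (simp_all add: e)
  have "s' * U' + r' * D' + p' * V' = (0 - u2*v2) * e1 + (u1*v1) * e2"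
    unfolding d e by Groebner_Basis.algebra
  thus "s * U + r * D + p * V = 0"
    by (simp add: e0 eq)
  \<comment> \<open>The identity holds only modulo 2, whereas \<open>algebra\<close> computes with
    integer coefficients. \<open>R\<close> is half of the integral discrepancy and disappears
    because 2 = 0.\<close>
  define R where "R = 0 - v2 - v2^3 - v2^4 + u2*v2^2 - u2^2*v2 - u2^3*v2 - v1*u2*v2 - v1*u2*v2^3 - v1*u2^2*v2 +
      v1*u2^3*v2 + v1*u2^3*v2^2 - v1^2*v2 - v1^2*v2^4 - v1^2*u2*v2 + v1^2*u2*v2^2 - v1^2*u2*v2^3 -
      3*v1^2*u2^3*v2 - 2*v1^2*u2^3*v2^2 - 2*v1^2*u2^4*v2 - v1^3*v2 - v1^3*v2^3 - v1^3*v2^4 +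
      2*v1^3*u2*v2^2 - v1^3*u2^2*v2 + 2*v1^3*u2^3*v2^2 + 2*v1^3*u2^4*v2 - v1^4*u2*v2 - v1^4*u2^2*v2
      - v1^4*u2^4*v2 - v1^5*u2*v2 - v1^5*u2*v2^2 - v1^5*u2^3*v2 - v1^5*u2^3*v2^2 - v1^5*u2^4*v2 - u1
      - u1*v2 - u1*v2^3 - u1*v2^4 + u1*u2*v2^2 - u1*u2*v2^4 + 2*u1*u2^2*v2 - 2*u1*u2^2*v2^2 -
      u1*u2^2*v2^3 + u1*u2^3 + 2*u1*v1*v2^3 + u1*v1*v2^4 - u1*v1*u2*v2^2 - u1*v1*u2*v2^3 -
      2*u1*v1*u2^2*v2 + u1*v1*u2^2*v2^2 + 2*u1*v1*u2^2*v2^3 - 2*u1*v1*u2^3 - u1*v1^2*v2 -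
      2*u1*v1^2*v2^2 - u1*v1^2*v2^3 - u1*v1^2*v2^4 - u1*v1^2*v2^5 + u1*v1^2*u2*v2^2 +
      u1*v1^2*u2*v2^3 - u1*v1^2*u2*v2^4 - u1*v1^2*u2^2 + 4*u1*v1^2*u2^2*v2 + 3*u1*v1^2*u2^2*v2^2 -
      5*u1*v1^2*u2^2*v2^3 + u1*v1^2*u2^3 + 3*u1*v1^2*u2^3*v2 - 4*u1*v1^2*u2^3*v2^2 - u1*v1^2*u2^4*v2
      + u1*v1^3*u2*v2^2 - u1*v1^3*u2*v2^4 + u1*v1^3*u2^2*v2 - u1*v1^3*u2^2*v2^2 + u1*v1^3*u2^2*v2^3
      - u1*v1^3*u2^3*v2 + 5*u1*v1^3*u2^3*v2^2 + 2*u1*v1^3*u2^4*v2 - u1*v1^4*u2*v2^2 -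
      u1*v1^4*u2*v2^3 - u1*v1^4*u2^2*v2 + 2*u1*v1^4*u2^2*v2^3 - u1*v1^4*u2^3*v2 - u1*v1^4*u2^3*v2^2
      - u1*v1^4*u2^4*v2 - 2*u1^2*u2 - 2*u1^2*u2*v2 + 4*u1^2*u2*v2^2 - 2*u1^2*u2*v2^3 - 3*u1^2*u2^2 +
      4*u1^2*u2^2*v2 - u1^2*u2^2*v2^2 - u1^2*u2^2*v2^3 + u1^2*u2^3 - u1^2*v1*u2 + u1^2*v1*u2*v2 -
      2*u1^2*v1*u2*v2^2 - 2*u1^2*v1*u2*v2^3 + 2*u1^2*v1*u2*v2^4 + 2*u1^2*v1*u2^2 - 4*u1^2*v1*u2^2*v2
      + u1^2*v1*u2^2*v2^2 + u1^2*v1*u2^2*v2^3 - u1^2*v1*u2^3 + u1^2*v1^2*u2 - 2*u1^2*v1^2*u2*v2 -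
      2*u1^2*v1^2*u2*v2^2 + 4*u1^2*v1^2*u2*v2^3 - 3*u1^2*v1^2*u2*v2^4 + 6*u1^2*v1^2*u2^2*v2^2 -
      5*u1^2*v1^2*u2^2*v2^3 + u1^2*v1^2*u2^3 + 3*u1^2*v1^2*u2^3*v2 - u1^2*v1^2*u2^3*v2^2 -
      u1^2*v1^3*u2*v2 - u1^2*v1^3*u2*v2^4 - u1^2*v1^3*u2^2*v2 - 2*u1^2*v1^3*u2^2*v2^2 +
      2*u1^2*v1^3*u2^2*v2^3 - 2*u1^2*v1^3*u2^3*v2 + 2*u1^2*v1^3*u2^3*v2^2 + u1^3 - 2*u1^3*v2^2 +
      2*u1^3*v2^3 - u1^3*v2^4 - 5*u1^3*u2*v2 + 4*u1^3*u2*v2^2 - u1^3*u2*v2^3 - 2*u1^3*u2^2 +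
      2*u1^3*u2^2*v2 - u1^3*v1*v2 + 2*u1^3*v1*v2^3 - 2*u1^3*v1*v2^4 + u1^3*v1*v2^5 + 2*u1^3*v1*u2*v2
      - u1^3*v1*u2*v2^2 - u1^3*v1*u2*v2^3 + u1^3*v1*u2^2 - u1^3*v1*u2^2*v2 + u1^3*v1*u2^2*v2^2 +
      u1^3*v1*u2^3*v2 - u1^3*v1^2*u2*v2 - u1^3*v1^2*u2*v2^2 + 2*u1^3*v1^2*u2*v2^3 -
      2*u1^3*v1^2*u2*v2^4 - u1^3*v1^2*u2^2*v2 + 2*u1^3*v1^2*u2^2*v2^2 - u1^3*v1^2*u2^2*v2^3 +
      u1^4*v2 - 2*u1^4*v2^2 + u1^4*v2^3 + u1^4*u2 - u1^4*u2*v2 + u1^4*u2*v2^2 - b*u2^3*v2 +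
      b*v1*u2^3*v2 - 3*b*v1^2*u2^3*v2 - 3*b*v1^2*u2^3*v2^2 - b*v1^2*u2^4*v2 + b*v1^3*u2^3*v2 +
      2*b*v1^3*u2^3*v2^2 + 2*b*v1^3*u2^4*v2 - b*v1^4*u2^4*v2 - b*v1^5*u2^3*v2 - b*v1^5*u2^3*v2^2 +
      2*b*u1*u2^2*v2 - 2*b*u1*u2^2*v2^2 - b*u1*u2^2*v2^3 - b*u1*u2^4*v2 - b*u1*u2^5 - b*u1*v1*u2^2 -
      4*b*u1*v1*u2^2*v2 + 2*b*u1*v1*u2^2*v2^2 + 2*b*u1*v1*u2^2*v2^3 - 2*b*u1*v1*u2^3 -
      b*u1*v1*u2^3*v2 + b*u1*v1*u2^5 - b*u1*v1^2*u2^2 + b*u1*v1^2*u2^2*v2 + b*u1*v1^2*u2^2*v2^2 -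
      4*b*u1*v1^2*u2^2*v2^3 + b*u1*v1^2*u2^3 + 2*b*u1*v1^2*u2^3*v2 - 3*b*u1*v1^2*u2^3*v2^2 -
      b*u1*v1^2*u2^4*v2 - 2*b*u1*v1^2*u2^5 + b*u1*v1^3*u2^2 - 3*b*u1*v1^3*u2^2*v2^2 +
      b*u1*v1^3*u2^2*v2^3 - 2*b*u1*v1^3*u2^3*v2 + 5*b*u1*v1^3*u2^3*v2^2 + b*u1*v1^3*u2^4*v2 +
      b*u1*v1^3*u2^5 - b*u1*v1^4*u2^2*v2 + b*u1*v1^4*u2^2*v2^3 - b*u1*v1^4*u2^3*v2 -
      b*u1*v1^4*u2^3*v2^2 - 2*b*u1^2*u2 - 2*b*u1^2*u2*v2 + 3*b*u1^2*u2*v2^2 - 3*b*u1^2*u2*v2^3 -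
      b*u1^2*u2*v2^4 - 2*b*u1^2*u2^2 + 4*b*u1^2*u2^2*v2 - b*u1^2*u2^4 - b*u1^2*u2^5 +
      2*b*u1^2*v1*u2*v2 - b*u1^2*v1*u2*v2^2 - 2*b*u1^2*v1*u2*v2^3 + b*u1^2*v1*u2*v2^4 +
      b*u1^2*v1*u2^2 - 3*b*u1^2*v1*u2^2*v2 + b*u1^2*v1*u2^2*v2^2 - 2*b*u1^2*v1*u2^3 - b*u1^2*v1*u2^4
      + 2*b*u1^2*v1*u2^4*v2 + b*u1^2*v1*u2^5 - b*u1^2*v1^2*u2*v2^2 + 3*b*u1^2*v1^2*u2*v2^3 -
      2*b*u1^2*v1^2*u2*v2^4 - b*u1^2*v1^2*u2^2 + b*u1^2*v1^2*u2^2*v2 + 3*b*u1^2*v1^2*u2^2*v2^2 -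
      4*b*u1^2*v1^2*u2^2*v2^3 + b*u1^2*v1^2*u2^3*v2 - 2*b*u1^2*v1^2*u2^3*v2^2 + b*u1^2*v1^2*u2^4 -
      4*b*u1^2*v1^2*u2^4*v2 - b*u1^2*v1^2*u2^5 - b*u1^2*v1^3*u2 - b*u1^2*v1^3*u2*v2 -
      b*u1^2*v1^3*u2*v2^4 + b*u1^2*v1^3*u2^2*v2 - 2*b*u1^2*v1^3*u2^2*v2^2 + 2*b*u1^2*v1^3*u2^2*v2^3
      - 2*b*u1^2*v1^3*u2^3*v2 - b*u1^2*v1^3*u2^4 + b*u1^2*v1^3*u2^4*v2 - b*u1^3*v2 - 2*b*u1^3*v2^2 +
      b*u1^3*v2^3 - b*u1^3*v2^4 + b*u1^3*u2 - 4*b*u1^3*u2*v2 + 3*b*u1^3*u2*v2^2 + b*u1^3*u2^2*v2 +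
      2*b*u1^3*u2^3 - 2*b*u1^3*u2^3*v2 - b*u1^3*u2^4 - b*u1^3*v1*v2 - 2*b*u1^3*v1*v2^2 +
      b*u1^3*v1*v2^3 - 2*b*u1^3*v1*v2^4 + b*u1^3*v1*u2 + 2*b*u1^3*v1*u2*v2 - b*u1^3*v1*u2*v2^2 +
      b*u1^3*v1*u2*v2^3 + 2*b*u1^3*v1*u2^2 - b*u1^3*v1*u2^2*v2 + b*u1^3*v1*u2^2*v2^2 -
      2*b*u1^3*v1*u2^3 - b*u1^3*v1*u2^3*v2 + 2*b*u1^3*v1*u2^3*v2^2 - b*u1^3*v1*u2^4 -
      b*u1^3*v1^2*u2*v2 - 2*b*u1^3*v1^2*u2*v2^2 + 2*b*u1^3*v1^2*u2*v2^3 - b*u1^3*v1^2*u2*v2^4 +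
      2*b*u1^3*v1^2*u2^2*v2^2 + b*u1^3*v1^2*u2^3*v2 - 2*b*u1^3*v1^2*u2^3*v2^2 -
      2*b*u1^3*v1^2*u2^4*v2 - b*u1^4 - 2*b*u1^4*v2^2 - b*u1^4*v2^4 - 2*b*u1^4*u2*v2 + b*u1^4*u2*v2^2
      - b*u1^4*u2*v2^4 - 2*b*u1^4*u2^2 + 3*b*u1^4*u2^2*v2 - 2*b*u1^4*u2^2*v2^2 - b*u1^4*u2^2*v2^3 -
      b*u1^4*v1*u2*v2^2 - b*u1^4*v1*u2*v2^3 + b*u1^4*v1*u2^2 - b*u1^4*v1*u2^2*v2 +
      b*u1^4*v1*u2^2*v2^3 - 2*b*u1^5*u2*v2 + b*u1^5*u2*v2^2 - b*u1^5*u2*v2^3 - b*u1^5*u2^2 -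
      b*u1^5*u2^2*v2^2 - b*u1^5*u2^2*v2^3 - b^2*u1*u2^5 - 2*b^2*u1*v1^2*u2^5 + b^2*u1*v1^3*u2^5 -
      b^2*u1*v1^4*u2^5 - b^2*u1^2*u2^4 - b^2*u1^2*u2^4*v2 + b^2*u1^2*v1*u2^4*v2 + b^2*u1^2*v1^2*u2^4
      - 3*b^2*u1^2*v1^2*u2^4*v2 - b^2*u1^2*v1^3*u2^4 + b^2*u1^2*v1^3*u2^4*v2 + b^2*u1^3*u2^3 -
      2*b^2*u1^3*u2^3*v2 - 2*b^2*u1^3*v1*u2^3 - b^2*u1^3*v1*u2^3*v2 + b^2*u1^3*v1*u2^3*v2^2 +
      b^2*u1^3*v1^2*u2^3*v2 - 2*b^2*u1^3*v1^2*u2^3*v2^2 - 2*b^2*u1^4*u2^2 + 3*b^2*u1^4*u2^2*v2 -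
      2*b^2*u1^4*u2^2*v2^2 - b^2*u1^4*u2^2*v2^3 - b^2*u1^4*u2^3 - b^2*u1^4*u2^4*v2 - b^2*u1^4*u2^5 -
      2*b^2*u1^4*v1*u2^2*v2 - 2*b^2*u1^5*u2*v2 + b^2*u1^5*u2*v2^2 - b^2*u1^5*u2*v2^3 -
      b^2*u1^5*u2*v2^4 - b^2*u1^5*u2^5 - b^3*u1^4*u2^5 - b^3*u1^4*v1*u2^5 - b^3*u1^5*u2^4*v2"
  have "(p'^2 + r'^2 + s'^2 + p'*r' + p'*s' + r'*s') * (u1+v1+1) * (u2+v2+1) * (U'+V'+D')
      + (b+1) * (p'+r')^3 * (U'+V'+D') + (b+1) * U' * (u1+v1+1) * (u2+v2+1) * (p'+r')^2
    = (v2 + v2^3 + u2^2*v2 + v1*v2^2 + v1*v2^3 + v1*u2*v2 + v1*u2*v2^2 + v1*u2*v2^3 + v1*u2^2*v2 +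
      v1*u2^2*v2^2 + v1*u2^3*v2 + v1^2*u2*v2 + v1^2*u2*v2^2 + v1^2*u2^2*v2^2 + v1^2*u2^3*v2 +
      v1^2*u2^4*v2 + u1 + u1*v2 + u1*v2^3 + u1*v2^4 + u1*u2*v2 + u1*u2*v2^4 + u1*u2^2 + u1*u2^2*v2 +
      u1*u2^2*v2^2 + u1*u2^2*v2^3 + u1*u2^3 + u1*v1*u2*v2^2 + u1*v1*u2*v2^3 + u1*v1*u2^2*v2^2 +
      u1*v1*u2^3*v2 + u1*v1*u2^3*v2^2 + u1^2*u2*v2 + u1^2*u2*v2^2 + u1^2*u2^2*v2 + u1^2*u2^2*v2^2 +
      u1^2*u2^2*v2^3 + u1^2*u2^3*v2 + b*v1*u2^3*v2 + b*v1^2*u2^3*v2 + b*v1^2*u2^3*v2^2 +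
      b*u1*u2^2*v2^2 + b*u1*u2^2*v2^3 + b*u1*u2^3 + b*u1*u2^4*v2 + b*u1*u2^5 + b*u1*v1*u2^2 +
      b*u1*v1*u2^2*v2 + b*u1*v1*u2^3*v2 + b*u1^2*u2 + b*u1^2*u2*v2^2 + b*u1^2*u2*v2^3 +
      b*u1^2*u2*v2^4 + b*u1^2*u2^2*v2^2 + b*u1^2*u2^5 + b^2*u1*u2^5 + b^2*u1*v1*u2^5 +
      b^2*u1^2*u2^4*v2) * e1
    + (v2 + v1*v2^2 + v1^2*v2 + v1^2*v2^2 + u1 + u1*v2 + u1*u2*v2 + u1*u2^2 + u1*v1*u2 + u1*v1^2 +
      u1*v1^2*v2 + u1*v1^2*v2^2 + u1*v1^2*u2 + u1*v1^2*u2*v2 + u1*v1^2*u2^2 + u1^2*u2^2 + u1^2*v1*u2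
      + u1^2*v1*u2*v2 + u1^2*v1^2*v2 + u1^2*v1^2*v2^2 + u1^2*v1^2*u2*v2 + u1^2*v1^2*u2^2 + u1^3*u2 +
      u1^3*v1 + u1^3*v1*v2 + u1^3*v1*u2 + u1^3*v1*u2*v2 + u1^3*v1*u2^2 + u1^3*v1^2*u2*v2 + u1^4 +
      b*u1*u2^2 + b*u1*v1^2*u2^2 + b*u1^2*u2 + b*u1^2*u2*v2 + b*u1^2*v1*u2*v2 + b*u1^2*v1*u2^2 +
      b*u1^2*v1^2*u2 + b*u1^2*v1^2*u2^2 + b*u1^3 + b*u1^3*v2 + b*u1^3*v1 + b*u1^3*v1*v2 +
      b*u1^3*v1*v2^2 + b*u1^3*v1*u2*v2 + b*u1^4 + b*u1^4*v2 + b*u1^4*u2*v2 + b*u1^4*u2^2 +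
      b*u1^5*u2^2 + b^2*u1^4*u2^2 + b^2*u1^4*v1*u2^2 + b^2*u1^5*u2*v2) * e2
    + 2 * R"
    unfolding d e R_def by Groebner_Basis.algebra
  thus "(p^2 + r^2 + s^2 + p*r + p*s + r*s) * (u1+v1+1) * (u2+v2+1) * (U+V+D)
      + (b+1) * (p+r)^3 * (U+V+D) + (b+1) * U * (u1+v1+1) * (u2+v2+1) * (p+r)^2 = 0"
    unfolding eq e0 numeral_Bit0_char_two by (simp only: mult_zero_left mult_zero_right add_0_left)
qed

text \<open>Here \<open>s\<close>, \<open>r\<close>, \<open>p\<close> are the partial derivatives of
  the cubic modulo 2, hence the coordinates of the tangent. The second identity is the chord
  relation without the contribution of x1 + x2, which vanishes when the points agree.\<close>

lemma hessian_tangent: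
  fixes b u v :: "'a::{idom,char_two}"
  assumes "b * u^3 + v^3 + 1 = u * v"
  defines "U \<equiv> u + v^2*u*v" and "V \<equiv> v^2*v + b*u^2*u" and "D \<equiv> b*u^2*u*v + v"
    and "p \<equiv> 1 + u*v" and "r \<equiv> v^2 + u" and "s \<equiv> b*u^2 + v"
  shows "s * U + r * D + p * V = 0"
    and "(p^2 + r^2 + s^2 + p*r + p*s + r*s) * (U+V+D) + (b+1) * U * (p+r)^2 = 0"
proof -
  define U' V' D' p' r' s' where d: "U' = u - v^2*u*v" "V' = v^2*v - b*u^2*u"
    "D' = b*u^2*u*v - v" "p' = 1 - u*v" "r' = v^2 - u" "s' = b*u^2 - v"
  have eq: "U' = U" "V' = V" "D' = D" "p' = p" "r' = r" "s' = s"
    unfolding d U_def V_def D_def p_def r_def s_def by simp_all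
  define e1 where e: "e1 = b * u^3 + v^3 + 1 - u * v"
  have e0: "e1 = 0"
    using assms(1) by (simp_all add: e)
  have "s' * U' + r' * D' + p' * V' = 0"
    unfolding d by Groebner_Basis.algebra
  thus "s * U + r * D + p * V = 0"
    by (simp add: eq)
  define R where "R = 0 - v - v^3 - v^4 - v^6 + u + 3*u*v^2 - u*v^3 + 2*u*v^4 - 2*u*v^5 - u*v^7 - 2*u^2 - 2*u^2*v -
      2*u^2*v^2 - u^2*v^3 + 2*u^2*v^4 + 2*u^2*v^5 + u^2*v^6 + u^3 + 2*u^3*v + u^3*v^2 - u^3*v^3 -
      u^3*v^4 - u^3*v^5 + b*u*v^2 - b*u*v^3 - b*u*v^5 - b*u*v^7 - b*u^2 - b*u^2*v + 2*b*u^2*v^5 +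
      b*u^2*v^6 + b*u^3*v - b*u^3*v^2 - b*u^3*v^3 - 2*b*u^3*v^4 - b*u^3*v^5 + b*u^4*v^3 - b*u^5 -
      b^2*u^4 - b^2*u^4*v - b^2*u^4*v^4 + 2*b^2*u^5*v - b^2*u^5*v^2 - b^2*u^6*v^2 - b^3*u^7"
  have "(p'^2 + r'^2 + s'^2 + p'*r' + p'*s' + r'*s') * (U'+V'+D') + (b+1) * U' * (p'+r')^2
    = (v + v^2 + v^3 + v^4 + u^2 + u^2*v^3 + b*u + b*u*v^4 + b*u^3 + b*u^3*v^2 + b^2*u^4 + b^2*u^4*v) * e1 + 2 * R"
    unfolding d e R_def by Groebner_Basis.algebra
  thus "(p^2 + r^2 + s^2 + p*r + p*s + r*s) * (U+V+D) + (b+1) * U * (p+r)^2 = 0"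
    unfolding eq e0 numeral_Bit0_char_two by (simp only: mult_zero_left mult_zero_right add_0_left)
qed

text \<open>The rotated formulas are not symmetric in the two points; symmetry appears only modulo
  the curve equations.\<close>

lemma hessian_comm:
  fixes b u1 v1 u2 v2 :: "'a::idom"
  assumes "b * u1^3 + v1^3 + 1 = u1 * v1" and "b * u2^3 + v2^3 + 1 = u2 * v2"
  shows "(u1 - v1^2*u2*v2) * (b*u1^2*u2*v2 - v1) = (u2 - v2^2*u1*v1) * (b*u2^2*u1*v1 - v2)"
    and "(v2^2*v1 - b*u1^2*u2) * (b*u1^2*u2*v2 - v1) = (v1^2*v2 - b*u2^2*u1) * (b*u2^2*u1*v1 - v2)"
  using assms by Groebner_Basis.algebra+

section \<open>The curves \<open>y\<^sup>2 + x y + B y = x\<^sup>3\<close>\<close>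

definition triangular :: "'a::field \<Rightarrow> 'a weierstrass" where
  "triangular B = \<lparr>A1 = 1, A2 = 0, A3 = B, A4 = 0, A6 = 0\<rparr>"

lemma triangular_simps [simp]:
  "A1 (triangular B) = 1" "A2 (triangular B) = 0" "A3 (triangular B) = B"
  "A4 (triangular B) = 0" "A6 (triangular B) = 0"
  by (simp_all add: triangular_def)

text \<open>The cube root of unity gives the linear map between the two models, and
  \<open>not_cube\<close> keeps all points of the Hessian cubic in one affine chart. Both factors of
  the discriminant B^3 (B + 1), with B = b + 1, are then nonzero.\<close>

locale triangular_curve =
  fixes b \<omega> :: "'a::{field,char_two}"
  assumes omega: "\<omega>^2 + \<omega> + 1 = 0"
    and not_cube: "z^3 \<noteq> b"
    and b_neq_1: "b + 1 \<noteq> 0"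
begin

definition B :: 'a where "B = b + 1"

lemma b_nonzero: "b \<noteq> 0"
  using not_cube[of 0] by auto

lemma B_nonzero: "B \<noteq> 0"
  using b_neq_1 by (simp add: B_def)

lemma omega_mult: "\<omega> * \<omega> = \<omega> + 1" "\<omega> * (\<omega> * x) = \<omega> * x + x"
proof -
  show *: "\<omega> * \<omega> = \<omega> + 1"
    using omega by (simp add: power2_eq_square add.assoc add_eq_0_iff_char_two)
  show "\<omega> * (\<omega> * x) = \<omega> * x + x"
    by (simp add: * distrib_right flip: mult.assoc)
qed

lemmas omega_expand = char_two_expand omega_mult

lemma omega_cube: "\<omega>^3 = 1"
  by (simp add: omega_expand)

text \<open>Every point of the Hessian model lies in the affine chart \<open>Z = 1\<close>, since \<open>b\<close> is not a cube; the
  neutral element is \<open>(0, 1)\<close>.\<close>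

fun on_hessian :: "'a \<times> 'a \<Rightarrow> bool" where
  "on_hessian (u, v) \<longleftrightarrow> b * u^3 + v^3 + 1 = u * v"

fun hessian_add :: "'a \<times> 'a \<Rightarrow> 'a \<times> 'a \<Rightarrow> 'a \<times> 'a" where
  "hessian_add (u1, v1) (u2, v2) =
     ((u1 + v1^2*u2*v2) / (b*u2^2*u1*v1 + v2), (v2^2*v1 + b*u1^2*u2) / (b*u2^2*u1*v1 + v2))"

lemma hessian_v_nonzero:
  assumes "on_hessian (u, v)"
  shows "v \<noteq> 0"
proof
  assume "v = 0"
  hence "b * u^3 = 1"
    using assms by (simp add: add_eq_0_iff_char_two)
  moreover from this have "u \<noteq> 0"
    by auto
  ultimately have "(1 / u)^3 = b"
    by (simp add: power_divide field_simps)
  thus False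
    using not_cube by blast
qed

text \<open>A vanishing denominator determines v2. Substituted into the two curve equations this
  gives (b^2 u1^3 u2^3 + 1) (b v1^3 u2^3 + 1) = 0, and either factor being zero exhibits b as a
  cube.\<close>

lemma hessian_denominator:
  assumes "on_hessian (u1, v1)" "on_hessian (u2, v2)"
  shows "b*u2^2*u1*v1 + v2 \<noteq> 0"
proof
  assume "b*u2^2*u1*v1 + v2 = 0"
  hence v2: "v2 = b*u2^2*u1*v1"
    by (simp add: add_eq_0_iff_char_two)
  have m: "b * u1^3 + v1^3 = u1 * v1 + 1"
    using assms(1) by (metis on_hessian.simps add.commute add_self_left)
  have "(b*u1^3 * (b*u2^3) + 1) * (v1^3 * (b*u2^3) + 1)
      = b * (u1*v1)^3 * (b*u2^3)^2 + (b * u1^3 + v1^3) * (b*u2^3) + 1"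
    by (simp add: algebra_simps power_mult_distrib power2_eq_square)
  also have "\<dots> = v2^3 + u2 * v2 + b*u2^3 + 1"
    unfolding m by (simp add: v2 algebra_simps power_numeral_reduce)
  also have "\<dots> = (b * u2^3 + v2^3 + 1) + u2 * v2"
    by (simp add: ac_simps)
  also have "\<dots> = 0"
    using assms(2) by simp
  finally consider "b*u1^3 * (b*u2^3) = 1" | "v1^3 * (b*u2^3) = 1"
    by (auto simp: add_eq_0_iff_char_two)
  thus False
  proof cases
    case 1
    have "(b*u1*u2)^3 = b * (b*u1^3 * (b*u2^3))"
      by (simp add: algebra_simps power_numeral_reduce)
    thus False
      using 1 not_cube by simp
  next
    case 2
    hence "v1 * u2 \<noteq> 0"
      by auto
    hence "(1 / (v1*u2))^3 = b"
      using 2 by (simp add: power_divide field_simps power_mult_distrib)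
    thus False
      using not_cube by blast
  qed
qed

lemma on_hessian_frac:
  assumes "D \<noteq> 0"
  shows "on_hessian (U / D, V / D) \<longleftrightarrow> b*U^3 + V^3 + D^3 = U*V*D"
proof -
  have "b*(U/D)^3 + (V/D)^3 + 1 = (b*U^3 + V^3 + D^3) / D^3" "(U/D)*(V/D) = (U*V*D) / D^3"
    using assms by (simp_all add: field_simps power_divide power3_eq_cube)
  thus ?thesis
    using assms by simp
qed

lemma hessian_add_closed:
  assumes "on_hessian c" "on_hessian d"
  shows "on_hessian (hessian_add c d)"
proof -
  obtain u1 v1 u2 v2 where c: "c = (u1, v1)" and d: "d = (u2, v2)"
    by (metis surj_pair)
  note 1 = hessian_denominator[OF assms[unfolded c d]]
  from hessian_closed[of b u1 v1 u2 v2] assms[unfolded c d] show ?thesis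
    unfolding c d hessian_add.simps on_hessian_frac[OF 1] by simp
qed

lemma hessian_add_commute:
  assumes "on_hessian c" "on_hessian d"
  shows "hessian_add c d = hessian_add d c"
proof -
  obtain u1 v1 u2 v2 where c: "c = (u1, v1)" and d: "d = (u2, v2)"
    by (metis surj_pair)
  note 1 = hessian_denominator[OF assms[unfolded c d]] hessian_denominator[OF assms(2,1)[unfolded c d]]
  from hessian_comm[of b u1 v1 u2 v2] assms[unfolded c d] 1 show ?thesis
    unfolding c d by (simp add: frac_eq_eq)
qed

lemma hessian_add_frac_left:
  assumes "D \<noteq> 0"
  shows "hessian_add (U / D, V / D) (u, v)
    = ((U*D + V^2*u*v) / (b*u^2*U*V + D^2*v), (v^2*V*D + b*U^2*u) / (b*u^2*U*V + D^2*v))"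
proof -
  have "b*u^2*(U/D)*(V/D) + v = (b*u^2*U*V + D^2*v) / D^2"
    "U/D + (V/D)^2*u*v = (U*D + V^2*u*v) / D^2" "v^2*(V/D) + b*(U/D)^2*u = (v^2*V*D + b*U^2*u) / D^2"
    using assms by (simp_all add: field_simps power2_eq_square)
  thus ?thesis
    using assms by simp
qed

lemma hessian_add_frac_right:
  assumes "D \<noteq> 0"
  shows "hessian_add (u, v) (U / D, V / D)
    = ((D^2*u + v^2*U*V) / (b*U^2*u*v + V*D), (V^2*v + b*u^2*U*D) / (b*U^2*u*v + V*D))"
proof -
  have "b*(U/D)^2*u*v + V/D = (b*U^2*u*v + V*D) / D^2"
    "u + v^2*(U/D)*(V/D) = (D^2*u + v^2*U*V) / D^2" "(V/D)^2*v + b*u^2*(U/D) = (V^2*v + b*u^2*U*D) / D^2"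
    using assms by (simp_all add: field_simps power2_eq_square)
  thus ?thesis
    using assms by simp
qed

lemma hessian_add_assoc:
  assumes "on_hessian a" "on_hessian c" "on_hessian d"
  shows "hessian_add (hessian_add a c) d = hessian_add a (hessian_add c d)"
proof -
  obtain u1 v1 u2 v2 u3 v3 where a: "a = (u1, v1)" and c: "c = (u2, v2)" and d: "d = (u3, v3)"
    by (metis surj_pair)
  define U V D where UVD: "U = u1 + v1^2*u2*v2" "V = v2^2*v1 + b*u1^2*u2" "D = b*u2^2*u1*v1 + v2"
  define U' V' D' where UVD': "U' = u2 + v2^2*u3*v3" "V' = v3^2*v2 + b*u2^2*u3" "D' = b*u3^2*u2*v2 + v3"
  have D: "D \<noteq> 0" "D' \<noteq> 0"
    using hessian_denominator assms unfolding a c d UVD UVD' by blast+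
  have ac: "hessian_add a c = (U / D, V / D)" and cd: "hessian_add c d = (U' / D', V' / D')"
    by (simp_all add: a c d UVD UVD')
  have "b*u3^2*(U/D)*(V/D) + v3 \<noteq> 0"
    using hessian_denominator hessian_add_closed[OF assms(1,2)] assms(3) unfolding ac d by blast
  moreover have "b*u3^2*(U/D)*(V/D) + v3 = (b*u3^2*U*V + D^2*v3) / D^2"
    using D by (simp add: field_simps power2_eq_square)
  ultimately have 1: "b*u3^2*U*V + D^2*v3 \<noteq> 0"
    by auto
  have "b*(U'/D')^2*u1*v1 + V'/D' \<noteq> 0"
    using hessian_denominator hessian_add_closed[OF assms(2,3)] assms(1) unfolding cd a by blast
  moreover have "b*(U'/D')^2*u1*v1 + V'/D' = (b*U'^2*u1*v1 + V'*D') / D'^2"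
    using D by (simp add: field_simps power2_eq_square)
  ultimately have 2: "b*U'^2*u1*v1 + V'*D' \<noteq> 0"
    by auto
  have "(U*D + V^2*u3*v3) * (b*U'^2*u1*v1 + V'*D') = (D'^2*u1 + v1^2*U'*V') * (b*u3^2*U*V + D^2*v3)"
    "(v3^2*V*D + b*U^2*u3) * (b*U'^2*u1*v1 + V'*D') = (V'^2*v1 + b*u1^2*U'*D') * (b*u3^2*U*V + D^2*v3)"
    using hessian_assoc_u[of b u1 v1 u2 v2 u3 v3] hessian_assoc_v[of b u1 v1 u2 v2 u3 v3] assms
    by (simp_all add: a c d UVD UVD')
  thus ?thesis
    unfolding ac cd unfolding a d hessian_add_frac_left[OF D(1)] hessian_add_frac_right[OF D(2)]
    using 1 2 by (simp add: frac_eq_eq)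
qed

text \<open>Projectively a linear map: x = B X / (X + Y + Z) and y = B (X + \<omega> Y + \<omega>^2
  Z) / (X + Y + Z). In the inverse, X : Y : Z is x : y + \<omega> x + \<omega>^2 B : y + \<omega>^2
  x + \<omega> B.\<close>

fun of_hessian :: "'a \<times> 'a \<Rightarrow> 'a point" where
  "of_hessian (u, v) = (if u + v + 1 = 0 then Infinity
     else Affine (B*u / (u+v+1)) (B * (u + \<omega>*v + \<omega>^2) / (u+v+1)))"

text \<open>The line X + Y + Z = 0 is the inflectional tangent at the neutral element: on it the
  cubic restricts to B u^3.\<close>

lemma hessian_at_infinity:
  assumes "on_hessian (u, v)" "u + v + 1 = 0"
  shows "u = 0" "v = 1"
proof -
  have v: "v = u + 1"
    using assms(2) by (metis add.assoc add.commute add_eq_0_iff_char_two)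
  have "b*u^3 + v^3 + 1 + u * v = B * u^3"
    unfolding v B_def by (simp add: char_two_expand)
  hence "B * u^3 = 0"
    using assms(1) by simp
  thus "u = 0"
    using B_nonzero by simp
  thus "v = 1"
    by (simp add: v)
qed

lemma of_hessian_on_curve:
  assumes "on_hessian c"
  shows "on_curve (triangular B) (of_hessian c)"
proof -
  obtain u v where c: "c = (u, v)"
    by (metis surj_pair)
  define h y where h: "h = u + v + 1" and y: "y = u + \<omega>*v + \<omega>^2"
  have "y^2*h + u*y*h + y*h^2 + B*u^3 = b*u^3 + v^3 + 1 + u*v"
    unfolding h y B_def by (simp add: omega_expand)
  hence *: "y^2*h + u*y*h + y*h^2 = B*u^3"
    using assms c by (simp add: add_eq_0_iff_char_two)
  have "(B*y/h)^2 + (B*u/h)*(B*y/h) + B*(B*y/h) = (B*u/h)^3" if "h \<noteq> 0"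
  proof -
    have "(B*y/h)^2 + (B*u/h)*(B*y/h) + B*(B*y/h) = B^2 * (y^2*h + u*y*h + y*h^2) / h^3"
      using that by (simp add: field_simps power_numeral_reduce)
    also have "\<dots> = (B*u/h)^3"
      unfolding * by (simp add: field_simps power_numeral_reduce)
    finally show ?thesis .
  qed
  thus ?thesis
    unfolding c by (simp add: h[symmetric] y[symmetric])
qed

lemma of_hessian_surj:
  assumes "on_curve (triangular B) P"
  obtains c where "on_hessian c" "P = of_hessian c"
proof (cases P)
  case Infinity
  show ?thesis
    by (rule that[of "(0, 1)"]) (simp_all add: Infinity)
next
  case (Affine x y)
  define Y Z where Y: "Y = y + \<omega>*x + \<omega>^2*B" and Z: "Z = y + \<omega>^2*x + \<omega>*B"
  have e: "y^2 + x*y + B*y = x^3"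
    using assms Affine by simp
  have "b*x^3 + Y^3 + Z^3 + x*Y*Z + B * (x^3 + y^2 + x*y + B*y) = 0"
    unfolding Y Z B_def by (simp add: omega_expand)
  hence c: "b*x^3 + Y^3 + Z^3 = x*Y*Z"
    using e by (simp add: add.assoc add_eq_0_iff_char_two)
  have s: "x + Y + Z = B"
    unfolding Y Z by (simp add: omega_expand)
  have "Z \<noteq> 0"
  proof
    assume Z0: "Z = 0"
    hence c': "b*x^3 = Y^3"
      using c by (simp add: add_eq_0_iff_char_two)
    have "x \<noteq> 0"
      using c' s B_nonzero Z0 by auto
    hence "(Y/x)^3 = b"
      using c' by (simp add: power_divide field_simps)
    thus False
      using not_cube by blast
  qed
  have h: "x/Z + Y/Z + 1 = B/Z"
    using \<open>Z \<noteq> 0\<close> by (simp add: field_simps flip: s)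
  have "x + \<omega>*Y + \<omega>^2*Z = y"
    unfolding Y Z by (simp add: omega_expand)
  hence y: "x/Z + \<omega>*(Y/Z) + \<omega>^2 = y/Z"
    using \<open>Z \<noteq> 0\<close> by (simp add: field_simps)
  show ?thesis
  proof (rule that[of "(x/Z, Y/Z)"])
    show "on_hessian (x/Z, Y/Z)"
      using c unfolding on_hessian_frac[OF \<open>Z \<noteq> 0\<close>] .
    show "P = of_hessian (x/Z, Y/Z)"
      unfolding of_hessian.simps h y Affine using \<open>Z \<noteq> 0\<close> B_nonzero by simp
  qed
qed

lemma of_hessian_inj:
  assumes "on_hessian c" "on_hessian d" "of_hessian c = of_hessian d"
  shows "c = d"
proof -
  obtain u1 v1 u2 v2 where c: "c = (u1, v1)" and d: "d = (u2, v2)"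
    by (metis surj_pair)
  show ?thesis
  proof (cases "u1 + v1 + 1 = 0")
    case True
    hence "u2 + v2 + 1 = 0"
      using assms(3) by (simp add: c d split: if_splits)
    thus ?thesis
      using True hessian_at_infinity assms(1,2) unfolding c d by metis
  next
    case False
    define h1 h2 where h: "h1 = u1 + v1 + 1" "h2 = u2 + v2 + 1"
    have h0: "h1 \<noteq> 0" "h2 \<noteq> 0"
      using False assms(3) by (auto simp: c d h split: if_splits)
    have *: "B*(u + \<omega>*v + \<omega>^2)/h + \<omega>^2*(B*u/h) + \<omega>*B = B/h" if "h = u + v + 1" "h \<noteq> 0" for u v h
    proof -
      have "B*(u + \<omega>*v + \<omega>^2) + \<omega>^2*(B*u) + \<omega>*B*h = B"
        unfolding that(1) by (simp add: omega_expand)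
      thus ?thesis
        using that(2) by (simp add: field_simps)
    qed
    have e: "B*u1/h1 = B*u2/h2" "B*(u1 + \<omega>*v1 + \<omega>^2)/h1 = B*(u2 + \<omega>*v2 + \<omega>^2)/h2"
      using assms(3) h0 by (simp_all add: c d h)
    have "B/h1 = B/h2"
      using *[OF h(1) h0(1)] *[OF h(2) h0(2)] e by simp
    hence hh: "h1 = h2"
      using B_nonzero h0 by (simp add: field_simps)
    hence u: "u1 = u2"
      using e(1) h0 B_nonzero by simp
    have "v1 = v2"
      using hh u h by simp
    thus ?thesis
      using u by (simp add: c d)
  qed
qed

text \<open>Negation exchanges Y and Z, which on the Weierstrass side exchanges y and y + x +
  B.\<close>

lemma hessian_add_inverse:
  assumes "on_hessian (u, v)"
  shows "hessian_add (u, v) (u / v, 1 / v) = (0, 1)" "on_hessian (u / v, 1 / v)"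
    "u + v + 1 \<noteq> 0 \<Longrightarrow> of_hessian (u / v, 1 / v) =
       Affine (B*u / (u+v+1)) (B * (u + \<omega>*v + \<omega>^2) / (u+v+1) + B*u / (u+v+1) + B)"
proof -
  have v: "v \<noteq> 0"
    using hessian_v_nonzero[OF assms] .
  show c: "on_hessian (u / v, 1 / v)"
    using assms unfolding on_hessian_frac[OF v] by (simp add: ac_simps)
  have "b*(u/v)^2*u*v + 1/v = (1/v)^2*v + b*u^2*(u/v)"
    using v by (simp add: field_simps power2_eq_square)
  moreover have "u + v^2*(u/v)*(1/v) = 0"
    using v by (simp add: field_simps power2_eq_square)
  ultimately show "hessian_add (u, v) (u / v, 1 / v) = (0, 1)"
    using hessian_denominator[OF assms c] by simp
  assume h0: "u + v + 1 \<noteq> 0"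
  define h where h: "h = u + v + 1"
  have 1: "u / v + 1 / v + 1 = h / v"
    using v by (simp add: h field_simps)
  have "u / v + \<omega> / v + \<omega>^2 = (u + \<omega> + \<omega>^2*v) / v"
    using v by (simp add: field_simps)
  also have "u + \<omega> + \<omega>^2*v = u + \<omega>*v + \<omega>^2 + u + h"
    by (simp add: h omega_expand)
  finally have 2: "u / v + \<omega> / v + \<omega>^2 = (u + \<omega>*v + \<omega>^2 + u + h) / v" .
  have "h \<noteq> 0"
    using h0 h by simp
  thus "of_hessian (u / v, 1 / v) =
       Affine (B*u / (u+v+1)) (B * (u + \<omega>*v + \<omega>^2) / (u+v+1) + B*u / (u+v+1) + B)"
    unfolding h[symmetric] using v by (simp add: 1 2) (simp add: field_simps)
qed

text \<open>The slope enters the x-coordinate of a sum only through l^2 + l. This quantity is free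
  of \<omega>, which is why \<open>hessian_chord\<close> and \<open>hessian_tangent\<close> can be
  stated without \<omega>.\<close>

lemma slope_quadratic:
  fixes p r s :: 'a
  assumes "p + r \<noteq> 0"
  defines "l \<equiv> (\<omega>^2*p + \<omega>*r + s) / (p + r)"
  shows "l^2 + l = (p^2 + r^2 + s^2 + p*r + p*s + r*s) / (p + r)^2"
proof -
  have "(m / k)^2 + m / k = (m^2 + m * k) / k^2" if "k \<noteq> 0" for m k :: 'a
    using that by (simp add: field_simps power2_eq_square)
  hence "l^2 + l = ((\<omega>^2*p + \<omega>*r + s)^2 + (\<omega>^2*p + \<omega>*r + s) * (p + r)) / (p + r)^2"
    using assms(1) unfolding l_def by blast
  also have "(\<omega>^2*p + \<omega>*r + s)^2 + (\<omega>^2*p + \<omega>*r + s) * (p + r)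
      = p^2 + r^2 + s^2 + p*r + p*s + r*s"
    by (simp add: omega_expand)
  finally show ?thesis .
qed

text \<open>The chord or tangent \<open>s X + r Y + p Z = 0\<close> has slope \<open>(\<omega>\<^sup>2 p + \<omega> r + s) / (p + r)\<close> in Weierstrass
  coordinates.\<close>

lemma of_hessian_line:
  assumes D: "D \<noteq> 0" and pr: "p + r \<noteq> 0" and S: "U + V + D \<noteq> 0" and h: "u1 + v1 + 1 \<noteq> 0"
    and sum: "s*U + r*D + p*V = 0" and line: "s*u1 + r*v1 + p = 0"
  defines "l \<equiv> (\<omega>^2*p + \<omega>*r + s) / (p + r)"
  assumes x3: "x3 = B*U / (U+V+D)"
    and x1: "x1 = B*u1 / (u1+v1+1)" and y1: "y1 = B*(u1 + \<omega>*v1 + \<omega>^2) / (u1+v1+1)"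
  shows "of_hessian (U / D, V / D) = Affine x3 ((l + 1)*x3 + y1 + l*x1 + B)"
proof -
  define S h1 m where d: "S = U + V + D" "h1 = u1 + v1 + 1" "m = \<omega>^2*p + \<omega>*r + s"
  have nz: "S \<noteq> 0" "h1 \<noteq> 0"
    using S h by (simp_all add: d)
  have "(m + p + r)*U*h1 + (u1 + \<omega>*v1 + \<omega>^2)*S*(p+r) + m*u1*S + S*h1*(p+r)
      + (U + \<omega>*V + \<omega>^2*D)*(p+r)*h1 = h1*(s*U + r*D + p*V) + S*(s*u1 + r*v1 + p)"
    unfolding d by (simp add: omega_expand)
  hence *: "(m + p + r)*U*h1 + (u1 + \<omega>*v1 + \<omega>^2)*S*(p+r) + m*u1*S + S*h1*(p+r)
      = (U + \<omega>*V + \<omega>^2*D)*(p+r)*h1"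
    by (simp add: sum line add_eq_0_iff_char_two)
  have "(l + 1)*x3 + y1 + l*x1 + B = (m/(p+r) + 1)*(B*U/S) + B*(u1 + \<omega>*v1 + \<omega>^2)/h1 + m/(p+r)*(B*u1/h1) + B"
    unfolding l_def x3 x1 y1 d by simp
  also have "\<dots> = B * ((m + p + r)*U*h1 + (u1 + \<omega>*v1 + \<omega>^2)*S*(p+r) + m*u1*S + S*h1*(p+r)) / (S*(p+r)*h1)"
    using nz pr by (simp add: divide_simps) (simp add: algebra_simps)
  also have "\<dots> = B * (U + \<omega>*V + \<omega>^2*D) / S"
    unfolding * using nz pr by simp
  finally have y: "(l + 1)*x3 + y1 + l*x1 + B = B * (U + \<omega>*V + \<omega>^2*D) / S" .
  have 1: "U / D + V / D + 1 = S / D"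
    using D by (simp add: d field_simps)
  have 2: "U / D + \<omega>*V / D + \<omega>^2 = (U + \<omega>*V + \<omega>^2*D) / D"
    using D by (simp add: field_simps)
  show ?thesis
    unfolding y using D nz by (simp add: 1 2 x3 d(1)[symmetric])
qed

text \<open>Through this homomorphism the chord-tangent law inherits closure, commutativity and
  associativity from the Hessian formula, as every Weierstrass point lies in the image.\<close>

lemma of_hessian_add:
  assumes c: "on_hessian c" and d: "on_hessian d"
  shows "point_add (triangular B) (of_hessian c) (of_hessian d) = of_hessian (hessian_add c d)"
proof -
  obtain u1 v1 u2 v2 where cd: "c = (u1, v1)" "d = (u2, v2)"
    by (metis surj_pair)
  note e1 = c[unfolded cd on_hessian.simps] and e2 = d[unfolded cd on_hessian.simps]
  define U V D where UVD: "U = u1 + v1^2*u2*v2" "V = v2^2*v1 + b*u1^2*u2" "D = b*u2^2*u1*v1 + v2"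
  have D: "D \<noteq> 0"
    using hessian_denominator c d unfolding cd UVD by blast
  have add: "hessian_add c d = (U / D, V / D)"
    by (simp add: cd UVD)
  define h1 h2 where h: "h1 = u1 + v1 + 1" "h2 = u2 + v2 + 1"
  consider "h1 = 0" | "h2 = 0" | "h1 \<noteq> 0" "h2 \<noteq> 0"
    by blast
  thus ?thesis
  proof cases
    case 1
    hence "u1 = 0" "v1 = 1"
      using hessian_at_infinity[of u1 v1] c by (simp_all add: cd h)
    moreover have "v2 \<noteq> 0"
      using hessian_v_nonzero d cd by blast
    ultimately show ?thesis
      by (simp add: cd power2_eq_square)
  next
    case 2
    hence "u2 = 0" "v2 = 1"
      using hessian_at_infinity[of u2 v2] d by (simp_all add: cd h)
    thus ?thesis
      by (cases "of_hessian c") (simp_all add: cd)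
  next
    case 3
    define x1 x2 y1 y2 where xy: "x1 = B*u1/h1" "x2 = B*u2/h2"
      "y1 = B*(u1 + \<omega>*v1 + \<omega>^2)/h1" "y2 = B*(u2 + \<omega>*v2 + \<omega>^2)/h2"
    have P: "of_hessian c = Affine x1 y1" "of_hessian d = Affine x2 y2"
      using 3 by (simp_all add: cd xy h)
    have on: "y1^2 + x1*y1 + B*y1 = x1^3" "y2^2 + x2*y2 + B*y2 = x2^3"
      using of_hessian_on_curve[OF c] of_hessian_on_curve[OF d] by (simp_all add: P)
    show ?thesis
    proof (cases "x1 = x2 \<and> y2 = y1 + x1 + B")
      case True
      have "of_hessian (u1 / v1, 1 / v1) = Affine x1 (y1 + x1 + B)"
        using hessian_add_inverse(3)[of u1 v1] c 3 unfolding cd xy h by blast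
      hence "of_hessian (u1 / v1, 1 / v1) = of_hessian d"
        using True by (simp add: P)
      hence "d = (u1 / v1, 1 / v1)"
        using of_hessian_inj hessian_add_inverse(2) c d cd by metis
      hence "hessian_add c d = (0, 1)"
        using hessian_add_inverse(1) c cd by blast
      thus ?thesis
        using True by (simp add: P add.assoc)
    next
      case False
      have sum: "point_add (triangular B) (of_hessian c) (of_hessian d)
        = Affine (l^2 + l + x1 + x2) ((l + 1) * (l^2 + l + x1 + x2) + y1 + l*x1 + B)"
        if "l = (if x1 = x2 then (x1^2 + y1) / (x1 + B) else (y2 + y1) / (x2 + x1))" for l
        using False unfolding P that by (simp add: Let_def add.assoc)
      show ?thesis
      proof (cases "x1 = x2")
        case True
        \<comment> \<open>Over a common x-coordinate there are only a point and its negative, and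
          the latter case has been excluded.\<close>
        have "(y1 + y2) * (y2 + (y1 + x1 + B)) = (y1^2 + x1*y1 + B*y1) + (y2^2 + x1*y2 + B*y2)"
          by (simp add: char_two_expand)
        also have "\<dots> = 0"
          using on True by simp
        finally have "y1 = y2"
          using False True by (simp add: add_eq_0_iff_char_two)
        hence "c = d"
          using of_hessian_inj c d P True by metis
        hence eq: "u2 = u1" "v2 = v1" "h2 = h1"
          using cd h by auto
        define p r s where prs: "p = 1 + u1*v1" "r = v1^2 + u1" "s = b*u1^2 + v1"
        have pr: "p + r = (v1 + 1) * h1"
          unfolding prs h by (simp add: char_two_expand)
        have xB: "x1 + B = B * (v1 + 1) / h1"
          using 3 by (simp add: xy field_simps) (simp add: h char_two_expand)
        have "x1 + B \<noteq> 0"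
          using False True \<open>y1 = y2\<close> by (auto simp: add.assoc)
        hence pr0: "p + r \<noteq> 0" and v1: "v1 + 1 \<noteq> 0"
          using 3 by (auto simp: pr xB)
        define l where l: "l = (\<omega>^2*p + \<omega>*r + s) / (p + r)"
        have "\<omega>^2*p + \<omega>*r + s = B*u1^2 + (u1 + \<omega>*v1 + \<omega>^2) * h1"
          unfolding prs h B_def by (simp add: omega_expand)
        hence "l = (x1^2 + y1) / (x1 + B)"
          unfolding l pr xB using 3 v1 B_nonzero
          by (simp add: xy divide_simps) (simp add: char_two_expand)
        hence l': "l = (if x1 = x2 then (x1^2 + y1) / (x1 + B) else (y2 + y1) / (x2 + x1))"
          using True by simp
        note tangent = hessian_tangent[OF e1, folded prs UVD[unfolded eq]]
        have "s * u1 + r * v1 + p = b*u1^3 + v1^3 + 1 + u1*v1"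
          unfolding prs by (simp add: char_two_expand)
        hence line: "s * u1 + r * v1 + p = 0"
          using e1 by simp
        \<comment> \<open>A third point at infinity would be (0 : 1 : 1), and its incidence with the
          tangent would force p + r = 0.\<close>
        have S: "U + V + D \<noteq> 0"
        proof
          assume S: "U + V + D = 0"
          have "(b + 1) * U * (p + r)^2 = 0"
            using tangent(2) S by simp
          hence "U = 0"
            using B_nonzero pr0 by (simp add: B_def)
          moreover from this have "V = D"
            using S by (simp add: add_eq_0_iff_char_two)
          ultimately have "D * (p + r) = 0"
            using tangent(1) by (simp add: algebra_simps)
          thus False
            using D pr0 by simp
        qed
        define N where N: "N = p^2 + r^2 + s^2 + p*r + p*s + r*s"
        note ll = slope_quadratic[OF pr0, of s, folded l N]
        have "N * (U + V + D) = B * U * (p + r)^2"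
          using tangent(2) by (simp add: add_eq_0_iff_char_two B_def N)
        hence "N / (p + r)^2 = B * U / (U + V + D)"
          using S pr0 by (simp add: frac_eq_eq)
        hence "l^2 + l + x1 + x2 = B * U / (U + V + D)"
          using True by (simp add: add.assoc flip: ll)
        thus ?thesis
          unfolding sum[OF l'] add
          using of_hessian_line[OF D pr0 S _ tangent(1) line refl, of x1 y1] 3(1)
          by (simp add: xy h l)
      next
        case False
        define p r s where prs: "p = u1*v2 + u2*v1" "r = u2 + u1" "s = v1 + v2"
        have pr: "p + r = u1*h2 + u2*h1"
          unfolding prs h by (simp add: char_two_expand)
        have x12: "x2 + x1 = B * (p + r) / (h1*h2)"
          using 3 unfolding pr xy by (simp add: field_simps)
        hence pr0: "p + r \<noteq> 0"
          using False by (auto simp: add_eq_0_iff_char_two)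
        define l where l: "l = (\<omega>^2*p + \<omega>*r + s) / (p + r)"
        have "(u2 + \<omega>*v2 + \<omega>^2)*h1 + (u1 + \<omega>*v1 + \<omega>^2)*h2 = \<omega>^2*p + \<omega>*r + s"
          unfolding prs h by (simp add: omega_expand)
        moreover have "y2 + y1 = B * ((u2 + \<omega>*v2 + \<omega>^2)*h1 + (u1 + \<omega>*v1 + \<omega>^2)*h2) / (h1*h2)"
          using 3 unfolding xy by (simp add: divide_simps) (simp add: algebra_simps)
        ultimately have "y2 + y1 = B * (\<omega>^2*p + \<omega>*r + s) / (h1*h2)"
          by simp
        hence l': "l = (if x1 = x2 then (x1^2 + y1) / (x1 + B) else (y2 + y1) / (x2 + x1))"
          using False 3 B_nonzero pr0 unfolding x12 l by simp
        note chord = hessian_chord[OF e1 e2, folded prs UVD h]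
        have line: "s * u1 + r * v1 + p = 0"
          unfolding prs by (simp add: char_two_expand)
        have S: "U + V + D \<noteq> 0"
        proof
          assume S: "U + V + D = 0"
          have "(b + 1) * U * h1 * h2 * (p + r)^2 = 0"
            using chord(2) S by simp
          hence "U = 0"
            using B_nonzero pr0 3 by (simp add: B_def)
          moreover from this have "V = D"
            using S by (simp add: add_eq_0_iff_char_two)
          ultimately have "D * (p + r) = 0"
            using chord(1) by (simp add: algebra_simps)
          thus False
            using D pr0 by simp
        qed
        define N where N: "N = p^2 + r^2 + s^2 + p*r + p*s + r*s"
        note ll = slope_quadratic[OF pr0, of s, folded l N]
        have N': "N * h1 * h2 * (U + V + D) + B * (p + r)^3 * (U + V + D) = B * U * h1 * h2 * (p + r)^2"
          using chord(2) by (simp add: add_eq_0_iff_char_two B_def N)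
        have "l^2 + l + (x2 + x1)
            = (N * h1 * h2 * (U + V + D) + B * (p + r)^3 * (U + V + D)) / ((p + r)^2 * h1 * h2 * (U + V + D))"
          unfolding ll x12 using pr0 3 S by (simp add: divide_simps power_numeral_reduce)
            (simp add: algebra_simps)
        also have "\<dots> = B * U / (U + V + D)"
          unfolding N' using pr0 3 S by simp
        finally have "l^2 + l + x1 + x2 = B * U / (U + V + D)"
          by (simp add: ac_simps)
        thus ?thesis
          unfolding sum[OF l'] add
          using of_hessian_line[OF D pr0 S _ chord(1) line refl, of x1 y1] 3(1)
          by (simp add: xy h l)
      qed
    qed
  qed
qed

lemma point_add_closed:
  assumes "on_curve (triangular B) P" "on_curve (triangular B) Q"
  shows "on_curve (triangular B) (point_add (triangular B) P Q)"
  using assms by (metis of_hessian_surj of_hessian_add of_hessian_on_curve hessian_add_closed)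

lemma point_add_commute:
  assumes "on_curve (triangular B) P" "on_curve (triangular B) Q"
  shows "point_add (triangular B) P Q = point_add (triangular B) Q P"
  using assms by (metis of_hessian_surj of_hessian_add hessian_add_commute)

lemma point_add_assoc:
  assumes "on_curve (triangular B) P" "on_curve (triangular B) Q" "on_curve (triangular B) R"
  shows "point_add (triangular B) (point_add (triangular B) P Q) R
    = point_add (triangular B) P (point_add (triangular B) Q R)"
proof -
  obtain c d e where "on_hessian c" "P = of_hessian c" "on_hessian d" "Q = of_hessian d"
    "on_hessian e" "R = of_hessian e"
    using assms of_hessian_surj by metis
  thus ?thesis
    by (simp add: of_hessian_add hessian_add_closed hessian_add_assoc)
qed

end

section \<open>The group of rational points\<close>

definition subfield_set :: "'a::field set \<Rightarrow> bool" where
  "subfield_set K \<longleftrightarrow> 0 \<in> K \<and> 1 \<in> K \<and> (\<forall>x\<in>K. \<forall>y\<in>K. x + y \<in> K \<and> x * y \<in> K \<and> x / y \<in> K)"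

lemma subfield_set_UNIV: "subfield_set UNIV"
  by (simp add: subfield_set_def)

context triangular_curve
begin

lemma point_add_rational:
  assumes K: "subfield_set K" "B \<in> K"
    and P: "P \<in> rational_points K (triangular B)" and Q: "Q \<in> rational_points K (triangular B)"
  shows "point_add (triangular B) P Q \<in> rational_points K (triangular B)"
proof (cases "\<exists>x1 y1 x2 y2. P = Affine x1 y1 \<and> Q = Affine x2 y2")
  case True
  then obtain x1 y1 x2 y2 where PQ: "P = Affine x1 y1" "Q = Affine x2 y2"
    by blast
  hence xy: "x1 \<in> K" "y1 \<in> K" "x2 \<in> K" "y2 \<in> K"
    using P Q by (auto simp: rational_points_def)
  have cl: "x + y \<in> K" "x * y \<in> K" "x / y \<in> K" if "x \<in> K" "y \<in> K" for x y
    using K that by (auto simp: subfield_set_def)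
  have "on_curve (triangular B) (point_add (triangular B) P Q)"
    using P Q by (simp add: rational_points_def point_add_closed)
  moreover have "case point_add (triangular B) P Q of Infinity \<Rightarrow> True | Affine x y \<Rightarrow> x \<in> K \<and> y \<in> K"
    using xy K unfolding PQ by (simp add: Let_def power2_eq_square cl subfield_set_def[of K])
  ultimately show ?thesis
    by (simp add: rational_points_def)
next
  case False
  thus ?thesis
    using P Q by (cases P; cases Q) auto
qed

lemma comm_group_mordell_weil:
  assumes K: "subfield_set K" "B \<in> K"
  shows "comm_group (mordell_weil_group K (triangular B))"
proof (rule comm_groupI)
  let ?G = "mordell_weil_group K (triangular B)"
  have on: "on_curve (triangular B) P" if "P \<in> carrier ?G" for P
    using that by (simp add: mordell_weil_group_def rational_points_def)
  show "\<one>\<^bsub>?G\<^esub> \<in> carrier ?G"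
    by (simp add: mordell_weil_group_def rational_points_def)
  fix P assume P: "P \<in> carrier ?G"
  show "\<one>\<^bsub>?G\<^esub> \<otimes>\<^bsub>?G\<^esub> P = P"
    by (simp add: mordell_weil_group_def)
  show "\<exists>Q\<in>carrier ?G. Q \<otimes>\<^bsub>?G\<^esub> P = \<one>\<^bsub>?G\<^esub>"
  proof (cases P)
    case Infinity
    thus ?thesis
      using P by (intro bexI[of _ P]) (simp_all add: mordell_weil_group_def)
  next
    case (Affine x y)
    have "(y + x + B)^2 + x * (y + x + B) + B * (y + x + B) = y^2 + x*y + B*y"
      by (simp add: char_two_expand)
    hence "Affine x (y + x + B) \<in> carrier ?G"
      using P K by (auto simp: Affine mordell_weil_group_def rational_points_def subfield_set_def)
    thus ?thesis
      by (intro bexI[of _ "Affine x (y + x + B)"]) (auto simp: Affine mordell_weil_group_def ac_simps)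
  qed
  fix Q assume Q: "Q \<in> carrier ?G"
  show "P \<otimes>\<^bsub>?G\<^esub> Q \<in> carrier ?G"
    using P Q point_add_rational[OF K] by (simp add: mordell_weil_group_def)
  show "P \<otimes>\<^bsub>?G\<^esub> Q = Q \<otimes>\<^bsub>?G\<^esub> P"
    using point_add_commute on[OF P] on[OF Q] by (simp add: mordell_weil_group_def)
  fix R assume R: "R \<in> carrier ?G"
  show "P \<otimes>\<^bsub>?G\<^esub> Q \<otimes>\<^bsub>?G\<^esub> R = P \<otimes>\<^bsub>?G\<^esub> (Q \<otimes>\<^bsub>?G\<^esub> R)"
    using point_add_assoc on[OF P] on[OF Q] on[OF R] by (simp add: mordell_weil_group_def)
qed

end

section \<open>The descent map y modulo cubes\<close>

context triangular_curve
begin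

text \<open>Vieta's formulas for the cubic obtained by substituting y = l x + m into the curve
  equation. The second symmetric function comes from the slope formula for a tangent and, for a
  chord, from adding the equations of two roots and cancelling x1 + x2.\<close>

lemma point_add_line:
  assumes P: "on_curve (triangular B) (Affine x1 y1)" and Q: "on_curve (triangular B) (Affine x2 y2)"
    and ninv: "\<not> (x1 = x2 \<and> y2 = y1 + x1 + B)"
  obtains l m x3 where "point_add (triangular B) (Affine x1 y1) (Affine x2 y2) = Affine x3 (l*x3 + m + x3 + B)"
    "y1 = l*x1 + m" "y2 = l*x2 + m" "x1 + x2 + x3 = l^2 + l"
    "x1*x2 + x1*x3 + x2*x3 = m + B*l" "x1*x2*x3 = m^2 + B*m"
proof -
  define l where l: "l = (if x1 = x2 then (x1^2 + y1) / (x1 + B) else (y2 + y1) / (x2 + x1))"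
  define m x3 where mx: "m = y1 + l*x1" "x3 = l^2 + l + x1 + x2"
  have "point_add (triangular B) (Affine x1 y1) (Affine x2 y2)
      = Affine x3 ((l + 1)*x3 + (y1 + l*x1) + B)"
    using ninv unfolding mx l by (simp add: Let_def add.assoc)
  hence sum: "point_add (triangular B) (Affine x1 y1) (Affine x2 y2) = Affine x3 (l*x3 + m + x3 + B)"
    by (simp add: mx(1) algebra_simps)
  have y1: "y1 = l*x1 + m"
    by (simp add: mx add.commute)
  have e1: "x1 + x2 + x3 = l^2 + l"
    by (simp add: mx(2) ac_simps)
  have root: "x^3 + (l^2 + l)*x^2 + (m + B*l)*x + (m^2 + B*m) = 0"
    if "on_curve (triangular B) (Affine x y)" "y = l*x + m" for x y
  proof -
    have "x^3 + (l^2 + l)*x^2 + (m + B*l)*x + (m^2 + B*m) = x^3 + (y^2 + x*y + B*y)"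
      unfolding that(2) by (simp add: char_two_expand)
    moreover have on: "y^2 + x*y + B*y = x^3"
      using that(1) by simp
    ultimately show ?thesis
      unfolding on by simp
  qed
  have e23: "x1*x2 + x1*x3 + x2*x3 = m + B*l \<and> y2 = l*x2 + m"
  proof (cases "x1 = x2")
    case True
    have "(y1 + y2) * (y2 + (y1 + x1 + B)) = (y1^2 + x1*y1 + B*y1) + (y2^2 + x1*y2 + B*y2)"
      by (simp add: char_two_expand)
    also have "\<dots> = 0"
      using P Q True by simp
    finally have y: "y1 = y2"
      using ninv True by (simp add: add_eq_0_iff_char_two)
    hence "x1 + B \<noteq> 0"
      using ninv True by (auto simp: add.assoc)
    hence "l * (x1 + B) = x1^2 + y1"
      using True by (simp add: l)
    hence "l*x1 + B*l = x1^2 + y1"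
      by (simp add: algebra_simps)
    moreover have "m + B*l = y1 + (l*x1 + B*l)"
      by (simp add: mx ac_simps)
    ultimately have "m + B*l = x1^2"
      by (simp add: add.left_commute)
    thus ?thesis
      using True y y1 by (simp add: power2_eq_square add.assoc)
  next
    case False
    hence d: "x1 + x2 \<noteq> 0"
      by (simp add: add_eq_0_iff_char_two)
    have "l * (x1 + x2) = y1 + y2"
      using False d by (simp add: l add.commute)
    hence y2: "y2 = l*x2 + m"
      by (simp add: mx algebra_simps add_eq_0_iff_char_two)
    have "(x1 + x2) * (x1*x2 + x1*x3 + x2*x3 + (m + B*l))
        = (x1^3 + (l^2 + l)*x1^2 + (m + B*l)*x1 + (m^2 + B*m))
          + (x2^3 + (l^2 + l)*x2^2 + (m + B*l)*x2 + (m^2 + B*m))"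
      unfolding mx(2) by (simp add: char_two_expand)
    also have "\<dots> = 0"
      using root[OF P y1] root[OF Q y2] by simp
    finally have "x1*x2 + x1*x3 + x2*x3 = m + B*l"
      using d by (simp add: add_eq_0_iff_char_two)
    thus ?thesis
      using y2 by simp
  qed
  have "x1*x2*x3 + (m^2 + B*m) = x1^3 + (x1 + x2 + x3)*x1^2 + (x1*x2 + x1*x3 + x2*x3)*x1 + (m^2 + B*m)"
    by (simp add: char_two_expand)
  also have "\<dots> = 0"
    using root[OF P y1] e23 e1 by simp
  finally have "x1*x2*x3 = m^2 + B*m"
    by (simp add: add_eq_0_iff_char_two)
  thus ?thesis
    using that sum y1 e1 e23 by blast
qed

text \<open>Modulo cubes, \<open>\<chi>\<close> is the connecting map of the descent by the 3-isogeny with kernel generated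
  by \<open>(0, 0)\<close>. The value at \<open>(0, 0)\<close> is the inverse of the value \<open>B\<close> at \<open>(0, B)\<close>, up to a cube.\<close>

fun \<chi> :: "'a point \<Rightarrow> 'a" where
  "\<chi> Infinity = 1"
| "\<chi> (Affine x y) = (if y = 0 then B^2 else y)"

lemma chi_nonzero: "\<chi> P \<noteq> 0"
  using B_nonzero by (cases P) auto

lemma point_on_curve_iff:
  "on_curve (triangular B) (Affine x y) \<longleftrightarrow> y * (y + x + B) = x^3"
  by (simp add: algebra_simps power2_eq_square)

text \<open>At (0, 0) the vanishing y is replaced by B^2, so this summand is treated apart. For
  general Q the line passes through the origin, hence m = 0, and Vieta's formulas give x2^3 y3 = B^2
  y2.\<close>

lemma chi_add_torsion:
  assumes Q: "on_curve (triangular B) Q"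
  shows "\<exists>k. k \<noteq> 0 \<and> \<chi> (Affine 0 0) * \<chi> Q = k^3 * \<chi> (point_add (triangular B) (Affine 0 0) Q)"
proof (cases Q)
  case Infinity
  thus ?thesis
    by (intro exI[of _ 1]) simp
next
  case (Affine x2 y2)
  have T: "on_curve (triangular B) (Affine 0 0)"
    by simp
  show ?thesis
  proof (cases "x2 = 0 \<and> y2 = B")
    case True
    thus ?thesis
      using B_nonzero Affine by (intro exI[of _ B]) (simp add: power2_eq_square power3_eq_cube)
  next
    case False
    hence "\<not> (0 = x2 \<and> y2 = 0 + 0 + B)"
      by auto
    then obtain l m x3 where
      sum: "point_add (triangular B) (Affine 0 0) (Affine x2 y2) = Affine x3 (l*x3 + m + x3 + B)"
      and m: "0 = l*0 + m" and y2: "y2 = l*x2 + m" and e1: "0 + x2 + x3 = l^2 + l"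
      and e2: "0*x2 + 0*x3 + x2*x3 = m + B*l"
      using point_add_line[OF T Q[unfolded Affine]] by blast
    define y3 where y3: "y3 = l*x3 + m + x3 + B"
    have on3: "on_curve (triangular B) (Affine x3 y3)"
      using point_add_closed[OF T Q] by (simp only: Affine sum y3)
    have m0: "m = 0"
      using m by simp
    show ?thesis
    proof (cases "y2 = 0")
      case True
      hence "x2 = 0"
        using Q Affine by simp
      hence "l = 0"
        using e2 m0 B_nonzero by auto
      hence "x3 = 0"
        using e1 \<open>x2 = 0\<close> by simp
      thus ?thesis
        using Affine sum True B_nonzero m0
        by (intro exI[of _ B]) (simp add: power_numeral_reduce)
    next
      case False
      hence nz: "l \<noteq> 0" "x2 \<noteq> 0"
        using y2 m0 by auto
      have x23: "x2*x3 = B*l"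
        using e2 m0 by simp
      hence x3: "x3 \<noteq> 0"
        using nz B_nonzero by auto
      have "y3 * (l*x3) = x3^3"
        using on3[unfolded point_on_curve_iff] by (simp add: y3 m0 ac_simps)
      hence "y3 * l = x3^2"
        using x3 by (simp add: power2_eq_square power3_eq_cube)
      hence y3': "y3 = x3^2 / l"
        using nz by (simp add: field_simps)
      have "x2^3 * y3 = x2 * (x2*x3)^2 / l"
        using nz by (simp add: y3' power_numeral_reduce)
      also have "\<dots> = B^2 * y2"
        using nz by (simp add: x23 y2 m0 power2_eq_square)
      finally have "x2^3 * y3 = B^2 * y2" .
      moreover have "y3 \<noteq> 0"
        using y3' x3 nz by simp
      ultimately show ?thesis
        using nz False unfolding Affine sum y3[symmetric] by (intro exI[of _ x2]) simp
    qed
  qed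
qed

text \<open>The function y has a triple zero at (0, 0) and a triple pole at infinity, so its product
  over three collinear points should be a cube. Indeed Vieta's formulas collapse the product of the
  three values of l x + m to m^3.\<close>

lemma chi_add:
  assumes P: "on_curve (triangular B) P" and Q: "on_curve (triangular B) Q"
  shows "\<exists>k. k \<noteq> 0 \<and> \<chi> P * \<chi> Q = k^3 * \<chi> (point_add (triangular B) P Q)"
proof -
  consider "P = Infinity" | "Q = Infinity" | "P = Affine 0 0" | "Q = Affine 0 0"
    | x1 y1 x2 y2 where "P = Affine x1 y1" "Q = Affine x2 y2" "y1 \<noteq> 0" "y2 \<noteq> 0"
  proof (cases P; cases Q)
    fix x1 y1 x2 y2 assume *: "P = Affine x1 y1" "Q = Affine x2 y2"
    have "x1 = 0" if "y1 = 0"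
      using P * that by simp
    moreover have "x2 = 0" if "y2 = 0"
      using Q * that by simp
    ultimately show thesis
      using that * by blast
  qed
  thus ?thesis
  proof cases
    case 1
    thus ?thesis
      by (intro exI[of _ 1]) simp
  next
    case 2
    thus ?thesis
      by (intro exI[of _ 1]) (cases P; simp)
  next
    case 3
    thus ?thesis
      using chi_add_torsion[OF Q] by simp
  next
    case 4
    thus ?thesis
      using chi_add_torsion[OF P] point_add_commute[OF P Q] by (simp add: mult.commute)
  next
    case 5
    show ?thesis
    proof (cases "x1 = x2 \<and> y2 = y1 + x1 + B")
      case True
      hence "y1 * y2 = x1^3"
        using P 5 by (simp only: point_on_curve_iff)
      moreover from this have "x1 \<noteq> 0"
        using 5 by auto
      ultimately show ?thesis
        using True 5 by (intro exI[of _ x1]) simp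
    next
      case False
      then obtain l m x3 where
        sum: "point_add (triangular B) (Affine x1 y1) (Affine x2 y2) = Affine x3 (l*x3 + m + x3 + B)"
        and y: "y1 = l*x1 + m" "y2 = l*x2 + m" and e1: "x1 + x2 + x3 = l^2 + l"
        and e2: "x1*x2 + x1*x3 + x2*x3 = m + B*l" and e3: "x1*x2*x3 = m^2 + B*m"
        using point_add_line[OF P[unfolded 5] Q[unfolded 5]] by blast
      \<comment> \<open>\<open>n3\<close> is the ordinate of the third point on the line and
        \<open>y3\<close> that of its negative, which is the sum. By the curve equation their
        product is x3^3.\<close>
      define n3 y3 where n: "n3 = l*x3 + m" "y3 = l*x3 + m + x3 + B"
      have "on_curve (triangular B) (Affine x3 y3)"
        using point_add_closed[OF P Q] by (simp only: 5 sum n)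
      hence n3: "y3 * n3 = x3^3"
        unfolding point_on_curve_iff by (simp add: n ac_simps)
      have "y1 * y2 * n3 = l^3 * (x1*x2*x3) + l^2 * m * (x1*x2 + x1*x3 + x2*x3)
          + l * m^2 * (x1 + x2 + x3) + m^3"
        unfolding y n by (simp add: char_two_expand)
      also have "\<dots> = m^3"
        unfolding e1 e2 e3 by (simp add: char_two_expand)
      finally have prod: "y1 * y2 * n3 = m^3" .
      have sum': "point_add (triangular B) P Q = Affine x3 y3"
        by (simp only: 5 sum n)
      \<comment> \<open>The special cases are the sum (0, 0), where \<open>\<chi>\<close> takes its
        exceptional value, and the sum (0, B), where the third collinear point is (0, 0).\<close>
      consider "y3 = 0" | "y3 \<noteq> 0" "n3 = 0" | "y3 \<noteq> 0" "n3 \<noteq> 0"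
        by blast
      thus ?thesis
      proof cases
        case 1
        hence "x3 = 0"
          using n3 by simp
        hence nB: "n3 = B"
          using 1 by (simp add: n add_eq_0_iff_char_two)
        hence "m \<noteq> 0"
          using prod 5 B_nonzero by auto
        moreover have "y1 * y2 = (m / B)^3 * B^2"
          using prod B_nonzero unfolding nB by (simp add: field_simps power_numeral_reduce)
        ultimately show ?thesis
          using 1 5 B_nonzero unfolding sum' by (intro exI[of _ "m / B"]) simp
      next
        case 2
        hence x3: "x3 = 0"
          using n3 by simp
        hence m: "m = 0" and y3: "y3 = B"
          using 2 by (simp_all add: n)
        have "y1 * y2 = l^3 * B"
          using e2 by (simp add: y m x3 algebra_simps power_numeral_reduce)
        moreover have "l \<noteq> 0"
          using 5 y m by auto
        ultimately show ?thesis
          using 2 5 B_nonzero unfolding sum' by (intro exI[of _ l]) (simp add: y3)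
      next
        case 3
        hence "x3 \<noteq> 0" "m \<noteq> 0"
          using n3 prod 5 by auto
        moreover have "y1 * y2 * x3^3 = m^3 * y3"
          by (simp flip: n3 prod)
        ultimately show ?thesis
          using 3 5 unfolding sum' by (intro exI[of _ "m / x3"]) (simp add: field_simps power_divide)
      qed
    qed
  qed
qed

section \<open>Multiplication by 3 as a composition of two isogenies\<close>

abbreviation triple :: "'a point \<Rightarrow> 'a point" where
  "triple P \<equiv> point_add (triangular B) (point_add (triangular B) P P) P"

text \<open>With p = 1 / (u v), r = v^2 / u and s = b u^2 / v the curve equation reads p + r + s =
  1, and p r s = b. The Fourier transforms \<open>z\<close>, \<open>w\<close> of (p, r, s) satisfy
  z^3 + w^3 + z w = B, so that (z w, z^3) lies on the Weierstrass curve.\<close>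

lemma triple_of_hessian:
  assumes c: "on_hessian (u, v)" and u: "u \<noteq> 0"
  defines "z \<equiv> (1 + \<omega>^2*v^3 + \<omega>*(b*u^3)) / (u*v)" and "w \<equiv> (1 + \<omega>*v^3 + \<omega>^2*(b*u^3)) / (u*v)"
  shows "triple (of_hessian (u, v)) = Affine (z * w) (z^3)"
proof -
  have v: "v \<noteq> 0"
    using hessian_v_nonzero[OF c] .
  \<comment> \<open>Tripling becomes a computation in these quantities subject to \<delta> =
    \<alpha> + \<beta> + 1 and \<alpha> \<beta> = b \<delta>^3.\<close>
  define \<alpha> \<beta> \<delta> where d: "\<alpha> = b*u^3" "\<beta> = v^3" "\<delta> = u*v"
  have \<delta>: "\<delta> = \<alpha> + \<beta> + 1" and \<delta>0: "\<delta> \<noteq> 0"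
    using c u v by (simp_all add: d)
  have \<alpha>\<beta>: "\<alpha> * \<beta> = b * \<delta>^3"
    by (simp add: d power_mult_distrib)
  define U V D where UVD: "U = u*(1 + \<beta>)" "V = \<alpha> + \<beta>" "D = v*(\<alpha> + 1)"
  have UVD': "U = u + v^2*u*v" "V = v^2*v + b*u^2*u" "D = b*u^2*u*v + v"
    unfolding UVD d by (simp_all add: power_numeral_reduce algebra_simps)
  have D: "D \<noteq> 0"
    using hessian_denominator[OF c c] unfolding UVD' .
  have add2: "hessian_add (u, v) (u, v) = (U / D, V / D)"
    by (simp add: UVD')
  define N A E where NAE: "N = 1 + \<alpha>^2 + \<beta>^2 + \<alpha> + \<beta> + \<alpha>*\<beta>"
    "A = \<beta>*(\<alpha> + \<beta>)*(\<alpha> + 1) + \<alpha>*(1 + \<beta>)^2" "E = \<alpha>*(1 + \<beta>)*(\<alpha> + \<beta>) + \<beta>*(\<alpha> + 1)^2"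
  have "U*D + V^2*u*v = \<delta>*N" "b*u^2*U*V + D^2*v = E" "v^2*V*D + b*U^2*u = A"
    unfolding UVD NAE d by (simp_all add: char_two_expand)
  hence add3: "hessian_add (hessian_add (u, v) (u, v)) (u, v) = (\<delta>*N / E, A / E)"
    unfolding add2 hessian_add_frac_left[OF D] by simp
  have "b*u^2*(U/D)*(V/D) + v \<noteq> 0"
    using hessian_denominator[OF hessian_add_closed[OF c c, unfolded add2] c] by simp
  moreover have "b*u^2*(U/D)*(V/D) + v = (b*u^2*U*V + D^2*v) / D^2"
    using D by (simp add: field_simps power2_eq_square)
  ultimately have E: "E \<noteq> 0"
    using \<open>b*u^2*U*V + D^2*v = E\<close> by auto
  have "\<delta>*N + A + E = \<delta>^3 + \<alpha>*\<beta>"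
    unfolding NAE \<delta> by (simp add: char_two_expand)
  also have "\<dots> = B*\<delta>^3"
    unfolding \<alpha>\<beta> by (simp add: B_def algebra_simps)
  finally have h: "\<delta>*N / E + A / E + 1 = B*\<delta>^3 / E"
    using E by (simp add: field_simps)
  have y: "\<delta>*N / E + \<omega>*(A / E) + \<omega>^2 = (\<delta>*N + \<omega>*A + \<omega>^2*E) / E"
    using E by (simp add: field_simps)
  have "triple (of_hessian (u, v)) = of_hessian (\<delta>*N / E, A / E)"
    by (simp only: of_hessian_add hessian_add_closed c add3)
  also have "\<dots> = Affine (N / \<delta>^2) ((\<delta>*N + \<omega>*A + \<omega>^2*E) / \<delta>^3)"
    unfolding of_hessian.simps h y using E \<delta>0 B_nonzero by (simp add: field_simps power_numeral_reduce)
  also have "N / \<delta>^2 = z * w"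
  proof -
    have "(1 + \<omega>^2*\<beta> + \<omega>*\<alpha>) * (1 + \<omega>*\<beta> + \<omega>^2*\<alpha>) = N"
      unfolding NAE by (simp add: omega_expand)
    thus ?thesis
      by (simp add: z_def w_def power2_eq_square flip: d)
  qed
  also have "(\<delta>*N + \<omega>*A + \<omega>^2*E) / \<delta>^3 = z^3"
  proof -
    have "(1 + \<omega>^2*\<beta> + \<omega>*\<alpha>)^3 = \<delta>*N + \<omega>*A + \<omega>^2*E"
      unfolding NAE \<delta> by (simp add: omega_expand)
    thus ?thesis
      by (simp add: z_def power_divide flip: d)
  qed
  finally show ?thesis .
qed

text \<open>By \<open>triple_of_hessian\<close> a point with u \<noteq> 0 has an affine triple, so
  3-torsion forces u = 0 and thus x = 0.\<close>

lemma three_torsion: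
  assumes "on_curve (triangular B) P" "triple P = Infinity"
  shows "P \<in> {Infinity, Affine 0 0, Affine 0 B}"
proof -
  obtain u v where c: "on_hessian (u, v)" and P: "P = of_hessian (u, v)"
    using of_hessian_surj[OF assms(1)] by (metis surj_pair)
  have "u = 0"
    using triple_of_hessian[OF c] assms(2) unfolding P by auto
  show ?thesis
  proof (cases P)
    case (Affine x y)
    hence "x = 0"
      using P \<open>u = 0\<close> by (simp split: if_splits)
    hence "y * (y + B) = 0"
      using assms(1) Affine by (simp add: algebra_simps power2_eq_square)
    thus ?thesis
      using Affine \<open>x = 0\<close> by (auto simp: add_eq_0_iff_char_two)
  qed simp
qed

text \<open>This inverts the passage to (p, r, s). There p^2 r = 1 / u^3 and u v = 1 / p, so a cube
  root \<open>Z\<close> of p^2 r is all that is missing to recover (u, v).\<close>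

lemma triple_descent:
  assumes sum: "p + r + s = 1" and prod: "p * r * s = b" and cube: "p^2 * r = Z^3"
  defines "z \<equiv> p + \<omega>^2*r + \<omega>*s" and "w \<equiv> p + \<omega>*r + \<omega>^2*s"
  shows "on_hessian (1 / Z, p*r / Z^2)"
    and "triple (of_hessian (1 / Z, p*r / Z^2)) = Affine (z * w) (z^3)"
proof -
  have nz: "p \<noteq> 0" "r \<noteq> 0"
    using prod b_nonzero by auto
  hence Z: "Z \<noteq> 0"
    using cube by auto
  have \<delta>: "(1 / Z) * (p*r / Z^2) = 1 / p"
  proof -
    have "(1 / Z) * (p*r / Z^2) = p * r / Z^3"
      by (simp add: power_numeral_reduce)
    thus ?thesis
      using nz by (simp add: power2_eq_square flip: cube)
  qed
  have "Z^6 = (p^2*r)^2"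
    unfolding cube by (simp flip: power_mult)
  hence \<beta>: "(p*r / Z^2)^3 = r / p"
    using nz Z by (simp add: power_divide power_mult_distrib flip: power_mult)
      (simp add: field_simps power_numeral_reduce)
  have "b * (1 / Z)^3 = p * r * s / (p^2 * r)"
    unfolding cube prod by (simp add: power_divide)
  hence \<alpha>: "b * (1 / Z)^3 = s / p"
    using nz by (simp add: power2_eq_square)
  have "s / p + r / p + 1 = 1 / p"
    using nz sum by (simp add: field_simps)
  thus c: "on_hessian (1 / Z, p*r / Z^2)"
    unfolding on_hessian.simps \<alpha> \<beta> \<delta> .
  show "triple (of_hessian (1 / Z, p*r / Z^2)) = Affine (z * w) (z^3)"
  proof -
    have "(1 + \<omega>^2*(r/p) + \<omega>*(s/p)) / (1/p) = z" "(1 + \<omega>*(r/p) + \<omega>^2*(s/p)) / (1/p) = w"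
      using nz by (simp_all add: z_def w_def field_simps)
    thus ?thesis
      using triple_of_hessian[OF c] Z unfolding \<alpha> \<beta> \<delta> by simp
  qed
qed

end

section \<open>Ranks of abelian groups by 3-descent\<close>

text \<open>Fraction-free Gaussian elimination: \<open>i0\<close> is the pivot for the column
  \<open>j\<close>, and its coefficient in the relation is chosen to cancel that column.\<close>

lemma int_linear_relation:
  fixes n :: "'i \<Rightarrow> 'j \<Rightarrow> int"
  assumes "finite J" "finite I" "card J < card I"
  shows "\<exists>c. (\<exists>i\<in>I. c i \<noteq> 0) \<and> (\<forall>j\<in>J. (\<Sum>i\<in>I. c i * n i j) = 0)"
  using assms
proof (induction J arbitrary: I n rule: finite_induct)
  case empty
  then obtain i where "i \<in> I"
    by fastforce
  thus ?case
    by (intro exI[of _ "\<lambda>_. 1"]) auto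
next
  case (insert j J)
  show ?case
  proof (cases "\<forall>i\<in>I. n i j = 0")
    case True
    obtain c where "\<exists>i\<in>I. c i \<noteq> 0" "\<forall>j\<in>J. (\<Sum>i\<in>I. c i * n i j) = 0"
      using insert.IH[of I n] insert.prems insert.hyps by auto
    thus ?thesis
      using True by (intro exI[of _ c]) auto
  next
    case False
    then obtain i0 where i0: "i0 \<in> I" "n i0 j \<noteq> 0"
      by blast
    define I' where "I' = I - {i0}"
    have I': "finite I'" "card J < card I'" "I = insert i0 I'" "i0 \<notin> I'"
      using insert.prems insert.hyps i0 by (auto simp: I'_def)
    obtain c where c: "\<exists>i\<in>I'. c i \<noteq> 0"
      "\<forall>k\<in>J. (\<Sum>i\<in>I'. c i * (n i0 j * n i k - n i j * n i0 k)) = 0"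
      using insert.IH[of I' "\<lambda>i k. n i0 j * n i k - n i j * n i0 k"] I' by auto
    define c' where "c' = (\<lambda>i. if i = i0 then - (\<Sum>i\<in>I'. c i * n i j) else c i * n i0 j)"
    have c'_sum: "(\<Sum>i\<in>I. c' i * n i k) = (\<Sum>i\<in>I'. c i * (n i0 j * n i k - n i j * n i0 k))" for k
    proof -
      have "(\<Sum>i\<in>I'. c' i * n i k) = (\<Sum>i\<in>I'. c i * n i0 j * n i k)"
        using I' by (intro sum.cong) (auto simp: c'_def)
      thus ?thesis
        using I' by (simp add: c'_def sum_distrib_right right_diff_distrib sum_subtractf mult.assoc)
    qed
    have "\<forall>k\<in>insert j J. (\<Sum>i\<in>I. c' i * n i k) = 0"
      using c(2) unfolding c'_sum by (auto simp: mult.commute)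
    moreover have "\<exists>i\<in>I. c' i \<noteq> 0"
      using c(1) I' i0 by (auto simp: c'_def)
    ultimately show ?thesis
      by blast
  qed
qed

text \<open>Modulo 3 the maps \<open>v z\<close> are dual to the elements \<open>P z\<close>. All
  values of \<open>T\<close> are 2, so this torsion element is the source of one relation that
  involves every \<open>P z\<close>; \<open>z0\<close> marks the generator to be eliminated with it.
  The last assumption says that \<open>v z0\<close> detects 3-torsion.\<close>

locale three_descent = comm_group G for G (structure) +
  fixes Z :: "'z set" and z0 :: 'z and P :: "'z \<Rightarrow> 'a" and v :: "'z \<Rightarrow> 'a \<Rightarrow> int" and T :: 'a
  assumes fin: "finite Z" and z0: "z0 \<in> Z"
    and P_closed: "z \<in> Z \<Longrightarrow> P z \<in> carrier G"
    and v_mult: "\<lbrakk>z \<in> Z; x \<in> carrier G; y \<in> carrier G\<rbrakk> \<Longrightarrow> [v z (x \<otimes> y) = v z x + v z y] (mod 3)"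
    and v_P: "\<lbrakk>z \<in> Z; z' \<in> Z\<rbrakk> \<Longrightarrow> [v z (P z') = (if z = z' then 1 else 0)] (mod 3)"
    and T_closed: "T \<in> carrier G" and T_cube: "T [^] (3::int) = \<one>" and v_T: "z \<in> Z \<Longrightarrow> [v z T = 2] (mod 3)"
    and torsion: "\<lbrakk>x \<in> carrier G; x [^] (3::int) = \<one>; [v z0 x = 0] (mod 3)\<rbrakk> \<Longrightarrow> x = \<one>"
begin

definition comb :: "('z \<Rightarrow> int) \<Rightarrow> 'a" where
  "comb n = (\<Otimes>z\<in>Z. P z [^] n z)"

lemma comb_closed [simp]: "comb n \<in> carrier G"
  unfolding comb_def using P_closed by (intro finprod_closed) auto

lemma comb_add: "comb (\<lambda>z. n z + m z) = comb n \<otimes> comb m"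
proof -
  have "comb (\<lambda>z. n z + m z) = (\<Otimes>z\<in>Z. P z [^] n z \<otimes> P z [^] m z)"
    unfolding comb_def using P_closed by (intro finprod_cong') (auto simp: int_pow_mult)
  also have "\<dots> = comb n \<otimes> comb m"
    unfolding comb_def using P_closed by (intro finprod_multf) auto
  finally show ?thesis .
qed

lemma finprod_int_pow:
  assumes "finite A" "f \<in> A \<rightarrow> carrier G"
  shows "(\<Otimes>z\<in>A. f z) [^] (k::int) = (\<Otimes>z\<in>A. f z [^] k)"
  using assms
proof (induction A rule: finite_induct)
  case (insert a A)
  have "f \<in> A \<rightarrow> carrier G" "f a \<in> carrier G"
    using insert by auto
  thus ?case
    using insert by (simp add: int_pow_distrib Pi_iff)
qed simp

lemma comb_scale: "comb (\<lambda>z. k * n z) = comb n [^] k"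
proof -
  have "comb n [^] k = (\<Otimes>z\<in>Z. (P z [^] n z) [^] k)"
    unfolding comb_def using P_closed fin by (intro finprod_int_pow) auto
  also have "\<dots> = comb (\<lambda>z. k * n z)"
    unfolding comb_def using P_closed by (intro finprod_cong') (auto simp: int_pow_pow mult.commute)
  finally show ?thesis ..
qed

lemma comb_zero: "comb (\<lambda>_. 0) = \<one>"
  unfolding comb_def by (intro finprod_one_eqI) simp

lemma comb_sum:
  assumes "finite S"
  shows "comb (\<lambda>z. \<Sum>s\<in>S. n s z) = (\<Otimes>s\<in>S. comb (n s))"
  using assms
  by (induction S rule: finite_induct) (simp_all add: comb_zero comb_add)

lemma v_one:
  assumes "z \<in> Z"
  shows "[v z \<one> = 0] (mod 3)"
proof -
  have "[v z (\<one> \<otimes> \<one>) = v z \<one> + v z \<one>] (mod 3)"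
    using assms by (intro v_mult) auto
  thus ?thesis
    by (simp add: cong_iff_dvd_diff)
qed

lemma v_nat_pow:
  assumes "z \<in> Z" "x \<in> carrier G"
  shows "[v z (x [^] (n::nat)) = int n * v z x] (mod 3)"
proof (induction n)
  case 0
  show ?case
    using v_one[OF assms(1)] by simp
next
  case (Suc n)
  have "[v z (x [^] n \<otimes> x) = v z (x [^] n) + v z x] (mod 3)"
    using assms by (intro v_mult) auto
  also have "[v z (x [^] n) + v z x = int n * v z x + v z x] (mod 3)"
    by (intro cong_add Suc.IH cong_refl)
  finally show ?case
    by (simp add: algebra_simps)
qed

lemma v_int_pow:
  assumes "z \<in> Z" "x \<in> carrier G"
  shows "[v z (x [^] (n::int)) = n * v z x] (mod 3)"
proof (cases n rule: int_cases2)
  case (nonneg k)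
  thus ?thesis
    using v_nat_pow[OF assms, of k] by (simp only: int_pow_int)
next
  case (nonpos k)
  have "[v z (x [^] n \<otimes> x [^] (- n)) = v z (x [^] n) + v z (x [^] (- n))] (mod 3)"
    using assms by (intro v_mult) auto
  moreover have "x [^] n \<otimes> x [^] (- n) = \<one>"
    using assms(2) by (simp add: int_pow_mult[symmetric])
  moreover have neg: "[v z (x [^] (- n)) = - n * v z x] (mod 3)"
    using v_nat_pow[OF assms, of k] by (simp only: nonpos int_pow_int minus_minus)
  ultimately have "[v z (x [^] n) + v z (x [^] (- n)) = 0] (mod 3)"
    using v_one[OF assms(1)] by (auto simp: cong_def)
  moreover have "[v z (x [^] n) + v z (x [^] (- n)) = v z (x [^] n) + - n * v z x] (mod 3)"
    by (intro cong_add cong_refl neg)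
  ultimately have "[v z (x [^] n) + - n * v z x = 0] (mod 3)"
    by (simp add: cong_def)
  thus ?thesis
    by (simp add: cong_iff_dvd_diff)
qed

lemma v_finprod:
  assumes "z \<in> Z" "finite A" "f \<in> A \<rightarrow> carrier G"
  shows "[v z (\<Otimes>a\<in>A. f a) = (\<Sum>a\<in>A. v z (f a))] (mod 3)"
  using assms(2,3)
proof (induction A rule: finite_induct)
  case empty
  show ?case
    using v_one[OF assms(1)] by simp
next
  case (insert a A)
  have f: "f \<in> A \<rightarrow> carrier G" "f a \<in> carrier G"
    using insert by auto
  have "[v z (f a \<otimes> (\<Otimes>a\<in>A. f a)) = v z (f a) + v z (\<Otimes>a\<in>A. f a)] (mod 3)"
    using f assms(1) by (intro v_mult) auto
  also have "[v z (f a) + v z (\<Otimes>a\<in>A. f a) = v z (f a) + (\<Sum>a\<in>A. v z (f a))] (mod 3)"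
    using insert f by (intro cong_add cong_refl) auto
  finally show ?case
    using insert f by simp
qed

lemma v_comb:
  assumes "z \<in> Z"
  shows "[v z (comb n) = n z] (mod 3)"
proof -
  have "[v z (comb n) = (\<Sum>a\<in>Z. v z (P a [^] n a))] (mod 3)"
    unfolding comb_def using P_closed assms fin by (intro v_finprod) auto
  also have "[(\<Sum>a\<in>Z. v z (P a [^] n a)) = (\<Sum>a\<in>Z. n a * (if z = a then 1 else 0))] (mod 3)"
  proof (intro cong_sum)
    fix a assume a: "a \<in> Z"
    have "[v z (P a [^] n a) = n a * v z (P a)] (mod 3)"
      using assms a P_closed by (intro v_int_pow)
    also have "[n a * v z (P a) = n a * (if z = a then 1 else 0)] (mod 3)"
      using v_P assms a by (intro cong_mult cong_refl)
    finally show "[v z (P a [^] n a) = n a * (if z = a then 1 else 0)] (mod 3)" .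
  qed
  also have "(\<Sum>a\<in>Z. n a * (if z = a then 1 else 0)) = n z"
    using assms fin by (simp add: if_distrib cong: if_cong)
  finally show ?thesis .
qed

text \<open>Infinite descent on the sum of the absolute coefficients. Applying \<open>v\<close>
  shows that 3 divides each coefficient; a third of the relation is a 3-torsion element on which
  \<open>v z0\<close> vanishes, hence again a relation.\<close>

lemma comb_eq_one:
  assumes "comb n = \<one>" "n z0 = 0"
  shows "\<forall>z\<in>Z. n z = 0"
  using assms
proof (induction "nat (\<Sum>z\<in>Z. \<bar>n z\<bar>)" arbitrary: n rule: less_induct)
  case less
  have dvd: "3 dvd n z" if "z \<in> Z" for z
  proof -
    have "[n z = v z (comb n)] (mod 3)"
      using v_comb[OF that] by (rule cong_sym)
    also have "[v z (comb n) = 0] (mod 3)"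
      unfolding less.prems(1) by (rule v_one[OF that])
    finally show ?thesis
      by (simp add: cong_0_iff)
  qed
  define m where "m = (\<lambda>z. n z div 3)"
  have m: "n z = 3 * m z" if "z \<in> Z" for z
    using dvd[OF that] by (simp add: m_def)
  have "comb m [^] (3::int) = comb n"
    unfolding comb_scale[symmetric] unfolding comb_def using P_closed m by (intro finprod_cong') auto
  moreover have m0: "m z0 = 0"
    using m[OF z0] less.prems by simp
  ultimately have m1: "comb m = \<one>"
    using v_comb[OF z0, of m] less.prems(1) by (intro torsion[OF comb_closed]) simp_all
  show ?case
  proof (rule ccontr)
    assume "\<not> (\<forall>z\<in>Z. n z = 0)"
    then obtain z where z: "z \<in> Z" "n z \<noteq> 0"
      by blast
    have "(\<Sum>z\<in>Z. \<bar>m z\<bar>) < (\<Sum>z\<in>Z. \<bar>n z\<bar>)"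
      using z m fin by (intro sum_strict_mono_ex1 bexI[of _ z]) auto
    moreover have "0 \<le> (\<Sum>z\<in>Z. \<bar>m z\<bar>)"
      by (intro sum_nonneg) auto
    ultimately have "nat (\<Sum>z\<in>Z. \<bar>m z\<bar>) < nat (\<Sum>z\<in>Z. \<bar>n z\<bar>)"
      by linarith
    hence "\<forall>z\<in>Z. m z = 0"
      by (rule less.hyps[OF _ m1 m0])
    thus False
      using z m by auto
  qed
qed

lemma inj_P: "inj_on P Z"
proof (rule inj_onI, rule ccontr)
  fix x y assume *: "x \<in> Z" "y \<in> Z" "P x = P y" "x \<noteq> y"
  have "[1 = (0::int)] (mod 3)"
    using v_P[OF *(1,1)] v_P[OF *(1,2)] * by (simp add: cong_def)
  thus False
    by (simp add: cong_def)
qed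

lemma independent_P: "int_independent G (P ` (Z - {z0}))"
  unfolding int_independent_def
proof (intro conjI allI impI)
  show "finite (P ` (Z - {z0}))" "P ` (Z - {z0}) \<subseteq> carrier G"
    using fin P_closed by auto
  fix n :: "'a \<Rightarrow> int"
  assume n: "(\<Otimes>x\<in>P ` (Z - {z0}). x [^] n x) = \<one>"
  define m where "m = (\<lambda>z. if z = z0 then 0 else n (P z))"
  have Z: "Z = insert z0 (Z - {z0})"
    using z0 by blast
  have "comb m = (\<Otimes>z\<in>Z - {z0}. P z [^] m z)"
    unfolding comb_def using fin P_closed z0 by (subst Z, subst finprod_insert) (auto simp: m_def)
  also have "\<dots> = (\<Otimes>z\<in>Z - {z0}. P z [^] n (P z))"
    using P_closed by (intro finprod_cong') (auto simp: m_def)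
  also have "\<dots> = (\<Otimes>x\<in>P ` (Z - {z0}). x [^] n x)"
    using P_closed inj_P by (subst finprod_reindex) (auto intro: inj_on_subset)
  finally have "comb m = \<one>"
    using n by simp
  hence "\<forall>z\<in>Z. m z = 0"
    by (intro comb_eq_one) (auto simp: m_def)
  thus "\<forall>x\<in>P ` (Z - {z0}). n x = 0"
    by (auto simp: m_def split: if_splits)
qed

text \<open>This is all that heights have to supply: a finite set in which one can subtract a
  combination and divide by 3 without leaving it.\<close>

definition descends :: "'a set \<Rightarrow> bool" where
  "descends S \<longleftrightarrow> finite S \<and> S \<subseteq> carrier G \<and>
     (\<forall>x\<in>S. \<exists>y\<in>S. \<exists>n. x = comb n \<otimes> y [^] (3::int))"

text \<open>An orbit of the descent map on a finite set is eventually periodic; this replaces finite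
  generation.\<close>

lemma descends_multiple:
  assumes S: "descends S" and x: "x \<in> S"
  shows "\<exists>m n. [m = 1] (mod 3) \<and> x [^] (m::int) = comb n"
proof -
  have SG: "S \<subseteq> carrier G"
    using S by (simp add: descends_def)
  obtain f g where fg: "\<And>x. x \<in> S \<Longrightarrow> f x \<in> S \<and> x = comb (g x) \<otimes> f x [^] (3::int)"
    using S unfolding descends_def by metis
  define a where "a = (\<lambda>i. (f ^^ i) x)"
  have aS: "a i \<in> S" for i
    by (induction i) (auto simp: a_def x fg)
  hence aG: "a i \<in> carrier G" for i
    using SG by blast
  have step: "\<exists>n. a i = comb n \<otimes> a (i + k) [^] ((3::int) ^ k)" for i k
  proof (induction k)
    case 0
    show ?case
      using aG by (intro exI[of _ "\<lambda>_. 0"]) (simp add: comb_zero)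
  next
    case (Suc k)
    then obtain n where n: "a i = comb n \<otimes> a (i + k) [^] ((3::int) ^ k)"
      by blast
    define y n' where y: "y = a (i + Suc k)" and n': "n' = g (a (i + k))"
    have yG: "y \<in> carrier G"
      using aG by (simp add: y)
    have e: "a (i + k) = comb n' \<otimes> y [^] (3::int)"
      using fg[OF aS[of "i + k"]] by (simp add: a_def y n')
    have "a (i + k) [^] ((3::int) ^ k) = comb n' [^] ((3::int) ^ k) \<otimes> (y [^] (3::int)) [^] ((3::int) ^ k)"
      unfolding e using yG by (intro int_pow_distrib) auto
    also have "\<dots> = comb (\<lambda>z. 3 ^ k * n' z) \<otimes> y [^] ((3::int) ^ Suc k)"
      using yG by (simp add: comb_scale int_pow_pow)
    finally have "a i = comb n \<otimes> (comb (\<lambda>z. 3 ^ k * n' z) \<otimes> y [^] ((3::int) ^ Suc k))"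
      using n by simp
    also have "\<dots> = comb (\<lambda>z. n z + 3 ^ k * n' z) \<otimes> y [^] ((3::int) ^ Suc k)"
      using yG by (simp only: comb_add) (simp add: m_assoc)
    finally have "a i = comb (\<lambda>z. n z + 3 ^ k * n' z) \<otimes> a (i + Suc k) [^] ((3::int) ^ Suc k)"
      unfolding y .
    thus ?case
      by blast
  qed
  have "\<not> inj a"
  proof
    assume "inj a"
    hence "infinite (range a)"
      by (simp add: finite_image_iff)
    moreover have "range a \<subseteq> S"
      using aS by blast
    ultimately show False
      using S finite_subset by (auto simp: descends_def)
  qed
  then obtain i k where ik: "a i = a (i + Suc k)"
  proof -
    obtain i j where "a i = a j" "i \<noteq> j"
      using \<open>\<not> inj a\<close> by (auto simp: inj_def)
    hence "a (min i j) = a (max i j)" "min i j < max i j"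
      by (auto simp: min_def max_def)
    thus thesis
      using that less_imp_Suc_add by (metis add_Suc_right)
  qed
  obtain n where n: "a 0 = comb n \<otimes> a i [^] ((3::int) ^ i)"
    using step[of 0 i] by auto
  obtain n' where n': "a i = comb n' \<otimes> a i [^] ((3::int) ^ Suc k)"
    using step[of i "Suc k"] ik by auto
  \<comment> \<open>Written additively, periodicity makes \<open>a i\<close> a combination plus
    3^(Suc k) times \<open>a i\<close>, so \<open>m\<close> times \<open>a i\<close> is a
    combination.\<close>
  define m where "m = 1 - (3::int) ^ Suc k"
  have m: "a i [^] m = comb n'"
  proof -
    have "a i [^] m = a i \<otimes> inv (a i [^] ((3::int) ^ Suc k))"
      using aG[of i] unfolding m_def by (subst int_pow_diff) simp_all
    also have "\<dots> = comb n'"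
      using n' aG[of i] inv_solve_right'[of "comb n'" "a i" "a i [^] ((3::int) ^ Suc k)"] by simp
    finally show ?thesis .
  qed
  have "x [^] m = (comb n \<otimes> a i [^] ((3::int) ^ i)) [^] m"
    using n by (simp add: a_def)
  also have "\<dots> = comb n [^] m \<otimes> (a i [^] m) [^] ((3::int) ^ i)"
    using aG[of i] by (simp add: int_pow_distrib int_pow_pow mult.commute)
  also have "\<dots> = comb (\<lambda>z. m * n z + 3 ^ i * n' z)"
    unfolding m by (simp only: comb_add comb_scale)
  finally have "x [^] m = comb (\<lambda>z. m * n z + 3 ^ i * n' z)" .
  moreover have "[m = 1] (mod 3)"
    by (simp add: m_def cong_iff_dvd_diff)
  ultimately show ?thesis
    by blast
qed

theorem int_rank_eq:
  assumes desc: "\<And>x. x \<in> carrier G \<Longrightarrow> \<exists>S. x \<in> S \<and> descends S"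
  shows "int_rank G = enat (card Z - 1)"
proof -
  have multiple: "\<exists>m n. [m = 1] (mod 3) \<and> x [^] (m::int) = comb n" if "x \<in> carrier G" for x
    using desc[OF that] descends_multiple by blast
  obtain m N where m: "[m = 1] (mod 3)" "T [^] (m::int) = comb N"
    using multiple[OF T_closed] by blast
  \<comment> \<open>As 3 T = 0, three times the combination \<open>N\<close> is a relation. It is
    nontrivial at \<open>z0\<close> because N z0 is congruent to m times v z0 T, that is, to
    2.\<close>
  define R where "R = (\<lambda>z. 3 * N z)"
  have "comb R = (T [^] m) [^] (3::int)"
    by (simp add: R_def comb_scale m)
  also have "\<dots> = (T [^] (3::int)) [^] m"
    using T_closed by (simp add: int_pow_pow mult.commute)
  finally have R: "comb R = \<one>"
    by (simp add: T_cube)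
  have R0: "R z0 \<noteq> 0"
  proof
    assume "R z0 = 0"
    hence "[0 = v z0 (T [^] m)] (mod 3)"
      using v_comb[OF z0, of N] m by (simp add: R_def cong_sym)
    also have "[v z0 (T [^] m) = m * v z0 T] (mod 3)"
      using z0 T_closed by (intro v_int_pow)
    also have "[m * v z0 T = 1 * 2] (mod 3)"
      using m v_T[OF z0] by (intro cong_mult)
    finally show False
      by (simp add: cong_def)
  qed
  \<comment> \<open>Scaling by R z0 and subtracting n z0 times the relation eliminates the generator
    \<open>P z0\<close>.\<close>
  have multiple': "\<exists>M n. M \<noteq> 0 \<and> n z0 = 0 \<and> x [^] (M::int) = comb n" if x: "x \<in> carrier G" for x
  proof -
    obtain k n where k: "[k = 1] (mod 3)" "x [^] (k::int) = comb n"
      using multiple[OF x] by blast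
    have "k \<noteq> 0"
      using k by (auto simp: cong_def)
    moreover have "x [^] (R z0 * k) = comb (\<lambda>z. R z0 * n z + (- n z0) * R z)"
    proof -
      have "comb (\<lambda>z. R z0 * n z + (- n z0) * R z) = comb n [^] R z0 \<otimes> comb R [^] (- n z0)"
        by (simp only: comb_add comb_scale)
      also have "\<dots> = (x [^] k) [^] R z0"
        using x by (simp add: R k)
      also have "\<dots> = x [^] (R z0 * k)"
        using x by (simp add: int_pow_pow mult.commute)
      finally show ?thesis ..
    qed
    ultimately show ?thesis
      using R0 by (intro exI[of _ "R z0 * k"] exI[of _ "\<lambda>z. R z0 * n z + (- n z0) * R z"]) auto
  qed
  have upper: "card S \<le> card Z - 1" if S: "int_independent G S" for S
  proof (rule ccontr)
    assume "\<not> card S \<le> card Z - 1"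
    hence card: "card (Z - {z0}) < card S"
      using fin z0 by simp
    have SG: "S \<subseteq> carrier G" "finite S"
      using S by (auto simp: int_independent_def)
    have "\<forall>x\<in>S. \<exists>M n. M \<noteq> 0 \<and> n z0 = 0 \<and> x [^] (M::int) = comb n"
      using multiple' SG by blast
    then obtain M n where Mn: "\<And>x. x \<in> S \<Longrightarrow> M x \<noteq> 0 \<and> n x z0 = 0 \<and> x [^] (M x :: int) = comb (n x)"
      by metis
    obtain c where c: "\<exists>x\<in>S. c x \<noteq> 0" "\<forall>z\<in>Z - {z0}. (\<Sum>x\<in>S. c x * n x z) = 0"
      using int_linear_relation[of "Z - {z0}" S n] card fin SG by auto
    have "(\<Otimes>x\<in>S. x [^] (c x * M x)) = (\<Otimes>x\<in>S. comb (\<lambda>z. c x * n x z))"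
    proof (intro finprod_cong')
      fix x assume "x \<in> S"
      thus "x [^] (c x * M x) = comb (\<lambda>z. c x * n x z)"
        using Mn SG by (metis comb_scale int_pow_pow mult.commute subsetD)
    qed auto
    also have "\<dots> = comb (\<lambda>z. \<Sum>x\<in>S. c x * n x z)"
      using SG by (simp add: comb_sum)
    also have "\<dots> = comb (\<lambda>_. 0)"
    proof -
      have "(\<Sum>x\<in>S. c x * n x z) = 0" if "z \<in> Z" for z
        using c(2) Mn that by (cases "z = z0") auto
      thus ?thesis
        unfolding comb_def using P_closed by (intro finprod_cong') auto
    qed
    finally have "\<forall>x\<in>S. c x * M x = 0"
      using S unfolding int_independent_def comb_zero by (elim conjE allE[where x = "\<lambda>x. c x * M x"]) simp
    thus False
      using c(1) Mn by auto
  qed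
  show ?thesis
  proof (rule antisym)
    show "int_rank G \<le> enat (card Z - 1)"
      unfolding int_rank_def using upper by (intro SUP_least) auto
    have "card (P ` (Z - {z0})) = card Z - 1"
      using inj_P fin z0 by (subst card_image) (auto intro: inj_on_subset)
    thus "enat (card Z - 1) \<le> int_rank G"
      unfolding int_rank_def
      using independent_P SUP_upper[of "P ` (Z - {z0})" "{S. int_independent G S}" "\<lambda>S. enat (card S)"]
      by simp
  qed
qed

end

section \<open>Rational functions over an algebraically closed field\<close>

instance bit :: char_two
  by standard simp

instance alg_closure :: ("{field,char_two}") char_two
proof
  have "(1 + 1 :: 'a alg_closure) = to_ac (1 + 1)"
    by (simp only: to_ac_add to_ac_1)
  thus "(1 + 1 :: 'a alg_closure) = 0"
    by (simp only: one_plus_one to_ac_0)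
qed

instance poly :: (char_two) char_two
  by standard (simp add: one_pCons)

instance fract :: ("{idom,char_two}") char_two
  by standard (simp add: One_fract_def Zero_fract_def)

instance alg_closure :: (field) field_gcd ..

lemma to_fract_eq_Fract: "to_fract p = Fract p 1"
  by (simp add: to_fract_def)

lemma to_fract_power: "to_fract (p ^ n) = to_fract p ^ n"
  by (induction n) auto

section \<open>Valuations and cubes of rational functions\<close>

definition val :: "'k::field_gcd \<Rightarrow> 'k poly fract \<Rightarrow> int" where
  "val c x = int (order c (fst (quot_of_fract x))) - int (order c (snd (quot_of_fract x)))"

lemma fract_cases_field:
  fixes x :: "'k::idom fract"
  obtains p r where "x = Fract p r" "r \<noteq> 0"
  by (cases x) auto

lemma val_Fract:
  assumes "p \<noteq> 0" "r \<noteq> 0"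
  shows "val c (Fract p r) = int (order c p) - int (order c r)"
proof -
  define n d where nd: "n = fst (quot_of_fract (Fract p r))" "d = snd (quot_of_fract (Fract p r))"
  have "Fract n d = Fract p r" and d: "d \<noteq> 0"
    by (simp_all add: nd)
  hence e: "n * r = p * d"
    using assms by (simp add: eq_fract)
  hence "n \<noteq> 0"
    using assms d by auto
  hence "order c n + order c r = order c p + order c d"
    using arg_cong[OF e, of "order c"] assms d by (simp add: order_mult)
  thus ?thesis
    by (simp add: val_def flip: nd)
qed

lemma val_to_fract: "p \<noteq> 0 \<Longrightarrow> val c (to_fract p) = int (order c p)"
  by (simp add: to_fract_eq_Fract val_Fract)

lemma val_mult:
  assumes "x \<noteq> 0" "y \<noteq> 0"
  shows "val c (x * y) = val c x + val c y"
proof -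
  obtain p r p' r' where xy: "x = Fract p r" "r \<noteq> 0" "y = Fract p' r'" "r' \<noteq> 0"
    by (metis fract_cases_field)
  hence "p \<noteq> 0" "p' \<noteq> 0"
    using assms by (auto simp: fract_collapse)
  thus ?thesis
    using xy by (simp add: val_Fract order_mult)
qed

lemma val_power:
  assumes "x \<noteq> 0"
  shows "val c (x ^ n) = int n * val c x"
proof (induction n)
  case 0
  show ?case
    using val_to_fract[of 1 c] by simp
next
  case (Suc n)
  thus ?case
    using assms by (simp add: val_mult algebra_simps)
qed

lemma val_add:
  assumes "x \<noteq> 0" "y \<noteq> 0" "x + y \<noteq> 0"
  shows "min (val c x) (val c y) \<le> val c (x + y)"
proof -
  obtain p0 r0 p1 r1 where xy: "x = Fract p0 r0" "r0 \<noteq> 0" "y = Fract p1 r1" "r1 \<noteq> 0"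
    by (metis fract_cases_field)
  define p p' r where r: "p = p0 * r1" "p' = p1 * r0" "r = r0 * r1"
  have xy': "x = Fract p r" "y = Fract p' r" "x + y = Fract (p + p') r" "r \<noteq> 0"
    using xy by (simp_all add: r eq_fract algebra_simps)
  hence nz: "p \<noteq> 0" "p' \<noteq> 0" "p + p' \<noteq> 0"
    using assms by (auto simp: fract_collapse)
  have "[:-c, 1:] ^ min (order c p) (order c p') dvd p + p'"
    by (intro dvd_add) (simp_all add: order_divides)
  hence "min (order c p) (order c p') \<le> order c (p + p')"
    using nz by (simp add: order_divides)
  thus ?thesis
    using nz xy'(4) unfolding xy'(3) unfolding xy'(1,2) by (simp add: val_Fract)
qed

lemma val_sum3:
  assumes "x \<noteq> 0" "y \<noteq> 0" "z \<noteq> 0" "x + y + z \<noteq> 0"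
  shows "min (val c x) (min (val c y) (val c z)) \<le> val c (x + y + z)"
proof (cases "x + y = 0")
  case False
  thus ?thesis
    using val_add[of x y c] val_add[of "x + y" z c] assms by simp
qed simp

text \<open>At a place where the coefficient \<open>B\<close> is a unit the descent map is unramified: among the
  valuations of the four terms of \<open>y + y' + x + B = 0\<close>, where \<open>y y' = x\<^sup>3\<close>, the minimum occurs twice.\<close>

lemma val_triangular:
  fixes x y B :: "'k::{field_gcd,char_two} poly fract"
  assumes e: "y * (y + x + B) = x^3" and y: "y \<noteq> 0" and B: "B \<noteq> 0" "val c B = 0"
  shows "3 dvd val c y"
proof (cases "x = 0")
  case True
  hence "y = B"
    using e y by (simp add: add_eq_0_iff_char_two)
  thus ?thesis
    using B by simp
next
  case False
  define y' where y': "y' = y + x + B"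
  have nz: "y' \<noteq> 0"
    using e False by (auto simp: y')
  have "val c y + val c y' = 3 * val c x"
    using val_mult[OF y nz, of c] val_power[OF False, of c 3] e by (simp add: y')
  moreover have "min (val c y) (min (val c x) (val c B)) \<le> val c y'"
    unfolding y' using nz y False B by (intro val_sum3) (auto simp: y')
  moreover have "min (val c y') (min (val c x) (val c B)) \<le> val c y"
    using val_sum3[of y' x B c] nz y False B by (simp add: y' ac_simps)
  moreover have "min (val c y') (min (val c y) (val c B)) \<le> val c x"
    using val_sum3[of y' y B c] nz y False B by (simp add: y' ac_simps)
  moreover have "min (val c y') (min (val c y) (val c x)) \<le> val c B"
    using val_sum3[of y' y x c] nz y False B by (simp add: y' ac_simps)
  ultimately have "val c y = val c y' \<or> val c y = 0 \<or> val c y' = 0"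
    unfolding B(2) by linarith
  moreover note \<open>val c y + val c y' = 3 * val c x\<close>
  ultimately show ?thesis
    by presburger
qed

text \<open>Constants have cube roots and nonconstant polynomials have roots, so cubes of linear
  factors can be split off one at a time.\<close>

lemma poly_cube_root:
  fixes p :: "'k::alg_closed_field poly"
  assumes "p \<noteq> 0" "\<And>c. 3 dvd order c p"
  shows "\<exists>r. p = r^3"
  using assms
proof (induction "degree p" arbitrary: p rule: less_induct)
  case less
  show ?case
  proof (cases "degree p = 0")
    case True
    then obtain a where p: "p = [:a:]"
      by (metis degree_eq_zeroE)
    obtain b where "b^3 = a"
      using nth_root_exists[of 3 a] by auto
    thus ?thesis
      by (intro exI[of _ "[:b:]"]) (simp add: p power3_eq_cube mult.assoc)
  next
    case False
    then obtain c where "poly p c = 0"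
      using alg_closed_imp_poly_has_root by blast
    hence "order c p \<noteq> 0"
      using order_root less.prems by metis
    hence "3 \<le> order c p"
      using less.prems(2)[of c] by (auto elim: dvdE)
    then obtain s where s: "p = [:-c, 1:]^3 * s"
      using less.prems(1) order_divides[of c 3 p] by (auto elim: dvdE)
    hence s0: "s \<noteq> 0"
      using less.prems by auto
    have "3 dvd order a s" for a
    proof -
      have "order a p = order a ([:-c, 1:]^3) + order a s"
        unfolding s using less.prems s by (intro order_mult) auto
      also have "order a ([:-c, 1:]^3) = (if a = c then 3 else 0)"
        using order_power_n_n[of c 3] by (auto intro!: order_0I)
      finally show ?thesis
        using less.prems(2)[of a] by (auto split: if_splits)
    qed
    moreover have "degree s < degree p"
      using s0 unfolding s by (subst degree_mult_eq) (auto simp: degree_power_eq)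
    ultimately obtain r where "s = r^3"
      using less.hyps s0 by blast
    thus ?thesis
      by (intro exI[of _ "[:-c, 1:] * r"]) (simp add: s power_mult_distrib del: mult_pCons_left)
  qed
qed

text \<open>Over algebraically closed constants neither the class group nor the units modulo cubes
  obstruct, so the valuations at the finite places decide.\<close>

lemma fract_cube_root:
  fixes x :: "'k::{alg_closed_field,field_gcd} poly fract"
  assumes x: "x \<noteq> 0" and dvd: "\<And>c. 3 dvd val c x"
  shows "\<exists>z. x = z^3"
proof -
  define n d where nd: "n = fst (quot_of_fract x)" "d = snd (quot_of_fract x)"
  have xnd: "x = Fract n d" and d: "d \<noteq> 0" and n: "n \<noteq> 0"
    using x by (simp_all add: nd)
  \<comment> \<open>In lowest terms nothing cancels between numerator and denominator, so each of
    them has all orders divisible by 3.\<close>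
  have "order c n = 0 \<or> order c d = 0" for c
  proof (rule ccontr)
    assume "\<not> ?thesis"
    hence "[:-c, 1:] dvd n" "[:-c, 1:] dvd d"
      using order_divides[of c 1 n] order_divides[of c 1 d] by auto
    moreover have "coprime n d"
      unfolding nd by (rule coprime_quot_of_fract)
    ultimately have "[:-c, 1:] dvd 1"
      using coprime_common_divisor by blast
    thus False
      by (simp add: is_unit_iff_degree)
  qed
  hence "3 dvd order c n \<and> 3 dvd order c d" for c
    using dvd[of c] unfolding xnd val_Fract[OF n d] by (metis diff_0 diff_zero dvd_0_right dvd_minus_iff int_dvd_int_iff of_nat_0 of_nat_numeral)
  then obtain a b where "n = a^3" "d = b^3"
    using poly_cube_root n d by metis
  hence "x = (Fract a b)^3"
    by (simp add: xnd power3_eq_cube)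
  thus ?thesis
    by blast
qed

subsection \<open>Automorphisms of the coefficients\<close>

text \<open>To be used for the q^2-power Frobenius. Its extension \<open>\<sigma>\<close> fixes the
  variable, and rationality over F(t) becomes invariance under \<open>\<sigma>\<close>.\<close>

locale coeff_hom =
  fixes f :: "'k::field_gcd \<Rightarrow> 'k"
  assumes f_add: "f (a + b) = f a + f b" and f_mult: "f (a * b) = f a * f b" and f_one: "f 1 = 1"
begin

lemma f_zero [simp]: "f 0 = 0"
  using f_add[of 0 0] by (simp only: add_0_right add_cancel_right_right)

lemma f_eq_0_iff [simp]: "f a = 0 \<longleftrightarrow> a = 0"
  by (metis f_mult f_one f_zero mult_zero_left right_inverse zero_neq_one)

lemma f_uminus: "f (- a) = - f a"
  using f_add[of a "- a"] by (simp add: eq_neg_iff_add_eq_0 add.commute)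

lemma f_sum: "f (\<Sum>i\<in>A. g i) = (\<Sum>i\<in>A. f (g i))"
  by (induction A rule: infinite_finite_induct) (simp_all add: f_add)

abbreviation mp :: "'k poly \<Rightarrow> 'k poly" where
  "mp \<equiv> map_poly f"

lemma mp_add: "mp (p + r) = mp p + mp r"
  by (rule poly_eqI) (simp add: coeff_map_poly f_add)

lemma mp_mult: "mp (p * r) = mp p * mp r"
  by (rule poly_eqI) (simp add: coeff_map_poly coeff_mult f_sum f_mult)

lemma mp_one [simp]: "mp 1 = 1"
  by (simp add: f_one)

lemma mp_power: "mp (p ^ n) = mp p ^ n"
  by (induction n) (simp_all add: mp_mult)

lemma mp_eq_0_iff [simp]: "mp p = 0 \<longleftrightarrow> p = 0"
  by (rule map_poly_eq_0_iff) simp_all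

lemma degree_mp [simp]: "degree (mp p) = degree p"
  by (cases "p = 0") (auto intro: map_poly_degree_eq)

lemma poly_mp: "poly (mp p) (f c) = f (poly p c)"
  by (induction p) (simp_all add: map_poly_pCons f_add f_mult)

lemma order_mp:
  assumes "p \<noteq> 0"
  shows "order (f c) (mp p) = order c p"
proof -
  obtain r where r: "p = [:-c, 1:] ^ order c p * r" "\<not> [:-c, 1:] dvd r"
    using order_decomp[OF assms] by blast
  have "mp p = [:- f c, 1:] ^ order c p * mp r"
    by (subst r(1)) (simp add: mp_mult mp_power map_poly_pCons f_one f_uminus del: mult_pCons_left)
  moreover have "poly (mp r) (f c) \<noteq> 0"
    using r(2) by (simp add: poly_mp poly_eq_0_iff_dvd)
  hence "order (f c) (mp r) = 0"
    by (rule order_0I)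
  moreover have "mp p \<noteq> 0"
    using assms by simp
  ultimately show ?thesis
    by (metis add.right_neutral order_mult order_power_n_n)
qed

definition \<sigma> :: "'k poly fract \<Rightarrow> 'k poly fract" where
  "\<sigma> x = Fract (mp (fst (quot_of_fract x))) (mp (snd (quot_of_fract x)))"

lemma sigma_Fract:
  assumes "r \<noteq> 0"
  shows "\<sigma> (Fract p r) = Fract (mp p) (mp r)"
proof -
  define n d where nd: "n = fst (quot_of_fract (Fract p r))" "d = snd (quot_of_fract (Fract p r))"
  have "Fract n d = Fract p r" and d: "d \<noteq> 0"
    by (simp_all add: nd)
  hence "mp (n * r) = mp (p * d)"
    using assms by (simp add: eq_fract)
  thus ?thesis
    using assms d unfolding \<sigma>_def nd[symmetric] by (simp add: eq_fract mp_mult)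
qed

lemma sigma_add: "\<sigma> (x + y) = \<sigma> x + \<sigma> y"
proof -
  obtain p r p' r' where "x = Fract p r" "r \<noteq> 0" "y = Fract p' r'" "r' \<noteq> 0"
    by (metis fract_cases_field)
  thus ?thesis
    by (simp add: sigma_Fract mp_add mp_mult)
qed

lemma sigma_mult: "\<sigma> (x * y) = \<sigma> x * \<sigma> y"
proof -
  obtain p r p' r' where "x = Fract p r" "r \<noteq> 0" "y = Fract p' r'" "r' \<noteq> 0"
    by (metis fract_cases_field)
  thus ?thesis
    by (simp add: sigma_Fract mp_mult)
qed

lemma sigma_to_fract: "\<sigma> (to_fract p) = to_fract (mp p)"
  by (simp add: to_fract_eq_Fract sigma_Fract)

lemma sigma_zero [simp]: "\<sigma> 0 = 0"
  using sigma_to_fract[of 0] by simp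

lemma sigma_one [simp]: "\<sigma> 1 = 1"
  using sigma_to_fract[of 1] by simp

lemma sigma_eq_0_iff [simp]: "\<sigma> x = 0 \<longleftrightarrow> x = 0"
  by (metis sigma_mult sigma_one sigma_zero mult_zero_left right_inverse zero_neq_one)

lemma sigma_inverse: "\<sigma> (inverse x) = inverse (\<sigma> x)"
proof (cases "x = 0")
  case False
  hence "\<sigma> x * \<sigma> (inverse x) = 1"
    by (simp flip: sigma_mult)
  thus ?thesis
    using inverse_unique by metis
qed simp

lemma sigma_divide: "\<sigma> (x / y) = \<sigma> x / \<sigma> y"
  by (simp add: divide_inverse sigma_mult sigma_inverse)

lemma sigma_uminus: "\<sigma> (- x) = - \<sigma> x"
  using sigma_add[of x "- x"] by (simp add: eq_neg_iff_add_eq_0 add.commute)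

lemma sigma_inj: "\<sigma> x = \<sigma> y \<longleftrightarrow> x = y"
  using sigma_eq_0_iff[of "x - y"] sigma_add[of x "- y"] by (metis diff_conv_add_uminus eq_iff_diff_eq_0 sigma_uminus)

lemma val_sigma:
  assumes "x \<noteq> 0"
  shows "val (f c) (\<sigma> x) = val c x"
proof -
  obtain p r where x: "x = Fract p r" "r \<noteq> 0"
    by (metis fract_cases_field)
  hence "p \<noteq> 0"
    using assms by (auto simp: fract_collapse)
  thus ?thesis
    using x by (simp add: sigma_Fract val_Fract order_mp)
qed

text \<open>A reduced representation is unique up to a constant, and since the denominator is monic
  and keeps its degree, that constant is 1.\<close>

lemma sigma_fixed:
  assumes "\<sigma> x = x"
  shows "mp (fst (quot_of_fract x)) = fst (quot_of_fract x)" "mp (snd (quot_of_fract x)) = snd (quot_of_fract x)"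
proof -
  define n d where nd: "n = fst (quot_of_fract x)" "d = snd (quot_of_fract x)"
  have d: "d \<noteq> 0" and x: "x = Fract n d" and cop: "coprime n d"
    using coprime_quot_of_fract[of x] by (simp_all add: nd)
  have "unit_factor (lead_coeff d) = 1"
    using unit_factor_snd_quot_of_fract[of x] by (simp add: nd unit_factor_poly_def one_pCons)
  hence lc: "lead_coeff d = 1"
    using is_unit_unit_factor[of "lead_coeff d"] d by (simp add: dvd_field_iff)
  have e: "mp n * d = n * mp d"
    using assms d by (simp add: x sigma_Fract eq_fract)
  hence "d dvd n * mp d"
    by (metis dvd_triv_right)
  hence "d dvd mp d"
    using cop by (simp add: coprime_commute coprime_dvd_mult_right_iff)
  then obtain c where c: "mp d = d * c"
    by (elim dvdE)
  have "degree (mp d) = degree d + degree c"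
    unfolding c using d c by (intro degree_mult_eq) auto
  then obtain a where a: "c = [:a:]"
    by (metis add_cancel_right_right degree_eq_zeroE degree_mp)
  have "lead_coeff (mp d) = 1"
    by (simp add: coeff_map_poly lc f_one)
  hence "a = 1"
    unfolding c a lead_coeff_mult lc by simp
  hence md: "mp d = d"
    by (simp add: c a one_pCons[symmetric])
  moreover have "mp n = n"
    using e d by (simp add: md)
  ultimately show "mp (fst (quot_of_fract x)) = fst (quot_of_fract x)" "mp (snd (quot_of_fract x)) = snd (quot_of_fract x)"
    by (simp_all add: nd)
qed

lemma mp_fixed_iff: "mp p = p \<longleftrightarrow> (\<forall>i. coeff p i \<in> {c. f c = c})"
  by (simp add: poly_eq_iff coeff_map_poly)

lemma rational_functions_fixed: "rational_functions {c. f c = c} = {x. \<sigma> x = x}"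
proof (intro subset_antisym subsetI)
  fix x assume "x \<in> rational_functions {c. f c = c}"
  then obtain p r where "x = Fract p r" "mp p = p" "mp r = r" "r \<noteq> 0"
    unfolding rational_functions_def mp_fixed_iff by blast
  thus "x \<in> {x. \<sigma> x = x}"
    by (simp add: sigma_Fract)
next
  fix x assume "x \<in> {x. \<sigma> x = x}"
  hence "mp (fst (quot_of_fract x)) = fst (quot_of_fract x)" "mp (snd (quot_of_fract x)) = snd (quot_of_fract x)"
    using sigma_fixed by simp_all
  thus "x \<in> rational_functions {c. f c = c}"
    unfolding rational_functions_def mp_fixed_iff
    by (intro CollectI exI[of _ "fst (quot_of_fract x)"] exI[of _ "snd (quot_of_fract x)"]) simp
qed

lemma subfield_set_rational_functions: "subfield_set (rational_functions {c. f c = c})"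
  unfolding rational_functions_fixed subfield_set_def
  by (simp add: sigma_add sigma_mult sigma_divide)

end

subsection \<open>Heights\<close>

text \<open>A bound for the naive height of (x : y : 1). Unreduced representations are allowed, so
  that a formula with a common denominator yields a bound at once.\<close>

definition height_le :: "nat \<Rightarrow> 'k::field_gcd poly fract \<Rightarrow> 'k poly fract \<Rightarrow> bool" where
  "height_le n x y \<longleftrightarrow> (\<exists>U V W. W \<noteq> 0 \<and> degree U \<le> n \<and> degree V \<le> n \<and> degree W \<le> n \<and>
     x = Fract U W \<and> y = Fract V W)"

lemma height_le_mono: "height_le n x y \<Longrightarrow> n \<le> m \<Longrightarrow> height_le m x y"
  unfolding height_le_def using order_trans by blast

lemma common_denominator:
  fixes x y :: "'k::idom fract"
  obtains U V W where "W \<noteq> 0" "x = Fract U W" "y = Fract V W"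
proof -
  obtain p r p' r' where "x = Fract p r" "r \<noteq> 0" "y = Fract p' r'" "r' \<noteq> 0"
    by (metis fract_cases_field)
  thus ?thesis
    using that[of "r * r'" "p * r'" "p' * r"] by (simp add: eq_fract)
qed

lemma height_le_exists: "\<exists>n. height_le n x y"
proof -
  obtain U V W where "W \<noteq> 0" "x = Fract U W" "y = Fract V W"
    by (rule common_denominator)
  thus ?thesis
    unfolding height_le_def
    by (intro exI[of _ "degree U + degree V + degree W"] exI[of _ U] exI[of _ V] exI[of _ W]) simp
qed

lemma to_fract_mult_Fract: "to_fract a * Fract U W = Fract (a * U) W"
  by (simp add: to_fract_eq_Fract)

lemma to_fract_scale: "W \<noteq> 0 \<Longrightarrow> to_fract a = Fract (a * W) W"
  by (simp add: to_fract_eq_Fract eq_fract)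

lemma Fract_add_same: "W \<noteq> 0 \<Longrightarrow> Fract U W + Fract V W = Fract (U + V) W"
  by (simp add: eq_fract algebra_simps)

text \<open>Controls the bounded loss in the linear changes of coordinates before, between and after
  the two cube root extractions.\<close>

lemma height_le_linear:
  fixes x y X0 X1 X2 :: "'k::field_gcd poly fract"
  assumes h: "height_le n x y" and X2: "X2 \<noteq> 0"
    and X: "X0 = to_fract a0 + to_fract b0 * x + to_fract c0 * y"
      "X1 = to_fract a1 + to_fract b1 * x + to_fract c1 * y"
      "X2 = to_fract a2 + to_fract b2 * x + to_fract c2 * y"
    and deg: "degree a0 \<le> k" "degree b0 \<le> k" "degree c0 \<le> k" "degree a1 \<le> k" "degree b1 \<le> k"
      "degree c1 \<le> k" "degree a2 \<le> k" "degree b2 \<le> k" "degree c2 \<le> k"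
  shows "height_le (n + k) (X0 / X2) (X1 / X2)"
proof -
  obtain U V W where W: "W \<noteq> 0" and d: "degree U \<le> n" "degree V \<le> n" "degree W \<le> n"
    and xy: "x = Fract U W" "y = Fract V W"
    using h unfolding height_le_def by blast
  have lin: "to_fract a + to_fract b * x + to_fract c * y = Fract (a * W + b * U + c * V) W" for a b c
    by (simp only: xy to_fract_mult_Fract to_fract_scale[OF W, of a] Fract_add_same[OF W])
  have dl: "degree (a * W + b * U + c * V) \<le> n + k" if "degree a \<le> k" "degree b \<le> k" "degree c \<le> k" for a b c
    using that d
    by (intro degree_add_le) (metis add.commute add_mono degree_mult_le order_trans)+
  have nz: "a2 * W + b2 * U + c2 * V \<noteq> 0"
    using X2 unfolding X(3) lin by (auto simp: fract_collapse)
  have div: "Fract p W / Fract r W = Fract p r" if "r \<noteq> 0" for p r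
    using that W by (simp add: eq_fract)
  show ?thesis
    unfolding height_le_def X lin div[OF nz]
    by (intro exI[of _ "a0 * W + b0 * U + c0 * V"] exI[of _ "a1 * W + b1 * U + c1 * V"]
        exI[of _ "a2 * W + b2 * U + c2 * V"] conjI nz dl deg refl)
qed

text \<open>Once common factors of a, c and e are removed, their cubes have no common factor either,
  so every representation of (z^3 : w^3 : 1) is a polynomial multiple of (a^3 : c^3 : e^3). This is
  the source of the factor 3 gained with each isogeny.\<close>

lemma height_le_cube:
  fixes z w :: "'k::field_gcd poly fract"
  assumes "height_le n (z^3) (w^3)"
  shows "height_le (n div 3) z w"
proof -
  obtain U V W where W: "W \<noteq> 0" and d: "degree U \<le> n" "degree V \<le> n" "degree W \<le> n"
    and zw: "z^3 = Fract U W" "w^3 = Fract V W"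
    using assms unfolding height_le_def by blast
  obtain a0 c0 e0 where e0: "e0 \<noteq> 0" "z = Fract a0 e0" "w = Fract c0 e0"
    by (rule common_denominator)
  define g where "g = gcd a0 (gcd c0 e0)"
  have g: "g \<noteq> 0"
    using e0 by (simp add: g_def)
  define a c e where ace: "a = a0 div g" "c = c0 div g" "e = e0 div g"
  have "g dvd a0" "g dvd c0" "g dvd e0"
    by (simp_all add: g_def) (metis dvd_trans gcd_dvd1 gcd_dvd2)+
  hence ace': "a0 = g * a" "c0 = g * c" "e0 = g * e"
    by (simp_all add: ace)
  have e: "e \<noteq> 0"
    using e0 ace' by auto
  have z: "z = Fract a e" "w = Fract c e"
    using e0 e g by (simp_all add: ace' eq_fract)
  have "g * gcd a (gcd c e) dvd gcd a0 (gcd c0 e0)"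
    unfolding ace' by (intro gcd_greatest mult_dvd_mono) (auto intro: dvd_trans[OF gcd_dvd2])
  hence "gcd a (gcd c e) dvd 1"
    using g dvd_times_left_cancel_iff[of g "gcd a (gcd c e)" 1] by (simp flip: g_def)
  hence "coprime a (gcd c e)"
    by (simp only: is_unit_gcd_iff coprime_iff_gcd_eq_1)
  hence "coprime (a^3) (gcd (c^3) (e^3))"
    by (simp add: gcd_exp)
  moreover have e1: "a^3 * W = U * e^3" "c^3 * W = V * e^3"
    using zw W e by (simp_all add: z power3_eq_cube eq_fract)
  have gcd_dvd: "e^3 dvd gcd p r * W" if "e^3 dvd p * W" "e^3 dvd r * W" for p r
  proof -
    have "e^3 dvd gcd (W * p) (W * r)"
      using that by (simp add: mult.commute[of W])
    thus ?thesis
      unfolding gcd_mult_left by (simp add: mult.commute)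
  qed
  have "e^3 dvd gcd (a^3) (gcd (c^3) (e^3)) * W"
    using e1 by (intro gcd_dvd) simp_all
  ultimately have "e^3 dvd W"
    by (simp only: coprime_iff_gcd_eq_1 mult_1)
  then obtain k where k: "W = e^3 * k"
    by (elim dvdE)
  have UV: "U = a^3 * k" "V = c^3 * k"
    using e1 e unfolding k by (simp_all add: algebra_simps)
  have deg: "degree p \<le> n div 3" if "degree (p^3 * k) \<le> n" for p
  proof (cases "p = 0")
    case False
    have "k \<noteq> 0"
      using W k by auto
    hence "degree (p^3 * k) = 3 * degree p + degree k"
      using False by (simp add: degree_mult_eq degree_power_eq)
    thus ?thesis
      using that by linarith
  qed simp
  show ?thesis
    unfolding height_le_def using e z deg d unfolding UV k by blast
qed

lemma finite_polys_over:
  assumes "finite F"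
  shows "finite {p :: 'k::zero poly. degree p \<le> n \<and> (\<forall>i. coeff p i \<in> F)}" (is "finite ?S")
proof -
  have "inj_on (\<lambda>p. map (coeff p) [0..<Suc n]) ?S"
  proof (rule inj_onI)
    fix p r assume pr: "p \<in> ?S" "r \<in> ?S" "map (coeff p) [0..<Suc n] = map (coeff r) [0..<Suc n]"
    show "p = r"
    proof (rule poly_eqI)
      fix i show "coeff p i = coeff r i"
      proof (cases "i \<le> n")
        case True
        hence "i \<in> set [0..<Suc n]"
          by auto
        thus ?thesis
          using pr(3) by (metis map_eq_conv)
      next
        case False
        thus ?thesis
          using pr by (simp add: coeff_eq_0)
      qed
    qed
  qed
  moreover have "(\<lambda>p. map (coeff p) [0..<Suc n]) ` ?S \<subseteq> {xs. set xs \<subseteq> F \<and> length xs = Suc n}"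
    by auto
  ultimately show ?thesis
    by (rule finite_imageD[OF finite_subset[OF _ finite_lists_length_eq[OF assms]], rotated])
qed

lemma (in coeff_hom) finite_height:
  assumes "finite {c. f c = c}"
  shows "finite {(x, y). height_le n x y \<and> \<sigma> x = x \<and> \<sigma> y = y}"
proof -
  define S where "S = {p :: 'k poly. degree p \<le> n \<and> (\<forall>i. coeff p i \<in> {c. f c = c})}"
  have S: "finite S"
    unfolding S_def by (rule finite_polys_over[OF assms])
  \<comment> \<open>The given \<open>U\<close> and \<open>W\<close> may have coefficients outside
    the fixed field. The reduced fraction has fixed coefficients by \<open>sigma_fixed\<close>, and
    its degrees stay within the bound.\<close>
  have *: "x \<in> (\<lambda>(p, r). Fract p r) ` (S \<times> S)"
    if x: "x = Fract U W" "W \<noteq> 0" "degree U \<le> n" "degree W \<le> n" "\<sigma> x = x" for x U W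
  proof -
    define a d where nd: "a = fst (quot_of_fract x)" "d = snd (quot_of_fract x)"
    have d: "d \<noteq> 0" "x = Fract a d" "coprime a d"
      using coprime_quot_of_fract[of x] by (simp_all add: nd)
    have e: "a * W = U * d"
      using d x by (simp add: eq_fract)
    have "d dvd a * W"
      by (simp add: e)
    hence "d dvd W"
      using d(3) by (simp add: coprime_commute coprime_dvd_mult_right_iff)
    hence "degree d \<le> n"
      using dvd_imp_degree_le[OF _ x(2)] x(4) le_trans by blast
    moreover have "degree a \<le> n"
    proof (cases "U = 0")
      case True
      thus ?thesis
        using e x by simp
    next
      case False
      have "a dvd U * d"
        by (simp flip: e)
      hence "a dvd U"
        using d(3) by (simp add: coprime_dvd_mult_left_iff)
      thus ?thesis
        using dvd_imp_degree_le[OF _ False] x(3) le_trans by blast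
    qed
    moreover have "mp a = a" "mp d = d"
      using sigma_fixed[OF x(5)] by (simp_all add: nd)
    ultimately have "a \<in> S" "d \<in> S"
      unfolding S_def mp_fixed_iff by blast+
    thus ?thesis
      using d by auto
  qed
  have "{(x, y). height_le n x y \<and> \<sigma> x = x \<and> \<sigma> y = y}
      \<subseteq> (\<lambda>(p, r). Fract p r) ` (S \<times> S) \<times> (\<lambda>(p, r). Fract p r) ` (S \<times> S)"
    unfolding height_le_def by (auto simp del: mem_Sigma_iff intro!: SigmaI *)
  thus ?thesis
    by (rule finite_subset) (intro finite_SigmaI finite_imageI S)
qed

text \<open>The chord formula over a common denominator, with E / H and F / H for the differences of
  the coordinates, has degree 4 in quantities of degree at most n + m. The crude factor 4 is
  affordable because division by 3 gains 9.\<close>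

lemma height_le_translate:
  fixes x0 y0 :: "'k::{field_gcd,char_two} poly fract" and \<beta> :: "'k poly"
  shows "\<exists>C. \<forall>n x y l. height_le n x y \<longrightarrow> x \<noteq> x0 \<longrightarrow> l = (y + y0) / (x + x0) \<longrightarrow>
    height_le (4 * n + C) (l^2 + l + x + x0) ((l + 1) * (l^2 + l + x + x0) + (y + l * x) + to_fract \<beta>)"
proof -
  obtain a c g where g: "g \<noteq> 0" and xy0: "x0 = Fract a g" "y0 = Fract c g"
    by (rule common_denominator)
  define m where "m = degree a + degree c + degree g"
  show ?thesis
  proof (intro exI[of _ "4 * m + degree \<beta>"] allI impI)
    fix n x y l
    assume h: "height_le n x y" and neq: "x \<noteq> x0" and l: "l = (y + y0) / (x + x0)"
    obtain U V W where W: "W \<noteq> 0" and d: "degree U \<le> n" "degree V \<le> n" "degree W \<le> n"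
      and xy: "x = Fract U W" "y = Fract V W"
      using h unfolding height_le_def by blast
    define X' Y' E F H where def: "X' = U * g" "Y' = V * g" "E = U * g + a * W" "F = V * g + c * W" "H = W * g"
    have dm: "degree (p * r) \<le> i + j" if "degree p \<le> i" "degree r \<le> j" for p r :: "'k poly" and i j
      using degree_mult_le[of p r] that by linarith
    have d0: "degree a \<le> m" "degree c \<le> m" "degree g \<le> m"
      by (simp_all add: m_def)
    have dX: "degree X' \<le> n + m" "degree Y' \<le> n + m" "degree E \<le> n + m" "degree F \<le> n + m" "degree H \<le> n + m"
      unfolding def using dm d d0 by (auto intro!: degree_add_le simp: mult.commute[of _ W])
    have H: "H \<noteq> 0"
      using W g by (simp add: def)
    have xH: "x = Fract X' H" "y = Fract Y' H" "x + x0 = Fract E H" "y + y0 = Fract F H"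
      using W g by (simp_all add: xy xy0 def eq_fract algebra_simps)
    have "x + x0 \<noteq> 0"
      using neq by (simp add: add_eq_0_iff_char_two)
    hence E: "E \<noteq> 0"
      unfolding xH(3) by (auto simp: fract_collapse)
    define x3 where x3: "x3 = l^2 + l + x + x0"
    \<comment> \<open>x3 = N / (E^2 H); it is expanded by \<open>E\<close> in order to share the
      denominator \<open>Q\<close> with y3.\<close>
    define N where N: "N = F^2 * H + F * E * H + E^3"
    define Q where Q: "Q = E^3 * H"
    have Q0: "Q \<noteq> 0"
      using E H by (simp add: Q)
    define e' f' h' where t: "e' = to_fract E" "f' = to_fract F" "h' = to_fract H"
    have nz: "e' \<noteq> 0" "h' \<noteq> 0"
      using E H by (simp_all add: t)
    have FH: "Fract p r = to_fract p / to_fract r" for p r :: "'k poly"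
      by (simp add: Fract_conv_to_fract)
    have l': "l = f' / e'"
      using nz unfolding l xH(3,4) FH by (simp add: t)
    have "x3 = l^2 + l + (x + x0)"
      by (simp add: x3 add.assoc)
    also have "\<dots> = (e' * (f'^2 * h' + f' * e' * h' + e'^3)) / (e'^3 * h')"
      unfolding l' xH(3) FH t[symmetric] using nz by (simp add: field_simps power_numeral_reduce)
    also have "\<dots> = Fract (E * N) Q"
      unfolding FH by (simp add: t N Q to_fract_power)
    finally have X3: "x3 = Fract (E * N) Q" .
    have "(l + 1) * x3 + (y + l * x) + to_fract \<beta>
      = (f' / e' + 1) * ((e' * (f'^2 * h' + f' * e' * h' + e'^3)) / (e'^3 * h'))
        + (to_fract Y' / h' + f' / e' * (to_fract X' / h')) + to_fract \<beta>"
      unfolding X3 FH l' xH(1,2) by (simp add: t N Q to_fract_power)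
    also have "\<dots> = ((f' + e') * (f'^2 * h' + f' * e' * h' + e'^3)
        + e'^2 * (to_fract Y' * e' + f' * to_fract X') + to_fract \<beta> * e'^3 * h') / (e'^3 * h')"
      using nz by (simp add: divide_simps power_numeral_reduce)
    also have "\<dots> = Fract ((F + E) * N + E^2 * (Y' * E + F * X') + \<beta> * E^3 * H) Q"
      unfolding FH by (simp add: t N Q to_fract_power)
    finally have Y3: "(l + 1) * x3 + (y + l * x) + to_fract \<beta>
      = Fract ((F + E) * N + E^2 * (Y' * E + F * X') + \<beta> * E^3 * H) Q" .
    define i where "i = n + m"
    note dX = dX[folded i_def]
    have p2: "degree (p * r) \<le> 2 * i" if "degree p \<le> i" "degree r \<le> i" for p r :: "'k poly"
      using dm[OF that] by simp
    have p3: "degree (p * r) \<le> 3 * i" if "degree p \<le> 2 * i" "degree r \<le> i" for p r :: "'k poly"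
      using dm[OF that] by simp
    have p4: "degree (p * r) \<le> 4 * i" if "degree p \<le> i" "degree r \<le> 3 * i" for p r :: "'k poly"
      using dm[OF that] by simp
    have p22: "degree (p * r) \<le> 4 * i" if "degree p \<le> 2 * i" "degree r \<le> 2 * i" for p r :: "'k poly"
      using dm[OF that] by simp
    have E2: "degree (E^2) \<le> 2 * i" "degree (F^2) \<le> 2 * i"
      unfolding power2_eq_square using dX p2 by auto
    have E3: "degree (E^3) \<le> 3 * i"
      using p3[OF E2(1) dX(3)] by (simp add: power2_eq_square power3_eq_cube)
    have dN: "degree N \<le> 3 * i"
      unfolding N using E2 E3 dX p3 p2 by (intro degree_add_le) auto
    have dQ: "degree Q \<le> 4 * i"
      unfolding Q using p4[OF dX(5) E3] by (simp add: mult.commute)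
    have dEN: "degree (E * N) \<le> 4 * i"
      using p4 dX dN by blast
    have "degree (\<beta> * (E^3 * H)) \<le> degree \<beta> + 4 * i"
      using dQ by (intro dm) (auto simp: Q)
    moreover have "degree ((F + E) * N) \<le> 4 * i"
      using dX dN by (intro p4 degree_add_le)
    moreover have "degree (E^2 * (Y' * E + F * X')) \<le> 4 * i"
      using E2 dX p2 by (intro p22 degree_add_le) auto
    ultimately have dY: "degree ((F + E) * N + E^2 * (Y' * E + F * X') + \<beta> * E^3 * H) \<le> 4 * i + degree \<beta>"
      by (intro degree_add_le) (auto simp: mult.assoc)
    have i: "4 * n + (4 * m + degree \<beta>) = 4 * i + degree \<beta>"
      by (simp add: i_def)
    show "height_le (4 * n + (4 * m + degree \<beta>)) (l^2 + l + x + x0)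
        ((l + 1) * (l^2 + l + x + x0) + (y + l * x) + to_fract \<beta>)"
      unfolding x3[symmetric] Y3 unfolding X3 i height_le_def
      using Q0 dEN dY dQ trans_le_add1 by blast
  qed
qed

section \<open>The curve with \<open>B = 1 + t\<^bsup>q+1\<^esup>\<close>\<close>

lemma order_le_one:
  fixes p :: "'k::field poly"
  assumes "p \<noteq> 0" "poly p a = 0 \<Longrightarrow> poly (pderiv p) a \<noteq> 0"
  shows "order a p \<le> 1"
proof (rule ccontr)
  assume "\<not> order a p \<le> 1"
  hence "[:-a, 1:]^2 dvd p"
    by (simp add: order_divides)
  then obtain s where "p = [:-a, 1:]^2 * s"
    by (elim dvdE)
  hence s: "p = [:-a, 1:] * ([:-a, 1:] * s)"
    by (simp only: power2_eq_square mult.assoc)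
  have "poly p a = 0" "poly (pderiv p) a = 0"
    unfolding s by (simp_all add: pderiv_mult del: mult_pCons_left)
  thus False
    using assms(2) by blast
qed

lemma card_roots_eq_degree:
  fixes p :: "'k::alg_closed_field poly"
  assumes "p \<noteq> 0" "\<And>a. order a p \<le> 1"
  shows "finite {a. poly p a = 0} \<and> card {a. poly p a = 0} = degree p"
  using assms
proof (induction "degree p" arbitrary: p rule: less_induct)
  case less
  show ?case
  proof (cases "degree p = 0")
    case True
    then obtain a where "p = [:a:]"
      by (metis degree_eq_zeroE)
    thus ?thesis
      using less.prems by simp
  next
    case False
    then obtain c where "poly p c = 0"
      using alg_closed_imp_poly_has_root by blast
    then obtain s where s: "p = [:-c, 1:] * s"
      by (metis dvdE poly_eq_0_iff_dvd)
    have s0: "s \<noteq> 0"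
      using less.prems s by auto
    have ord: "order a p = order a [:-c, 1:] + order a s" for a
      unfolding s using less.prems s by (intro order_mult) auto
    have "order c [:-c, 1:] = 1"
      using order_power_n_n[of c 1] by simp
    hence "order c s = 0"
      using ord[of c] less.prems(2)[of c] by simp
    hence c: "poly s c \<noteq> 0"
      using s0 by (simp add: order_root)
    have "order a s \<le> 1" for a
      using ord[of a] less.prems(2)[of a] by simp
    moreover have deg: "degree p = Suc (degree s)"
      using s0 unfolding s by (subst degree_mult_eq) auto
    ultimately have IH: "finite {a. poly s a = 0}" "card {a. poly s a = 0} = degree s"
      using less.hyps[of s] s0 by simp_all
    have "{a. poly p a = 0} = insert c {a. poly s a = 0}"
      unfolding s by auto
    thus ?thesis
      using IH c deg by simp
  qed
qed

lemma frobenius_add: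
  fixes a c :: "'a::{comm_ring_1,char_two}"
  shows "(a + c) ^ (2 ^ n) = a ^ (2 ^ n) + c ^ (2 ^ n)"
proof (induction n)
  case (Suc n)
  have "(a + c) ^ (2 ^ Suc n) = ((a + c) ^ (2 ^ n))^2"
    by (simp add: mult.commute flip: power_mult)
  also have "\<dots> = a ^ (2 ^ Suc n) + c ^ (2 ^ Suc n)"
    unfolding Suc by (simp add: square_add_char_two mult.commute flip: power_mult)
  finally show ?case .
qed simp

lemma subfield_ring_of_type_algebra:
  fixes F :: "'k::{field,char_two} set"
  assumes F: "subfield_set F"
  shows "subfield F (ring_of_type_algebra :: 'k ring)"
proof -
  let ?R = "ring_of_type_algebra :: 'k ring"
  interpret field ?R
    by (rule field_from_type_algebra)
  have minus: "\<ominus>\<^bsub>?R\<^esub> x = x" for x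
    by (rule minus_equality) (simp_all add: ring_of_type_algebra_def)
  have inv: "inv\<^bsub>?R\<^esub> x = 1 / x" if "x \<noteq> 0" for x
    using that comm_inv_char[of x "1 / x"] by (simp add: ring_of_type_algebra_def)
  have "subring F ?R"
    using F by (intro subringI) (simp_all add: minus, simp_all add: subfield_set_def ring_of_type_algebra_def)
  thus ?thesis
  proof (rule subfieldI')
    fix k assume "k \<in> F - {\<zero>\<^bsub>?R\<^esub>}"
    hence "k \<in> F" "k \<noteq> 0"
      by (simp_all add: ring_of_type_algebra_def)
    thus "inv\<^bsub>?R\<^esub> k \<in> F"
      using F inv by (simp add: subfield_set_def)
  qed
qed

section \<open>Points: the action of \<sigma> and heights\<close>

fun map_point :: "('a \<Rightarrow> 'b) \<Rightarrow> 'a point \<Rightarrow> 'b point" where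
  "map_point f Infinity = Infinity"
| "map_point f (Affine x y) = Affine (f x) (f y)"

lemma (in coeff_hom) map_point_add:
  assumes "\<sigma> B = B"
  shows "map_point \<sigma> (point_add (triangular B) P Q) = point_add (triangular B) (map_point \<sigma> P) (map_point \<sigma> Q)"
proof (cases P; cases Q)
  fix x1 y1 x2 y2 assume PQ: "P = Affine x1 y1" "Q = Affine x2 y2"
  have num: "\<sigma> 2 = 2" "\<sigma> 3 = 3"
    using sigma_add[of 1 1] sigma_add[of 1 2] by simp_all
  have minus: "\<sigma> (x - y) = \<sigma> x - \<sigma> y" for x y
    using sigma_add[of x "- y"] by (simp add: sigma_uminus)
  have eq: "(\<sigma> y2 = - \<sigma> y1 - \<sigma> x - B) = (y2 = - y1 - x - B)" for x
    using sigma_inj[of y2 "- y1 - x - B"] by (simp only: minus sigma_uminus assms)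
  show ?thesis
    unfolding PQ
    by (cases "x1 = x2 \<and> y2 = - y1 - x1 - B"; cases "x1 = x2")
      (simp_all add: eq sigma_inj Let_def sigma_add minus sigma_uminus sigma_mult sigma_divide num assms
        power2_eq_square)
qed simp_all

fun hle :: "nat \<Rightarrow> 'k::field_gcd poly fract point \<Rightarrow> bool" where
  "hle n Infinity = True"
| "hle n (Affine x y) = height_le n x y"

lemma hle_mono: "hle n P \<Longrightarrow> n \<le> m \<Longrightarrow> hle m P"
  by (cases P) (auto intro: height_le_mono)

lemma hle_exists: "\<exists>n. hle n P"
  using height_le_exists by (cases P) auto

text \<open>Outside the chord case, \<open>P\<close> is Infinity, \<open>D\<close> or the negative
  of \<open>D\<close>; the heights of these sums are absorbed into the constant.\<close>

lemma hle_add: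
  fixes D :: "'k::{field_gcd,char_two} poly fract point" and \<beta> :: "'k poly"
  assumes D: "on_curve (triangular (to_fract \<beta>)) D"
  shows "\<exists>C. \<forall>n P. on_curve (triangular (to_fract \<beta>)) P \<longrightarrow> hle n P \<longrightarrow>
    hle (4 * n + C) (point_add (triangular (to_fract \<beta>)) P D)"
proof (cases D)
  case Infinity
  have "point_add (triangular (to_fract \<beta>)) P Infinity = P" for P
    by (cases P) simp_all
  thus ?thesis
    by (intro exI[of _ 0]) (auto simp: Infinity intro: hle_mono)
next
  case (Affine x0 y0)
  define B where "B = to_fract \<beta>"
  obtain C where C: "\<And>n x y l. height_le n x y \<Longrightarrow> x \<noteq> x0 \<Longrightarrow> l = (y + y0) / (x + x0) \<Longrightarrow>
    height_le (4 * n + C) (l^2 + l + x + x0) ((l + 1) * (l^2 + l + x + x0) + (y + l * x) + B)"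
    using height_le_translate[of x0 y0 \<beta>] unfolding B_def by blast
  obtain C1 where C1: "hle C1 D"
    using hle_exists by blast
  obtain C2 where C2: "hle C2 (point_add (triangular B) D D)"
    using hle_exists by blast
  show ?thesis
    unfolding B_def[symmetric]
  proof (intro exI[of _ "C + C1 + C2"] allI impI)
    fix n P assume P: "on_curve (triangular B) P" "hle n P"
    show "hle (4 * n + (C + C1 + C2)) (point_add (triangular B) P D)"
    proof (cases P)
      case Infinity
      thus ?thesis
        using C1 hle_mono by fastforce
    next
      case P': (Affine x y)
      show ?thesis
      proof (cases "x = x0")
        case False
        define l where "l = (y + y0) / (x + x0)"
        have "hle (4 * n + C) (Affine (l^2 + l + x + x0) ((l + 1) * (l^2 + l + x + x0) + (y + l * x) + B))"
          using C[OF _ False l_def] P by (simp add: P')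
        also have "Affine (l^2 + l + x + x0) ((l + 1) * (l^2 + l + x + x0) + (y + l * x) + B)
            = point_add (triangular B) P D"
          using False by (simp add: P' Affine Let_def l_def add.commute[of x0 x] add.commute[of y0 y] add.assoc)
        finally show ?thesis
          by (rule hle_mono) simp
      next
        case True
        have "(y + y0) * (y0 + (y + x + B)) = (y^2 + x*y + B*y) + (y0^2 + x*y0 + B*y0)"
          by (simp add: char_two_expand)
        also have "\<dots> = 0"
          using P(1) D True by (simp add: P' Affine B_def)
        finally consider "y = y0" | "y0 = y + x + B"
          by (auto simp: add_eq_0_iff_char_two)
        thus ?thesis
        proof cases
          case 1
          hence "P = D"
            using True P' Affine by simp
          thus ?thesis
            using C2 by (auto intro: hle_mono)
        next
          case 2
          hence "point_add (triangular B) P D = Infinity"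
            using True by (simp add: P' Affine add.assoc)
          thus ?thesis
            by simp
        qed
      qed
    qed
  qed
qed

text \<open>The three expressions are pairwise incongruent modulo 3. They will be the valuations of
  p^2 r, r^2 s and s^2 p at t = 0.\<close>

lemma mod_3_cyclic:
  fixes a b c :: int
  assumes "[a + b + c = 2] (mod 3)"
  shows "3 dvd 2 * a + b \<or> 3 dvd 2 * b + c \<or> 3 dvd 2 * c + a"
proof -
  obtain k where k: "a + b + c = 2 + 3 * k"
    using assms unfolding cong_iff_dvd_diff by (auto elim!: dvdE simp: algebra_simps)
  define e where "e = b - a"
  have "2 * a + b = e + 3 * a" "2 * b + c = (e + 2) + 3 * k" "2 * c + a = (e + 1) + 3 * (2 * k + 1 - b)"
    using k by (simp_all add: e_def)
  moreover have "3 dvd e \<or> 3 dvd e + 2 \<or> 3 dvd e + 1"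
    by presburger
  ultimately show ?thesis
    by (metis dvd_add_times_triv_right_iff mult.commute)
qed

text \<open>Over the denominator 9 the losses add up to d + 3 d + 9 d = 13 d, so the left side is at
  most (4 n + c + 13 d) / 9, and hence at most 5 n / 9.\<close>

lemma height_bound:
  fixes n c d :: nat
  assumes "c + 13 * d \<le> n"
  shows "((4 * n + c + d) div 3 + d) div 3 + d \<le> n"
proof -
  have "3 * ((4 * n + c + d) div 3) \<le> 4 * n + c + d"
    "3 * (((4 * n + c + d) div 3 + d) div 3) \<le> (4 * n + c + d) div 3 + d"
    by simp_all
  thus ?thesis
    using assms by linarith
qed

lemma four_power_mod_3: "(4::nat) ^ j mod 3 = 1"
  by (induction j) (simp_all add: mod_mult_right_eq[symmetric])

locale power_curve =
  fixes j :: nat and w :: "bit alg_closure"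
  assumes j: "0 < j" and w: "w^2 + w + 1 = 0"
begin

text \<open>As q is congruent to 1 modulo 3, not only is d congruent to 2, but q - 1 is divisible by
  3, as the explicit points require.\<close>

definition q :: nat where "q = 4 ^ j"
definition d :: nat where "d = q + 1"
definition t :: "bit alg_closure poly fract" where "t = to_fract [:0, 1:]"
definition \<beta> :: "bit alg_closure poly" where "\<beta> = monom 1 d + 1"
definition F :: "bit alg_closure set" where "F = {c. c ^ (q^2) = c}"
definition Z :: "bit alg_closure set" where "Z = {\<zeta>. \<zeta> ^ d = 1}"

lemma q_ge: "4 \<le> q"
  using j power_increasing[of 1 j "4::nat"] by (simp add: q_def)

lemma d_mod: "[int d = 2] (mod 3)"
proof -
  have "d mod 3 = 2"
    using four_power_mod_3[of j] by (simp add: d_def q_def mod_Suc)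
  hence "int d mod 3 = 2"
    by presburger
  thus ?thesis
    by (simp add: cong_def)
qed

lemma q_two: "q = 2 ^ (2 * j)" "q^2 = 2 ^ (4 * j)"
proof -
  show *: "q = 2 ^ (2 * j)"
    by (simp add: q_def power_mult)
  show "q^2 = 2 ^ (4 * j)"
    unfolding * by (simp flip: power_mult)
qed

lemma t_power: "t ^ n = to_fract (monom 1 n)"
  by (simp add: t_def monom_altdef flip: to_fract_power)

lemma of_nat_d: "of_nat d = (1 :: bit alg_closure)"
  using j by (simp add: d_def q_def)

lemma of_nat_q: "of_nat (q^2) = (0 :: bit alg_closure)"
  using j by (simp add: q_def)

lemma d_pos: "0 < d"
  by (simp add: d_def)

lemma degree_beta: "degree \<beta> = d" and beta_nonzero: "\<beta> \<noteq> 0"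
proof -
  show "degree \<beta> = d"
    using d_pos unfolding \<beta>_def by (subst degree_add_eq_left) (simp_all add: degree_monom_eq)
  thus "\<beta> \<noteq> 0"
    using d_pos by auto
qed

text \<open>\<open>\<beta>\<close> is separable because d is odd, and its roots are the d-th roots
  of unity because -1 = 1.\<close>

lemma order_beta: "order c \<beta> = (if c \<in> Z then 1 else 0)"
proof -
  have root: "poly \<beta> c = 0 \<longleftrightarrow> c \<in> Z"
    by (simp add: \<beta>_def Z_def poly_monom add_eq_0_iff_char_two)
  have "order c \<beta> \<le> 1"
  proof (rule order_le_one[OF beta_nonzero])
    assume "poly \<beta> c = 0"
    hence "c \<noteq> 0"
      using root d_pos by (auto simp: Z_def power_0_left)
    thus "poly (pderiv \<beta>) c \<noteq> 0"
      by (simp add: \<beta>_def pderiv_add pderiv_monom poly_monom of_nat_d)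
  qed
  moreover have "order c \<beta> = 0 \<longleftrightarrow> c \<notin> Z"
    using root beta_nonzero order_root[of \<beta> c] by blast
  ultimately show ?thesis
    by auto
qed

lemma Z_finite: "finite Z" and card_Z: "card Z = d" and one_in_Z: "1 \<in> Z"
proof -
  have "{c. poly \<beta> c = 0} = Z"
    by (auto simp: \<beta>_def Z_def poly_monom add_eq_0_iff_char_two)
  moreover have "order c \<beta> \<le> 1" for c
    by (simp add: order_beta)
  ultimately show "finite Z" "card Z = d"
    using card_roots_eq_degree[OF beta_nonzero] degree_beta by auto
  show "1 \<in> Z"
    by (simp add: Z_def)
qed

lemma card_F: "card F = q^2" and finite_F: "finite F"
proof -
  \<comment> \<open>The derivative of X^(q^2) + X is 1, so this polynomial has q^2 distinct
    roots.\<close>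
  define p :: "bit alg_closure poly" where "p = monom 1 (q^2) + [:0, 1:]"
  have q2: "1 < q^2"
    using q_ge mult_le_mono[OF q_ge q_ge] by (simp add: power2_eq_square)
  have deg: "degree p = q^2"
    unfolding p_def using q2 by (subst degree_add_eq_left) (simp_all add: degree_monom_eq)
  have p0: "p \<noteq> 0"
    using deg q2 by auto
  have "pderiv p = 1"
    using of_nat_q by (simp add: p_def pderiv_add pderiv_monom pderiv_pCons one_pCons)
  hence "order c p \<le> 1" for c
    by (intro order_le_one[OF p0]) simp
  moreover have "{c. poly p c = 0} = F"
    by (auto simp: p_def F_def poly_monom add_eq_0_iff_char_two)
  ultimately show "card F = q^2" "finite F"
    using card_roots_eq_degree[OF p0] deg by auto
qed

lemma Z_subset_F: "Z \<subseteq> F"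
proof
  fix \<zeta> assume "\<zeta> \<in> Z"
  hence 1: "\<zeta> ^ d = 1"
    by (simp add: Z_def)
  have "q^2 = d * (q - 1) + 1"
    using q_ge by (simp add: d_def power2_eq_square algebra_simps)
  hence "\<zeta> ^ (q^2) = (\<zeta> ^ d) ^ (q - 1) * \<zeta>"
    by (simp add: power_mult)
  thus "\<zeta> \<in> F"
    by (simp add: 1 F_def)
qed

sublocale coeff_hom "\<lambda>c :: bit alg_closure. c ^ (q^2)"
  by unfold_locales (simp_all add: q_two(2) frobenius_add power_mult_distrib)

lemma val_t_power: "val c (t ^ n) = (if c = 0 then int n else 0)"
  by (simp add: t_power val_to_fract order_0I poly_monom)

lemma val_cube: "x \<noteq> 0 \<Longrightarrow> 3 dvd val c (x^3)"
  by (simp add: val_power)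

lemma beta_fract: "to_fract \<beta> = t ^ d + 1"
  by (simp add: \<beta>_def t_power)

lemma d_not_dvd: "\<not> 3 dvd int d"
  using d_mod by (auto simp: cong_def dvd_eq_mod_eq_0)

sublocale triangular_curve "t ^ d" "to_fract [:w:]"
proof
  show "(to_fract [:w:])^2 + to_fract [:w:] + 1 = 0"
    using w by (simp add: power2_eq_square one_pCons flip: to_fract_mult to_fract_add to_fract_1)
  show "t ^ d + 1 \<noteq> 0"
    using beta_nonzero by (simp flip: beta_fract)
  fix z :: "bit alg_closure poly fract"
  show "z^3 \<noteq> t ^ d"
  proof
    assume z: "z^3 = t ^ d"
    hence "z \<noteq> 0"
      by (auto simp: t_def)
    thus False
      using val_cube[of z 0] d_not_dvd by (simp add: z val_t_power)
  qed
qed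

abbreviation \<omega> :: "bit alg_closure poly fract" where "\<omega> \<equiv> to_fract [:w:]"

lemma B_fract: "B = to_fract \<beta>"
  by (simp add: B_def beta_fract)

lemma val_B: "val c B = (if c \<in> Z then 1 else 0)"
  by (simp add: B_fract val_to_fract beta_nonzero order_beta)

definition K :: "bit alg_closure poly fract set" where "K = rational_functions F"

lemma K_fixed: "K = {x. \<sigma> x = x}"
  unfolding K_def F_def by (rule rational_functions_fixed)

lemma K_subfield: "subfield_set K"
  unfolding K_def F_def by (rule subfield_set_rational_functions)

lemma mp_beta: "mp \<beta> = \<beta>"
  using q_ge by (simp add: \<beta>_def mp_add map_poly_monom)

lemma sigma_B: "\<sigma> B = B"
  by (simp add: B_fract sigma_to_fract mp_beta)

lemma B_in_K: "B \<in> K"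
  using sigma_B by (simp add: K_fixed)

abbreviation E where "E \<equiv> triangular B"

lemma rational_iff: "P \<in> rational_points K E \<longleftrightarrow> on_curve E P \<and> map_point \<sigma> P = P"
  by (cases P) (auto simp: rational_points_def K_fixed)

definition G where "G = mordell_weil_group K E"

sublocale G: comm_group G
  unfolding G_def by (rule comm_group_mordell_weil[OF K_subfield B_in_K])

lemma G_simps: "carrier G = rational_points K E" "x \<otimes>\<^bsub>G\<^esub> y = point_add E x y" "\<one>\<^bsub>G\<^esub> = Infinity"
  by (simp_all add: G_def mordell_weil_group_def)

definition v :: "bit alg_closure \<Rightarrow> bit alg_closure poly fract point \<Rightarrow> int" where
  "v \<zeta> P = val \<zeta> (\<chi> P)"

lemma v_add:
  assumes "on_curve E P" "on_curve E Q"
  shows "[v \<zeta> (point_add E P Q) = v \<zeta> P + v \<zeta> Q] (mod 3)"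
proof -
  obtain k where k: "k \<noteq> 0" "\<chi> P * \<chi> Q = k^3 * \<chi> (point_add E P Q)"
    using chi_add[OF assms] by blast
  have "val \<zeta> (\<chi> P * \<chi> Q) = v \<zeta> P + v \<zeta> Q"
    unfolding v_def by (intro val_mult chi_nonzero)
  moreover have "val \<zeta> (k^3 * \<chi> (point_add E P Q)) = 3 * val \<zeta> k + v \<zeta> (point_add E P Q)"
    using k chi_nonzero by (simp add: v_def val_mult val_power)
  ultimately have "v \<zeta> P + v \<zeta> Q = 3 * val \<zeta> k + v \<zeta> (point_add E P Q)"
    using k(2) by simp
  thus ?thesis
    by (simp add: cong_def)
qed

subsection \<open>Explicit points\<close>

text \<open>With \<open>s = 1 + t / \<zeta>\<close> the ansatz \<open>y = s z\<^sup>3\<close>, \<open>x = s z u\<close> turns the equation of the curve into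
  \<open>z\<^sup>3 + s u\<^sup>3 + z u = s\<^bsup>q\<^esup> + s\<^bsup>q-1\<^esup> + 1\<close>, which is solved by \<open>z = g + 1\<close> and \<open>u = g\<close> if \<open>g\<^sup>3 = s\<^bsup>q-1\<^esup>\<close>.\<close>

definition point :: "bit alg_closure \<Rightarrow> bit alg_closure poly fract point" where
  "point \<zeta> = (let s = to_fract [:1, inverse \<zeta>:]; g = s ^ ((q - 1) div 3)
     in Affine (s * g * (g + 1)) (s * (g + 1)^3))"

lemma point_properties:
  assumes \<zeta>: "\<zeta> \<in> Z"
  shows "point \<zeta> \<in> rational_points K E" "\<zeta>' \<in> Z \<Longrightarrow> [v \<zeta>' (point \<zeta>) = (if \<zeta>' = \<zeta> then 1 else 0)] (mod 3)"
proof -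
  define s m g where s: "s = to_fract [:1, inverse \<zeta>:]" and m: "m = (q - 1) div 3" and g: "g = s ^ m"
  have P: "point \<zeta> = Affine (s * g * (g + 1)) (s * (g + 1)^3)"
    by (simp add: point_def Let_def s g m)
  have \<zeta>0: "\<zeta> \<noteq> 0"
    using \<zeta> d_pos by (auto simp: Z_def power_0_left)
  have m3: "3 * m = q - 1"
    using four_power_mod_3[of j] q_ge unfolding m q_def by presburger
  have "q = 3 * m + 1"
    using m3 q_ge by simp
  hence "s ^ q = s * g^3"
    by (simp add: g power_mult[symmetric] mult.commute)
  moreover have "(s + 1) ^ q = s ^ q + 1"
    unfolding q_two(1) by (simp add: frobenius_add)
  ultimately have sq: "(s + 1) ^ q = s * g^3 + 1"
    by simp
  have "s + 1 = to_fract [:inverse \<zeta>:] * t"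
    by (simp add: s t_def one_pCons flip: to_fract_1 to_fract_add to_fract_mult)
  hence "(s + 1) ^ d = to_fract ([:inverse \<zeta>:] ^ d) * t ^ d"
    by (simp add: power_mult_distrib to_fract_power)
  also have "[:inverse \<zeta>:] ^ d = [:inverse (\<zeta> ^ d):]"
    by (simp add: poly_const_pow power_inverse)
  also have "\<dots> = 1"
    using \<zeta> by (simp add: Z_def one_pCons)
  finally have "t ^ d = (s + 1) ^ q * (s + 1)"
    by (simp add: d_def mult.commute)
  \<comment> \<open>Here t^d = (s + 1)^d because \<zeta>^d = 1, and additivity of the q-th power
    gives B = s^(q+1) + s^q + s; moreover s^q = s g^3.\<close>
  hence B: "B = s^2 * g^3 + s * g^3 + s"
    unfolding B_def sq by (simp add: char_two_expand)
  have \<sigma>s: "\<sigma> s = s"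
  proof -
    have "inverse \<zeta> ^ (q^2) = inverse \<zeta>"
      using \<zeta> Z_subset_F by (auto simp: F_def power_inverse)
    thus ?thesis
      by (simp add: s sigma_to_fract map_poly_pCons)
  qed
  have "\<sigma> (s ^ n) = s ^ n" for n
    by (induction n) (simp_all add: sigma_mult \<sigma>s)
  hence \<sigma>g: "\<sigma> g = g"
    by (simp add: g)
  have "s * (g + 1)^3 * (s * (g + 1)^3 + s * g * (g + 1) + B) = (s * g * (g + 1))^3"
    unfolding B by (simp add: char_two_expand)
  hence "on_curve E (point \<zeta>)"
    unfolding P point_on_curve_iff .
  moreover have "map_point \<sigma> (point \<zeta>) = point \<zeta>"
    by (simp add: P sigma_mult sigma_add \<sigma>s \<sigma>g power3_eq_cube)
  ultimately show "point \<zeta> \<in> rational_points K E"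
    by (simp add: rational_iff)
  assume \<zeta>': "\<zeta>' \<in> Z"
  have s0: "s \<noteq> 0"
    by (simp add: s)
  have "val \<zeta>' s = (if \<zeta>' = \<zeta> then 1 else 0)" if "\<zeta>' \<in> Z" for \<zeta>'
  proof -
    have "[:1, inverse \<zeta>:] = smult (inverse \<zeta>) [:-\<zeta>, 1:]"
      using \<zeta>0 by simp
    hence "order \<zeta>' [:1, inverse \<zeta>:] = order \<zeta>' [:-\<zeta>, 1:]"
      using \<zeta>0 order_smult[of "inverse \<zeta>" \<zeta>' "[:-\<zeta>, 1:]"] by simp
    also have "\<dots> = (if \<zeta>' = \<zeta> then 1 else 0)"
      using order_power_n_n[of \<zeta> 1] by (auto intro!: order_0I simp: add_eq_0_iff_char_two)
    finally show ?thesis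
      by (simp add: s val_to_fract)
  qed
  note vs = this
  \<comment> \<open>This makes y nonzero, so that \<open>\<chi>\<close> is y and its valuation is
    that of s up to a multiple of 3. At \<zeta> the valuation of g is m > 0, hence g \<noteq>
    1.\<close>
  have "g + 1 \<noteq> 0"
  proof
    assume "g + 1 = 0"
    hence "g = 1"
      by (simp add: add_eq_0_iff_char_two)
    hence "val \<zeta> g = 0"
      using val_t_power[of \<zeta> 0] by simp
    moreover have "val \<zeta> g = int m"
      using vs[OF \<zeta>] s0 by (simp add: g val_power)
    ultimately show False
      using m3 q_ge by simp
  qed
  hence "v \<zeta>' (point \<zeta>) = (if \<zeta>' = \<zeta> then 1 else 0) + 3 * val \<zeta>' (g + 1)"
    using s0 vs[OF \<zeta>'] by (simp add: v_def P val_mult val_power)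
  thus "[v \<zeta>' (point \<zeta>) = (if \<zeta>' = \<zeta> then 1 else 0)] (mod 3)"
    by (simp add: cong_def)
qed

lemma torsion_points:
  "Affine 0 0 \<in> rational_points K E" "\<zeta> \<in> Z \<Longrightarrow> v \<zeta> (Affine 0 0) = 2" "\<zeta> \<in> Z \<Longrightarrow> v \<zeta> (Affine 0 B) = 1"
  "triple (Affine 0 0) = Infinity"
  using B_nonzero by (simp_all add: rational_iff v_def val_power val_B Let_def)

subsection \<open>Dividing by 3\<close>

lemma to_fract_smult: "to_fract (smult c p) = to_fract [:c:] * to_fract p"
  by (simp flip: to_fract_mult)

lemma to_fract_w2: "to_fract [:w^2:] = \<omega>^2"
  by (simp add: power2_eq_square flip: to_fract_mult)

text \<open>The equations \<open>p + r + s = 1\<close>, \<open>p r s = b\<close> describe the 3-isogenous curve, with \<open>b = B + 1\<close> in the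
  role of \<open>B\<close> and \<open>x = p r\<close>, \<open>y = p\<^sup>2 r\<close>. The cyclic shift of \<open>(p, r, s)\<close> is translation by a point of
  order 3; since 3 does not divide \<open>d\<close>, exactly one shift makes the valuation of \<open>y\<close> at \<open>t = 0\<close>
  divisible by 3.\<close>

lemma descent_step:
  assumes sum: "p + r + s = 1" and prod: "p * r * s = t ^ d" and dvd: "3 dvd val 0 (p^2 * r)"
    and xy: "x = (p + \<omega>^2*r + \<omega>*s) * (p + \<omega>*r + \<omega>^2*s)" "y = (p + \<omega>^2*r + \<omega>*s)^3"
  shows "\<exists>Q. on_curve E Q \<and> triple Q = Affine x y \<and>
    (\<forall>n. height_le n x y \<longrightarrow> hle (((n + d) div 3 + d) div 3 + d) Q)"
proof -
  define b where b: "b = t ^ d"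
  have b0: "b \<noteq> 0"
    using b_nonzero by (simp add: b)
  have nz: "p \<noteq> 0" "r \<noteq> 0" "s \<noteq> 0"
    using prod b0 by (auto simp: b)
  have "3 dvd val c (p^2 * r)" for c
  proof (cases "c = 0")
    case False
    \<comment> \<open>With x = p r and y = p^2 r this leads to y (y + x + b) = x^3, so
      \<open>val_triangular\<close> applies with b in place of B at all places other than t =
      0.\<close>
    have "p^2 * r + p * r + b = p * r * (p + 1 + s)"
      by (simp add: b prod[symmetric] char_two_expand)
    also have "p + 1 + s = r"
      by (simp flip: sum add: ac_simps)
    finally have "(p^2 * r) * (p^2 * r + p * r + b) = (p * r)^3"
      by (simp add: power_numeral_reduce ac_simps)
    thus ?thesis
      using nz b0 False val_t_power[of c d] by (intro val_triangular) (simp_all add: b)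
  qed (use dvd in simp)
  then obtain Z where Z: "p^2 * r = Z^3"
    using fract_cube_root[of "p^2 * r"] nz by auto
  have Z0: "Z \<noteq> 0"
    using Z nz by auto
  define z1 z2 W where z: "z1 = p + \<omega>^2*r + \<omega>*s" "z2 = p + \<omega>*r + \<omega>^2*s" and W: "W = p * r / Z"
  define Q where Q: "Q = of_hessian (1 / Z, p * r / Z^2)"
  note td = triple_descent[OF sum prod Z]
  have on: "on_curve E Q"
    unfolding Q by (rule of_hessian_on_curve[OF td(1)])
  have triple: "triple Q = Affine x y"
    unfolding Q xy by (rule td(2))
  have "hle (((n + d) div 3 + d) div 3 + d) Q" if h: "height_le n x y" for n
  proof -
    \<comment> \<open>The inverse Fourier transform: it makes p, r and s linear in z1 and
      z2.\<close>
    have "p = (p + r + s) + z1 + z2" "r = (p + r + s) + \<omega> * z1 + \<omega>^2 * z2"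
      "s = (p + r + s) + \<omega>^2 * z1 + \<omega> * z2"
      unfolding z by (simp_all add: omega_expand)
    note inv = this[unfolded sum]
    have "z1^3 + z2^3 + z1 * z2 + 1 = (1 + z1 + z2) * (1 + \<omega> * z1 + \<omega>^2 * z2) * (1 + \<omega>^2 * z1 + \<omega> * z2)"
      by (simp add: omega_expand)
    also have "\<dots> = b"
      unfolding inv[symmetric] b by (rule prod)
    finally have sum': "z1^3 + z2^3 + z1 * z2 + 1 = b" .
    have "z2^3 = (b + 1) + z1 * z2 + z1^3"
      unfolding sum'[symmetric] by (simp add: ac_simps)
    hence z2: "z2^3 = to_fract \<beta> + to_fract 1 * x + to_fract 1 * y"
      by (simp add: xy z b beta_fract)
    have z1: "z1^3 = to_fract 0 + to_fract 0 * x + to_fract 1 * y"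
      by (simp add: xy z)
    have one: "(1 :: bit alg_closure poly fract) = to_fract 1 + to_fract 0 * x + to_fract 0 * y"
      by simp
    have "height_le (n + d) (z1^3 / 1) (z2^3 / 1)"
      by (rule height_le_linear[OF h _ z1 z2 one]) (simp_all add: degree_beta)
    hence h1: "height_le ((n + d) div 3) z1 z2"
      by (intro height_le_cube) simp
    define m where m: "m = (monom 1 d :: bit alg_closure poly)"
    have bm: "b = to_fract m"
      by (simp add: b m t_power)
    have dm: "degree (smult c m) \<le> d" "degree m \<le> d" for c
      unfolding m by (simp_all add: smult_monom degree_monom_le)
    have X: "b * p = to_fract m + to_fract m * z1 + to_fract m * z2"
      "b * r = to_fract m + to_fract (smult w m) * z1 + to_fract (smult (w^2) m) * z2"
      "s = to_fract 1 + to_fract [:w^2:] * z1 + to_fract [:w:] * z2"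
      unfolding inv to_fract_smult to_fract_w2 bm by (simp_all add: algebra_simps)
    \<comment> \<open>Since b = p r s, the cubes p^2 r and p r^2 are quotients of linear forms in z1
      and z2. This permits the second division of the height by 3.\<close>
    have "b * p / s = Z^3"
      using nz by (simp add: b prod[symmetric] Z[symmetric] power2_eq_square)
    moreover have "b * r / s = W^3"
    proof -
      have "W^3 = (p * r)^3 / (p^2 * r)"
        by (simp add: W power_divide Z)
      also have "\<dots> = p * r^2"
        using nz by (simp add: power_numeral_reduce)
      also have "\<dots> = b * r / s"
        using nz by (simp add: b prod[symmetric] power2_eq_square)
      finally show ?thesis ..
    qed
    moreover have "height_le ((n + d) div 3 + d) (b * p / s) (b * r / s)"
      by (rule height_le_linear[OF h1 nz(3) X]) (simp_all add: dm)
    ultimately have h2: "height_le (((n + d) div 3 + d) div 3) Z W"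
      by (intro height_le_cube) simp
    \<comment> \<open>Projectively the Hessian point is (1 : W : Z), so the coordinates of
      \<open>Q\<close> are quotients of linear forms in \<open>Z\<close> and
      \<open>W\<close>.\<close>
    define h where hdef: "h = 1 + Z + W"
    have uv: "1 / Z + p * r / Z^2 + 1 = h / Z"
      using Z0 by (simp add: hdef W field_simps power2_eq_square)
    have h0: "h \<noteq> 0"
    proof
      assume "h = 0"
      hence "Q = Infinity"
        by (simp add: Q uv)
      thus False
        using triple by simp
    qed
    have y: "1 / Z + \<omega> * (p * r / Z^2) + \<omega>^2 = (1 + \<omega> * W + \<omega>^2 * Z) / Z"
      using Z0 by (simp add: W field_simps power2_eq_square)
    have "Q = Affine (B / h) ((B * (1 + \<omega> * W + \<omega>^2 * Z)) / h)"
      unfolding Q of_hessian.simps uv y using Z0 h0 by simp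
    moreover have "height_le (((n + d) div 3 + d) div 3 + d) (B / h) ((B * (1 + \<omega> * W + \<omega>^2 * Z)) / h)"
    proof (rule height_le_linear[OF h2 h0])
      show "B = to_fract \<beta> + to_fract 0 * Z + to_fract 0 * W"
        by (simp add: B_fract)
      show "B * (1 + \<omega> * W + \<omega>^2 * Z)
          = to_fract \<beta> + to_fract (smult (w^2) \<beta>) * Z + to_fract (smult w \<beta>) * W"
        unfolding to_fract_smult to_fract_w2 B_fract by (simp add: algebra_simps)
      show "h = to_fract 1 + to_fract 1 * Z + to_fract 1 * W"
        by (simp add: hdef)
    qed (use degree_smult_le[of _ \<beta>] in \<open>simp_all add: degree_beta\<close>)
    ultimately show ?thesis
      by simp
  qed
  thus ?thesis
    using on triple by blast
qed

text \<open>Away from the roots of B the valuation of y is divisible by 3 by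
  \<open>val_triangular\<close>, so y is a cube z1^3, and then y + x + B = x^3 / y is a cube z2^3.
  It remains to invert the Fourier transform and to find a good cyclic order of p, r, s.\<close>

lemma divide_by_three:
  assumes P: "on_curve E P" and dvd: "\<And>\<zeta>. \<zeta> \<in> Z \<Longrightarrow> 3 dvd v \<zeta> P"
  shows "\<exists>Q. on_curve E Q \<and> triple Q = P \<and>
    (\<forall>n. hle n P \<longrightarrow> hle (((n + d) div 3 + d) div 3 + d) Q)"
proof (cases P)
  case Infinity
  thus ?thesis
    by (intro exI[of _ Infinity]) simp
next
  case (Affine x y)
  have e: "y * (y + x + B) = x^3"
    using P unfolding Affine point_on_curve_iff .
  \<comment> \<open>The points (0, 0) and (0, B) are excluded because \<open>v\<close> takes the
    values 2 and 1 there.\<close>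
  have y: "y \<noteq> 0"
  proof
    assume "y = 0"
    hence "v 1 P = 2"
      using e torsion_points(2)[OF one_in_Z] by (simp add: Affine)
    thus False
      using dvd[OF one_in_Z] by simp
  qed
  have x: "x \<noteq> 0"
  proof
    assume "x = 0"
    hence "y = B"
      using e y by (simp add: add_eq_0_iff_char_two)
    thus False
      using dvd[OF one_in_Z] torsion_points(3)[OF one_in_Z] \<open>x = 0\<close> by (simp add: Affine)
  qed
  have "3 dvd val c y" for c
  proof (cases "c \<in> Z")
    case True
    thus ?thesis
      using dvd[OF True] y by (simp add: v_def Affine)
  next
    case False
    thus ?thesis
      using val_triangular[OF e y B_nonzero] val_B by simp
  qed
  then obtain z1 where z1: "y = z1^3"
    using fract_cube_root y by blast
  define z2 where z2: "z2 = x / z1"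
  have z10: "z1 \<noteq> 0"
    using y z1 by auto
  have xz: "x = z1 * z2"
    using z10 by (simp add: z2)
  have "z2^3 = y + x + B"
    using e y by (simp add: z2 power_divide flip: z1) (metis nonzero_mult_div_cancel_left)
  hence sum: "z1^3 + z2^3 + z1 * z2 = B"
    by (simp add: z1 xz ac_simps)
  \<comment> \<open>The form 1 + z1^3 + z2^3 - 3 z1 z2 splits into these factors over the cube roots
    of unity, and -3 = 1 in characteristic two.\<close>
  define p r s where prs: "p = 1 + z1 + z2" "r = 1 + \<omega>*z1 + \<omega>^2*z2" "s = 1 + \<omega>^2*z1 + \<omega>*z2"
  have prs_sum: "p + r + s = 1"
    unfolding prs by (simp add: omega_expand)
  have "p * r * s = z1^3 + z2^3 + z1 * z2 + 1"
    unfolding prs by (simp add: omega_expand)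
  hence "p * r * s = B + 1"
    by (simp only: sum)
  hence prod: "p * r * s = t ^ d"
    by (simp add: B_def add.assoc)
  have nz: "p \<noteq> 0" "r \<noteq> 0" "s \<noteq> 0"
    using prod b_nonzero by auto
  have z: "p + \<omega>^2*r + \<omega>*s = z1" "p + \<omega>*r + \<omega>^2*s = z2"
    unfolding prs by (simp_all add: omega_expand)
  have "val 0 p + val 0 r + val 0 s = int d"
    using prod nz val_t_power[of 0 d] by (simp add: val_mult flip: prod)
  hence "[val 0 p + val 0 r + val 0 s = 2] (mod 3)"
    using d_mod by simp
  hence "3 dvd 2 * val 0 p + val 0 r \<or> 3 dvd 2 * val 0 r + val 0 s \<or> 3 dvd 2 * val 0 s + val 0 p"
    by (rule mod_3_cyclic)
  then consider "3 dvd val 0 (p^2 * r)" | "3 dvd val 0 (r^2 * s)" | "3 dvd val 0 (s^2 * p)"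
    using nz by (auto simp: val_mult val_power)
  hence "\<exists>Q. on_curve E Q \<and> triple Q = Affine x y \<and>
    (\<forall>n. height_le n x y \<longrightarrow> hle (((n + d) div 3 + d) div 3 + d) Q)"
  proof cases
    case 1
    show ?thesis
      by (rule descent_step[OF prs_sum prod 1]) (simp_all add: z xz z1)
  next
    case 2
    \<comment> \<open>A cyclic shift multiplies z1 and z2 by mutually inverse cube roots of unity,
      which leaves x = z1 z2 and y = z1^3 unchanged.\<close>
    have "r + \<omega>^2*s + \<omega>*p = \<omega> * z1" "r + \<omega>*s + \<omega>^2*p = \<omega>^2 * z2"
      unfolding z[symmetric] by (simp_all add: omega_expand)
    thus ?thesis
      using prs_sum prod 2 xz z1
      by (intro descent_step[of r s p]) (simp_all add: ac_simps power_mult_distrib omega_cube omega_expand)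
  next
    case 3
    have "s + \<omega>^2*p + \<omega>*r = \<omega>^2 * z1" "s + \<omega>*p + \<omega>^2*r = \<omega> * z2"
      unfolding z[symmetric] by (simp_all add: omega_expand)
    thus ?thesis
      using prs_sum prod 3 xz z1
      by (intro descent_step[of s p r]) (simp_all add: ac_simps power_mult_distrib omega_cube omega_expand)
  qed
  thus ?thesis
    by (simp add: Affine)
qed

section \<open>Frobenius descent to the rational points\<close>

lemma map_point_on_curve:
  assumes "on_curve E P"
  shows "on_curve E (map_point \<sigma> P)"
proof (cases P)
  case (Affine x y)
  have "\<sigma> (y * (y + x + B)) = \<sigma> (x^3)"
    using assms unfolding Affine point_on_curve_iff by simp
  thus ?thesis
    unfolding Affine map_point.simps point_on_curve_iff
    by (simp only: sigma_mult sigma_add sigma_B power3_eq_cube)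
qed simp

text \<open>The place \<zeta> is rational over \<open>F\<close>, hence fixed by the
  Frobenius.\<close>

lemma v_map_point:
  assumes "\<zeta> \<in> Z"
  shows "v \<zeta> (map_point \<sigma> P) = v \<zeta> P"
proof -
  have "\<chi> (map_point \<sigma> P) = \<sigma> (\<chi> P)"
  proof -
    have "\<sigma> (B^2) = B^2"
      by (simp only: power2_eq_square[of B] sigma_mult sigma_B)
    thus ?thesis
      by (cases P) simp_all
  qed
  moreover have "\<zeta> ^ (q^2) = \<zeta>"
    using assms Z_subset_F by (auto simp: F_def)
  ultimately show ?thesis
    using val_sigma[OF chi_nonzero, of \<zeta> P] by (simp add: v_def)
qed

text \<open>If \<open>3 Q\<close> is rational, then \<open>Q\<close> and its Frobenius conjugate differ by a point of order dividing 3,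
  and this point is trivial because \<open>v\<close> does not distinguish \<open>Q\<close> from its conjugate.\<close>

lemma rational_if_triple_rational:
  assumes Q: "on_curve E Q" and triple: "triple Q \<in> rational_points K E"
  shows "Q \<in> rational_points K E"
proof -
  \<comment> \<open>\<open>Q\<close> is not yet known to be rational, so the comparison takes place
    in the group over closed constants.\<close>
  define H where "H = mordell_weil_group UNIV E"
  interpret H: comm_group H
    unfolding H_def by (rule comm_group_mordell_weil) (simp_all add: subfield_set_UNIV)
  have carrier: "P \<in> carrier H \<longleftrightarrow> on_curve E P" for P
    by (cases P) (simp_all add: H_def mordell_weil_group_def rational_points_def)
  have mult: "x \<otimes>\<^bsub>H\<^esub> y = point_add E x y" and one: "\<one>\<^bsub>H\<^esub> = Infinity" for x y
    by (simp_all add: H_def mordell_weil_group_def)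
  define Q' where "Q' = map_point \<sigma> Q"
  have QQ': "Q \<in> carrier H" "Q' \<in> carrier H"
    using Q map_point_on_curve by (simp_all add: carrier Q'_def)
  have "triple Q' = map_point \<sigma> (triple Q)"
    by (simp only: Q'_def map_point_add[OF sigma_B])
  also have "\<dots> = triple Q"
    using triple by (simp only: rational_iff)
  finally have eq: "Q' \<otimes>\<^bsub>H\<^esub> Q' \<otimes>\<^bsub>H\<^esub> Q' = Q \<otimes>\<^bsub>H\<^esub> Q \<otimes>\<^bsub>H\<^esub> Q"
    by (simp only: mult)
  define R where "R = Q' \<otimes>\<^bsub>H\<^esub> inv\<^bsub>H\<^esub> Q"
  have R: "R \<in> carrier H"
    using QQ' by (simp add: R_def)
  have Q'_eq: "Q' = R \<otimes>\<^bsub>H\<^esub> Q"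
    using QQ' by (simp add: R_def H.m_assoc)
  have "R \<otimes>\<^bsub>H\<^esub> R \<otimes>\<^bsub>H\<^esub> R \<otimes>\<^bsub>H\<^esub> (Q \<otimes>\<^bsub>H\<^esub> Q \<otimes>\<^bsub>H\<^esub> Q) = Q' \<otimes>\<^bsub>H\<^esub> Q' \<otimes>\<^bsub>H\<^esub> Q'"
    using R QQ' unfolding Q'_eq by (simp add: H.m_ac)
  hence "R \<otimes>\<^bsub>H\<^esub> R \<otimes>\<^bsub>H\<^esub> R = \<one>\<^bsub>H\<^esub>"
    unfolding eq using R QQ' by (metis H.m_closed H.r_cancel_one')
  hence "R \<in> {Infinity, Affine 0 0, Affine 0 B}"
    using three_torsion R by (simp only: mult one carrier)
  moreover have "[v 1 R + v 1 Q = v 1 Q'] (mod 3)"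
    using v_add[of R Q 1] R QQ' unfolding Q'_eq by (simp add: carrier mult cong_sym)
  hence "[v 1 R = 0] (mod 3)"
    using v_map_point[OF one_in_Z, of Q] by (simp add: Q'_def cong_iff_dvd_diff)
  ultimately have "R = \<one>\<^bsub>H\<^esub>"
    using torsion_points(2,3)[OF one_in_Z] by (auto simp: one cong_def)
  hence "Q' = Q"
    using QQ' by (simp add: Q'_eq)
  thus ?thesis
    using Q by (simp add: rational_iff Q'_def)
qed

section \<open>Finite descent sets and the rank\<close>

lemma finite_hle: "finite {P \<in> rational_points K E. hle n P}"
proof -
  have "finite {(x, y). height_le n x y \<and> \<sigma> x = x \<and> \<sigma> y = y}"
    using finite_F unfolding F_def by (rule finite_height)
  hence "finite (insert Infinity ((\<lambda>(x, y). Affine x y) ` {(x, y). height_le n x y \<and> \<sigma> x = x \<and> \<sigma> y = y}))"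
    by simp
  moreover have "{P \<in> rational_points K E. hle n P}
      \<subseteq> insert Infinity ((\<lambda>(x, y). Affine x y) ` {(x, y). height_le n x y \<and> \<sigma> x = x \<and> \<sigma> y = y})"
  proof
    fix P assume "P \<in> {P \<in> rational_points K E. hle n P}"
    thus "P \<in> insert Infinity ((\<lambda>(x, y). Affine x y) ` {(x, y). height_le n x y \<and> \<sigma> x = x \<and> \<sigma> y = y})"
      by (cases P) (auto simp: rational_iff)
  qed
  ultimately show ?thesis
    using finite_subset by blast
qed

lemma pow_three: "P \<in> carrier G \<Longrightarrow> P [^]\<^bsub>G\<^esub> (3::int) = triple P"
proof -
  assume P: "P \<in> carrier G"
  have "P [^]\<^bsub>G\<^esub> (3::int) = P [^]\<^bsub>G\<^esub> (3::nat)"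
    using int_pow_int[of G P 3] by simp
  also have "\<dots> = P \<otimes>\<^bsub>G\<^esub> P \<otimes>\<^bsub>G\<^esub> P"
    using P by (simp add: numeral_3_eq_3)
  finally show ?thesis
    by (simp add: G_simps)
qed

sublocale D: three_descent G Z 1 point v "Affine 0 0"
proof
  show "finite Z" "1 \<in> Z"
    by (rule Z_finite, rule one_in_Z)
  show T: "Affine 0 0 \<in> carrier G"
    using torsion_points(1) by (simp add: G_simps)
  show "Affine 0 0 [^]\<^bsub>G\<^esub> (3::int) = \<one>\<^bsub>G\<^esub>"
    using T torsion_points(4) by (simp only: pow_three G_simps(3))
next
  fix \<zeta> assume \<zeta>: "\<zeta> \<in> Z"
  show "point \<zeta> \<in> carrier G"
    using point_properties(1)[OF \<zeta>] by (simp add: G_simps)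
  show "[v \<zeta> (Affine 0 0) = 2] (mod 3)"
    using torsion_points(2)[OF \<zeta>] by simp
  fix \<zeta>' assume "\<zeta>' \<in> Z"
  thus "[v \<zeta> (point \<zeta>') = (if \<zeta> = \<zeta>' then 1 else 0)] (mod 3)"
    using point_properties(2) \<zeta> by blast
next
  fix \<zeta> P Q assume "P \<in> carrier G" "Q \<in> carrier G"
  thus "[v \<zeta> (P \<otimes>\<^bsub>G\<^esub> Q) = v \<zeta> P + v \<zeta> Q] (mod 3)"
    using v_add by (simp add: G_simps rational_iff)
next
  fix P assume P: "P \<in> carrier G" "P [^]\<^bsub>G\<^esub> (3::int) = \<one>\<^bsub>G\<^esub>" "[v 1 P = 0] (mod 3)"
  hence "P \<in> {Infinity, Affine 0 0, Affine 0 B}"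
    using three_torsion[of P] pow_three[OF P(1)] by (simp add: G_simps rational_iff)
  thus "P = \<one>\<^bsub>G\<^esub>"
    using P(3) torsion_points(2,3)[OF one_in_Z] by (auto simp: G_simps cong_def)
qed

lemma descends_exists:
  assumes P: "P \<in> carrier G"
  shows "\<exists>S. P \<in> S \<and> D.descends S"
proof -
  \<comment> \<open>Residues are taken in {0, 1, 2} and restricted to \<open>Z\<close>, so that only
    finitely many translations \<open>Ds\<close> occur and one constant serves for all of
    them.\<close>
  define N where "N = (\<lambda>R. restrict (\<lambda>\<zeta>. v \<zeta> R mod 3) Z)"
  define Ds where "Ds = (\<lambda>n. inv\<^bsub>G\<^esub> D.comb n) ` (Z \<rightarrow>\<^sub>E {0..<3::int})"
  have Ds: "finite Ds"
    unfolding Ds_def using Z_finite by (intro finite_imageI finite_PiE) auto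
  have "\<exists>C. \<forall>n R. on_curve E R \<longrightarrow> hle n R \<longrightarrow> hle (4 * n + C) (point_add E R x)" if "x \<in> Ds" for x
  proof -
    have "x \<in> carrier G"
      using that by (auto simp: Ds_def)
    thus ?thesis
      using hle_add[of \<beta> x] by (simp add: G_simps rational_iff flip: B_fract)
  qed
  then obtain C where C: "\<And>x n R. x \<in> Ds \<Longrightarrow> on_curve E R \<Longrightarrow> hle n R \<Longrightarrow> hle (4 * n + C x) (point_add E R x)"
    by metis
  define C' where "C' = (\<Sum>x\<in>Ds. C x)"
  have C': "hle (4 * n + C') (point_add E R x)" if "x \<in> Ds" "on_curve E R" "hle n R" for x n R
    using C[OF that] member_le_sum[OF that(1), of C] Ds by (auto simp: C'_def intro: hle_mono)
  obtain n0 where n0: "hle n0 P"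
    using hle_exists by blast
  \<comment> \<open>Large enough to admit \<open>P\<close> itself and to satisfy
    \<open>height_bound\<close>, so that a descent step does not leave the set.\<close>
  define n where "n = n0 + C' + 13 * d"
  define S where "S = {R \<in> rational_points K E. hle n R}"
  have "D.descends S"
    unfolding D.descends_def
  proof (intro conjI ballI)
    show "finite S"
      unfolding S_def by (rule finite_hle)
    show "S \<subseteq> carrier G"
      by (auto simp: S_def G_simps)
    fix R assume "R \<in> S"
    hence R: "R \<in> carrier G" "on_curve E R" "hle n R"
      by (auto simp: S_def G_simps rational_iff)
    define x where "x = inv\<^bsub>G\<^esub> D.comb (N R)"
    have "x \<in> Ds"
      unfolding Ds_def x_def by (intro imageI) (auto simp: N_def)
    have x: "x \<in> carrier G"
      by (simp add: x_def)
    define R' where "R' = point_add E R x"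
    have R': "R' = R \<otimes>\<^bsub>G\<^esub> x" "R' \<in> carrier G"
      using R x by (simp_all add: R'_def flip: G_simps)
    have h: "hle (4 * n + C') R'"
      unfolding R'_def using C' \<open>x \<in> Ds\<close> R by blast
    have R_eq: "R = D.comb (N R) \<otimes>\<^bsub>G\<^esub> R'"
      using R(1) by (simp add: R'(1) x_def G.m_lcomm[of "D.comb (N R)"])
    have "3 dvd v \<zeta> R'" if \<zeta>: "\<zeta> \<in> Z" for \<zeta>
    proof -
      have "[v \<zeta> R = v \<zeta> (D.comb (N R)) + v \<zeta> R'] (mod 3)"
        using D.v_mult[OF \<zeta> _ R'(2), of "D.comb (N R)"] by (simp flip: R_eq)
      moreover have "[v \<zeta> (D.comb (N R)) = v \<zeta> R] (mod 3)"
        using D.v_comb[OF \<zeta>, of "N R"] \<zeta> by (simp add: N_def cong_def)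
      ultimately show ?thesis
        unfolding cong_iff_dvd_diff by presburger
    qed
    then obtain Q where Q: "on_curve E Q" "triple Q = R'"
      "hle (((4 * n + C' + d) div 3 + d) div 3 + d) Q"
      using divide_by_three[of R'] R'(2) h by (auto simp: G_simps rational_iff)
    have QG: "Q \<in> rational_points K E"
    proof (rule rational_if_triple_rational[OF Q(1)])
      show "triple Q \<in> rational_points K E"
        using R'(2) by (simp only: Q(2) G_simps(1))
    qed
    have "((4 * n + C' + d) div 3 + d) div 3 + d \<le> n"
      by (rule height_bound) (simp add: n_def)
    hence "hle n Q"
      by (rule hle_mono[OF Q(3)])
    hence "Q \<in> S"
      using QG by (simp add: S_def)
    moreover have "R = D.comb (N R) \<otimes>\<^bsub>G\<^esub> Q [^]\<^bsub>G\<^esub> (3::int)"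
    proof -
      have "Q [^]\<^bsub>G\<^esub> (3::int) = R'"
        using pow_three[of Q] QG Q(2) by (simp only: G_simps(1))
      thus ?thesis
        using R_eq by simp
    qed
    ultimately show "\<exists>y\<in>S. \<exists>n. R = D.comb n \<otimes>\<^bsub>G\<^esub> y [^]\<^bsub>G\<^esub> (3::int)"
      by blast
  qed
  moreover have "P \<in> S"
    using P hle_mono[OF n0, of n] by (simp add: S_def G_simps n_def)
  ultimately show ?thesis
    by blast
qed

lemma int_rank_G: "int_rank G = enat q"
  using D.int_rank_eq[OF descends_exists] by (simp add: card_Z d_def)

lemma elliptic_curve: "elliptic_curve_over K E"
proof -
  have "discriminant E = B^3 * (B + 1)"
    by (simp add: discriminant_def Let_def power_numeral_reduce algebra_simps)
  also have "B + 1 = t ^ d"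
    by (simp add: B_def add.assoc)
  finally show ?thesis
    using B_nonzero b_nonzero B_in_K K_subfield by (simp add: elliptic_curve_over_def subfield_set_def)
qed

lemma subfield_F: "subfield F (ring_of_type_algebra :: bit alg_closure ring)"
  by (rule subfield_ring_of_type_algebra)
    (simp add: subfield_set_def F_def f_add power_mult_distrib power_divide)

end

theorem corollary5:
  fixes M :: nat
  shows "\<exists>q k :: nat. q = 2 ^ k \<and> q > M \<and>
    (\<exists>F :: bit alg_closure set.
       subfield F (ring_of_type_algebra :: bit alg_closure ring) \<and> card F = q ^ 2 \<and>
       (\<exists>E :: bit alg_closure poly fract weierstrass.
          elliptic_curve_over (rational_functions F) E \<and>
          int_rank (mordell_weil_group (rational_functions F) E) = enat q))"
proof -
  obtain w :: "bit alg_closure" where "poly [:1, 1, 1:] w = 0"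
    using alg_closed_imp_poly_has_root[of "[:1, 1, 1 :: bit alg_closure:]"] by auto
  hence w: "w^2 + w + 1 = 0"
    by (simp add: algebra_simps power2_eq_square)
  interpret power_curve "Suc M" w
    by unfold_locales (simp_all add: w)
  have "M < q"
    using less_exp[of "Suc M"] power_mono[of 2 "4::nat" "Suc M"] by (simp add: q_def)
  thus ?thesis
    using q_two(1) subfield_F card_F elliptic_curve int_rank_G
    unfolding K_def G_def by blast
qed

end
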